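(* Suppose that in the ground model $V$: $\kappa,\sigma,\lambda,\nu$ are cardinals with $\omega < \kappa < \sigma = \sigma^{<\sigma} < \lambda$ and $\kappa = \mathrm{cf}\,\lambda \le \nu$, $\lambda$ is a strong limit cardinal, $\zeta<\kappa$ is an ordinal, and $\kappa \rightarrow (\kappa,\ \zeta)^2$. Let $\mathbf{P}$ be the partial ordering for adding $\nu$ Cohen subsets of $\sigma$. Then in $V^{\mathbf P}$ (i.e., in every generic extension of $V$ by $\mathbf P$), $\lambda \rightarrow (\lambda,\ \zeta)^2$.
   Context: The partial ordering for adding $\nu$ Cohen subsets of $\sigma$ consists of partial functions $p$ from $\nu\times\sigma$ to $\{0,1\}$ with $|\mathrm{dom}\,p|<\sigma$, ordered by extension. For a cardinal $\tau$ and an ordinal $\zeta$, $\tau \rightarrow (\tau,\ \zeta)^2$ means that for every coloring $c:[\tau]^2 \to \{\text{red},\text{green}\}$ there is either a set $X\subseteq\tau$ of cardinality $\tau$ with $c$ constantly red on $[X]^2$, or a set $Y\subseteq \tau$ of order type $\zeta$ with $c$ constantly green on $[Y]^2$. *)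

theory Defs
  imports Main
begin

unbundle cardinal_syntax

section \<open>Cardinals and the partition relation in the ground model\<close>

text \<open>
  The ground model is the universe of HOL sets. As in the library, an ordinal is a well-order
  (up to \<open>=o\<close>) and a cardinal is a relation satisfying \<^const>\<open>Card_order\<close>.
\<close>

definition is_cofinality :: "'a rel \<Rightarrow> 'b rel \<Rightarrow> bool" where
  "is_cofinality k r \<longleftrightarrow>
     Card_order k \<and>
     (\<exists>A \<subseteq> Field r. cofinal A r \<and> |A| =o k) \<and>
     (\<forall>A \<subseteq> Field r. cofinal A r \<longrightarrow> k \<le>o |A| )"

text \<open>Cardinals below \<open>r\<close> are all represented on the type underlying \<open>r\<close>.\<close>

definition strong_limit :: "'a rel \<Rightarrow> bool" where
  "strong_limit r \<longleftrightarrow> (\<forall>m :: 'a rel. Card_order m \<and> m <o r \<longrightarrow> ctwo ^c m <o r)"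

text \<open>The cardinal \<open>r\<^sup><\<^sup>r\<close>: the number of functions from a proper initial segment of \<open>r\<close> into \<open>r\<close>.\<close>

definition weak_power :: "'a rel \<Rightarrow> ('a \<rightharpoonup> 'a) rel" where
  "weak_power r = |{f. \<exists>a \<in> Field r. dom f = Order_Relation.underS r a \<and> ran f \<subseteq> Field r}|"

datatype colour = Red | Green

text \<open>\<open>arrow r z\<close> is \<open>r \<rightarrow> (r, z)\<^sup>2\<close>; only the values of \<open>c\<close> on two-element subsets of
  \<open>Field r\<close> matter.\<close>

definition arrow :: "'a rel \<Rightarrow> 'b rel \<Rightarrow> bool" where
  "arrow r z \<longleftrightarrow>
     (\<forall>c :: 'a set \<Rightarrow> colour.
        (\<exists>X \<subseteq> Field r. |X| =o r \<and> (\<forall>x \<in> X. \<forall>y \<in> X. x \<noteq> y \<longrightarrow> c {x, y} = Red)) \<or>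
        (\<exists>Y \<subseteq> Field r. Restr r Y =o z \<and> (\<forall>x \<in> Y. \<forall>y \<in> Y. x \<noteq> y \<longrightarrow> c {x, y} = Green)))"


section \<open>Adding Cohen subsets\<close>

definition cohen_conds :: "'n rel \<Rightarrow> 's rel \<Rightarrow> ('n \<times> 's \<rightharpoonup> bool) set" where
  "cohen_conds n s = {p. dom p \<subseteq> Field n \<times> Field s \<and> |dom p| <o s}"

text \<open>A smaller condition is a stronger one.\<close>

definition cohen_le :: "('n \<times> 's \<rightharpoonup> bool) \<Rightarrow> ('n \<times> 's \<rightharpoonup> bool) \<Rightarrow> bool" where
  "cohen_le q p \<longleftrightarrow> p \<subseteq>\<^sub>m q"


section \<open>Names\<close>

text \<open>
  A name is a set of pairs (name, condition). A datatype needs a bound on the size of these sets,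
  so they are given as ranges of partial functions on an index type \<open>'i\<close>:
  \<open>('i, 'p) pname\<close> consists of the names that hereditarily have at most \<open>|UNIV :: 'i set|\<close> elements.
\<close>

datatype ('i, 'p) pname = PName "'i \<rightharpoonup> ('i, 'p) pname \<times> 'p"

primrec pelts :: "('i, 'p) pname \<Rightarrow> (('i, 'p) pname \<times> 'p) set" where
  "pelts (PName f) = ran f"

inductive_set pnames :: "'p set \<Rightarrow> ('i, 'p) pname set" for P :: "'p set" where
  "(\<And>s p. (s, p) \<in> pelts t \<Longrightarrow> s \<in> pnames P \<and> p \<in> P) \<Longrightarrow> t \<in> pnames P"

text \<open>The name with set of elements \<open>S\<close>, for \<open>S\<close> of size at most \<open>|UNIV :: 'i set|\<close>.\<close>

definition name_of :: "(('i, 'p) pname \<times> 'p) set \<Rightarrow> ('i, 'p) pname" where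
  "name_of S = PName (SOME f. ran f = S)"

text \<open>
  \<open>check_elem r e a\<close> is the canonical name of the ordinal represented by \<open>a\<close> in the
  well-order \<open>r\<close>, and \<open>check_ord r e\<close> that of the order type of \<open>r\<close> itself (a von Neumann
  ordinal); \<open>e\<close> is the largest condition.
\<close>

definition check_elem :: "'a rel \<Rightarrow> 'p \<Rightarrow> 'a \<Rightarrow> ('i, 'p) pname" where
  "check_elem r e =
     wfrec (r - Id) (\<lambda>f a. name_of ((\<lambda>b. (f b, e)) ` Order_Relation.underS r a))"

definition check_ord :: "'a rel \<Rightarrow> 'p \<Rightarrow> ('i, 'p) pname" where
  "check_ord r e = name_of ((\<lambda>a. (check_elem r e a, e)) ` Field r)"


section \<open>The forcing relation\<close>

definition dense_below :: "'p set \<Rightarrow> ('p \<Rightarrow> 'p \<Rightarrow> bool) \<Rightarrow> 'p \<Rightarrow> 'p set \<Rightarrow> bool" where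
  "dense_below P le p D \<longleftrightarrow> (\<forall>q \<in> P. le q p \<longrightarrow> (\<exists>r \<in> P. le r q \<and> r \<in> D))"

lemma wf_pelts: "wf {(s, t). \<exists>p. (s, p) \<in> pelts t}"
proof (rule wfUNIVI)
  fix Q :: "('i, 'p) pname \<Rightarrow> bool" and x
  assume step: "\<forall>t. (\<forall>s. (s, t) \<in> {(s, t). \<exists>p. (s, p) \<in> pelts t} \<longrightarrow> Q s) \<longrightarrow> Q t"
  show "Q x"
  proof (induction x)
    case (PName f)
    have "Q s" if "(s, p) \<in> ran f" for s p
    proof -
      from that obtain i where "f i = Some (s, p)" by (auto simp: ran_def)
      then have "Some (s, p) \<in> range f" by (metis rangeI)
      then show ?thesis by (rule PName[of "Some (s, p)" "(s, p)" s]) simp_all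
    qed
    then show ?case using step[rule_format, of "PName f"] by auto
  qed
qed

text \<open>
  \<open>forces_eq P le s t p\<close> is \<open>p \<tturnstile> s = t\<close>, and \<open>forces_mem P le s t p\<close> is \<open>p \<tturnstile> s \<in> t\<close>;
  the clauses are those of Kunen (Set Theory, 1980, VII.3.3).
\<close>

function forces_eq ::
  "'p set \<Rightarrow> ('p \<Rightarrow> 'p \<Rightarrow> bool) \<Rightarrow> ('i, 'p) pname \<Rightarrow> ('i, 'p) pname \<Rightarrow> 'p \<Rightarrow> bool" where
  "forces_eq P le s t p \<longleftrightarrow>
     (\<forall>x \<in> pelts s. dense_below P le p
        {q. le q (snd x) \<longrightarrow> (\<exists>y \<in> pelts t. le q (snd y) \<and> forces_eq P le (fst x) (fst y) q)}) \<and>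
     (\<forall>y \<in> pelts t. dense_below P le p
        {q. le q (snd y) \<longrightarrow> (\<exists>x \<in> pelts s. le q (snd x) \<and> forces_eq P le (fst x) (fst y) q)})"
  by pat_completeness auto
termination
  by (relation "inv_image {(s, t). \<exists>p. (s, p) \<in> pelts t} (\<lambda>(P, le, s, t, p). s)")
    (auto intro: wf_pelts wf_inv_image)

declare forces_eq.simps [simp del]

definition forces_mem ::
  "'p set \<Rightarrow> ('p \<Rightarrow> 'p \<Rightarrow> bool) \<Rightarrow> ('i, 'p) pname \<Rightarrow> ('i, 'p) pname \<Rightarrow> 'p \<Rightarrow> bool" where
  "forces_mem P le s t p \<longleftrightarrow>
     dense_below P le p {q. \<exists>y \<in> pelts t. le q (snd y) \<and> forces_eq P le s (fst y) q}"

text \<open>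
  Formulas of the language of set theory with parameters from \<open>'a\<close>, in higher-order abstract
  syntax: a quantifier carries the family of its instances.
\<close>

datatype 'a sform =
    Mem 'a 'a
  | Eq 'a 'a
  | Neg "'a sform"
  | Conj "'a sform" "'a sform"
  | Forall "'a \<Rightarrow> 'a sform"

primrec forces ::
  "'p set \<Rightarrow> ('p \<Rightarrow> 'p \<Rightarrow> bool) \<Rightarrow> ('i, 'p) pname sform \<Rightarrow> 'p \<Rightarrow> bool" where
  "forces P le (Mem s t) = forces_mem P le s t"
| "forces P le (Eq s t) = forces_eq P le s t"
| "forces P le (Neg \<phi>) = (\<lambda>p. \<forall>q \<in> P. le q p \<longrightarrow> \<not> forces P le \<phi> q)"
| "forces P le (Conj \<phi> \<psi>) = (\<lambda>p. forces P le \<phi> p \<and> forces P le \<psi> p)"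
| "forces P le (Forall F) = (\<lambda>p. \<forall>t \<in> pnames P. forces P le (F t) p)"

text \<open>Truth in every generic extension: every condition forces \<open>\<phi>\<close>.\<close>

definition holds_in_extension ::
  "'p set \<Rightarrow> ('p \<Rightarrow> 'p \<Rightarrow> bool) \<Rightarrow> ('i, 'p) pname sform \<Rightarrow> bool" where
  "holds_in_extension P le \<phi> \<longleftrightarrow> (\<forall>p \<in> P. forces P le \<phi> p)"


section \<open>The partition relation as a formula of set theory\<close>

definition Disj :: "'a sform \<Rightarrow> 'a sform \<Rightarrow> 'a sform" where
  "Disj \<phi> \<psi> = Neg (Conj (Neg \<phi>) (Neg \<psi>))"

definition Imp :: "'a sform \<Rightarrow> 'a sform \<Rightarrow> 'a sform" where
  "Imp \<phi> \<psi> = Neg (Conj \<phi> (Neg \<psi>))"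

definition Iff :: "'a sform \<Rightarrow> 'a sform \<Rightarrow> 'a sform" where
  "Iff \<phi> \<psi> = Conj (Imp \<phi> \<psi>) (Imp \<psi> \<phi>)"

definition Exists :: "('a \<Rightarrow> 'a sform) \<Rightarrow> 'a sform" where
  "Exists F = Neg (Forall (\<lambda>x. Neg (F x)))"

definition ForallIn :: "'a \<Rightarrow> ('a \<Rightarrow> 'a sform) \<Rightarrow> 'a sform" where
  "ForallIn A F = Forall (\<lambda>x. Imp (Mem x A) (F x))"

definition ExistsIn :: "'a \<Rightarrow> ('a \<Rightarrow> 'a sform) \<Rightarrow> 'a sform" where
  "ExistsIn A F = Exists (\<lambda>x. Conj (Mem x A) (F x))"

definition Subset :: "'a \<Rightarrow> 'a \<Rightarrow> 'a sform" where
  "Subset A B = ForallIn A (\<lambda>x. Mem x B)"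

definition IsZero :: "'a \<Rightarrow> 'a sform" where
  "IsZero x = Forall (\<lambda>y. Neg (Mem y x))"

definition IsOne :: "'a \<Rightarrow> 'a sform" where
  "IsOne x = Forall (\<lambda>y. Iff (Mem y x) (IsZero y))"

text \<open>\<open>e = {a, b}\<close>\<close>

definition IsUPair :: "'a \<Rightarrow> 'a \<Rightarrow> 'a \<Rightarrow> 'a sform" where
  "IsUPair e a b = Forall (\<lambda>x. Iff (Mem x e) (Disj (Eq x a) (Eq x b)))"

text \<open>\<open>z = (a, b) = {{a}, {a, b}}\<close>\<close>

definition IsOPair :: "'a \<Rightarrow> 'a \<Rightarrow> 'a \<Rightarrow> 'a sform" where
  "IsOPair z a b =
     Exists (\<lambda>u. Exists (\<lambda>v. Conj (IsUPair u a a) (Conj (IsUPair v a b) (IsUPair z u v))))"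

text \<open>\<open>(x, y) \<in> f\<close>\<close>

definition App :: "'a \<Rightarrow> 'a \<Rightarrow> 'a \<Rightarrow> 'a sform" where
  "App f x y = ExistsIn f (\<lambda>z. IsOPair z x y)"

text \<open>\<open>f\<close> is a function with domain \<open>{x. D x}\<close> and values in \<open>{y. R y}\<close>.\<close>

definition IsFun :: "'a \<Rightarrow> ('a \<Rightarrow> 'a sform) \<Rightarrow> ('a \<Rightarrow> 'a sform) \<Rightarrow> 'a sform" where
  "IsFun f D R =
     Conj (ForallIn f (\<lambda>z. Exists (\<lambda>x. Exists (\<lambda>y. Conj (Conj (D x) (R y)) (IsOPair z x y)))))
    (Conj (Forall (\<lambda>x. Imp (D x) (Exists (\<lambda>y. App f x y))))
          (Forall (\<lambda>x. Forall (\<lambda>y. Forall (\<lambda>y'. Imp (Conj (App f x y) (App f x y')) (Eq y y'))))))"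

definition IsBij :: "'a \<Rightarrow> 'a \<Rightarrow> 'a \<Rightarrow> 'a sform" where
  "IsBij f A B =
     Conj (IsFun f (\<lambda>x. Mem x A) (\<lambda>y. Mem y B))
    (Conj (ForallIn B (\<lambda>y. Exists (\<lambda>x. App f x y)))
          (Forall (\<lambda>x. Forall (\<lambda>x'. Forall (\<lambda>y. Imp (Conj (App f x y) (App f x' y)) (Eq x x'))))))"

definition Equipotent :: "'a \<Rightarrow> 'a \<Rightarrow> 'a sform" where
  "Equipotent A B = Exists (\<lambda>f. IsBij f A B)"

text \<open>The set \<open>Y\<close> of ordinals has order type the ordinal \<open>Z\<close>.\<close>

definition HasOrderType :: "'a \<Rightarrow> 'a \<Rightarrow> 'a sform" where
  "HasOrderType Y Z =
     Exists (\<lambda>f. Conj (IsBij f Y Z)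
       (Forall (\<lambda>x. Forall (\<lambda>x'. Forall (\<lambda>y. Forall (\<lambda>y'.
          Imp (Conj (App f x y) (App f x' y')) (Iff (Mem x x') (Mem y y'))))))))"

text \<open>\<open>e \<in> [A]\<^sup>2\<close>\<close>

definition InPairs :: "'a \<Rightarrow> 'a \<Rightarrow> 'a sform" where
  "InPairs e A = ExistsIn A (\<lambda>a. ExistsIn A (\<lambda>b. Conj (Neg (Eq a b)) (IsUPair e a b)))"

text \<open>\<open>c : [L]\<^sup>2 \<rightarrow> {0, 1}\<close>, where 0 is red and 1 is green.\<close>

definition IsColouring :: "'a \<Rightarrow> 'a \<Rightarrow> 'a sform" where
  "IsColouring c L = IsFun c (\<lambda>e. InPairs e L) (\<lambda>i. Disj (IsZero i) (IsOne i))"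

definition Homogeneous :: "'a \<Rightarrow> 'a \<Rightarrow> ('a \<Rightarrow> 'a sform) \<Rightarrow> 'a sform" where
  "Homogeneous c X Col = Forall (\<lambda>e. Imp (InPairs e X) (Exists (\<lambda>i. Conj (Col i) (App c e i))))"

text \<open>\<open>L \<rightarrow> (L, Z)\<^sup>2\<close> for a cardinal \<open>L\<close> and an ordinal \<open>Z\<close>\<close>

definition Arrow :: "'a \<Rightarrow> 'a \<Rightarrow> 'a sform" where
  "Arrow L Z =
     Forall (\<lambda>c. Imp (IsColouring c L)
       (Disj
         (Exists (\<lambda>X. Conj (Subset X L) (Conj (Equipotent X L) (Homogeneous c X IsZero))))
         (Exists (\<lambda>Y. Conj (Subset Y L) (Conj (HasOrderType Y Z) (Homogeneous c Y IsOne))))))"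

end

theory Submission
  imports Defs
begin

text \<open>
  Colourings are treated through their names: \<open>Grn a b p\<close> says that \<open>p\<close> forces the pair \<open>{a, b}\<close> to be
  green, and \<open>Red a b p\<close> that no extension of \<open>p\<close> does. As the forcing adds no short sequences, a green
  set of type \<open>zeta\<close> may be sought in the ground model; assume that no condition forces one.

  For \<open>i\<close> in \<open>kappa\<close> choose increasing sets \<open>C i\<close> of ordinals and coordinates that behave like elementary
  submodels closed under long sequences (here the strong limit hypothesis enters), and an ordinal \<open>d i\<close>
  above the part of \<open>C i\<close> in a suitable block. Along \<open>kappa\<close> build a decreasing sequence of conditions. At
  stage \<open>j\<close> first take a maximal set in \<open>C j\<close> that is green together with \<open>d j\<close>, as in the Erdoes-Rado
  theorem; then \<open>d j\<close> and the condition reflect to a large, pairwise red family. For each \<open>e\<close> in the family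
  extend the condition so that the pairs \<open>{e, d i}\<close> with \<open>i > j\<close> become green whenever possible; the set
  of these \<open>i\<close> and the root of a Delta-system can be made independent of \<open>e\<close>. This colours the pairs
  \<open>{j, i}\<close> of \<open>kappa\<close> in the ground model. A green set of type \<open>zeta\<close> for this colouring gives one in
  \<open>lam\<close>, while a red set of size \<open>kappa\<close> gives a red union of \<open>kappa\<close> many families, of which the
  generic filter selects \<open>lam\<close> many elements: it meets each of \<open>lam\<close> many disjoint pieces of size \<open>sigma\<close>.
\<close>

section \<open>Cardinal arithmetic\<close>

text \<open>The difficulty is that a red pair must stay red for every member of a family, whereas
  only the condition \<open>tot\<close> of the picked member joins the decreasing sequence. Redness
  of \<open>{e, d i}\<close> is therefore recorded at \<open>run e i\<close>, which consists of
  elements of \<open>base\<close> and of elements with coordinate in \<open>C i\<close>: the part in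
  \<open>C i\<close> can be a parameter when \<open>d i\<close> is reflected, and the rest is
  already contained in the current condition. For greenness the picked members suffice, since a
  green set needs only one ordinal per stage. Each stage has two closed sets because the family has
  more elements than \<open>C\<close> and avoids it; it is found inside the larger \<open>E\<close>,
  which also contains \<open>d i\<close> and can therefore decide the colours of the pairs
  \<open>{e, d i}\<close>. The bound \<open>Pow (Pow M)\<close> comes from counting parameters: a
  prescription \<open>F\<close> is a set of triples containing conditions, so over a support of size
  \<open>|M|\<close> the count goes up to a double power, and this cardinal is unchanged by raising
  it to the power \<open>|M|\<close>, as closing off requires.\<close>

lemma card_of_Pow_ctwo: "|Pow A| =o ctwo ^c |A|"
  by (simp add: card_of_Pow_Func cexp_def ctwo_def Field_card_of)

lemma card_of_Pow_Pow: "|A| \<le>o |Pow (Pow A)|"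
  by (rule ordLess_imp_ordLeq[OF ordLess_transitive[OF card_of_Pow card_of_Pow]])

text \<open>With \<open>chi = |Pow (Pow M)|\<close>, the power \<open>chi ^ |M|\<close> is
  \<open>2 ^ (|Pow M| * |M|) = chi\<close>. A nonempty small subset of \<open>C\<close> is the image
  of \<open>M\<close> under a function into \<open>C\<close>.\<close>

lemma card_of_small_subsets:
  fixes M :: "'m set" and C :: "'u set"
  assumes M: "infinite M" and C: "|C| \<le>o |Pow (Pow M)|"
  shows "|{B. B \<subseteq> C \<and> |B| \<le>o |M| }| \<le>o |Pow (Pow M)|"
proof -
  have iPM: "infinite (Pow M)" using M by simp
  have iPPM: "infinite (Pow (Pow M))" using M by simp
  have "{B. B \<subseteq> C \<and> |B| \<le>o |M| } \<subseteq> insert {} ((\<lambda>f. f ` M) ` Func M C)"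
  proof
    fix B assume "B \<in> {B. B \<subseteq> C \<and> |B| \<le>o |M| }"
    then have BC: "B \<subseteq> C" and BM: "|B| \<le>o |M|" by auto
    show "B \<in> insert {} ((\<lambda>f. f ` M) ` Func M C)"
    proof (cases "B = {}")
      case False
      then obtain g where g: "g ` M = B" using BM card_of_ordLeq2[of B M] by auto
      define f where "f = (\<lambda>x. if x \<in> M then g x else undefined)"
      have "f \<in> Func M C" using g BC by (auto simp: f_def Func_def)
      moreover have "f ` M = B" using g by (auto simp: f_def)
      ultimately show ?thesis by blast
    qed simp
  qed
  then have 1: "|{B. B \<subseteq> C \<and> |B| \<le>o |M| }| \<le>o |insert {} ((\<lambda>f. f ` M) ` Func M C)|"
    by (rule card_of_mono1)
  have "|Func M C| \<le>o |Pow (Pow M)|"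
  proof -
    have "|Func M C| = |C| ^c |M|" by (simp add: cexp_def Field_card_of)
    moreover have "|C| ^c |M| \<le>o |Pow (Pow M)| ^c |M|"
      using cexp_mono1[OF C card_of_Card_order] .
    moreover have "|Pow (Pow M)| ^c |M| =o (ctwo ^c |Pow M| ) ^c |M|"
      using cexp_cong1[OF card_of_Pow_ctwo card_of_Card_order] .
    moreover have "(ctwo ^c |Pow M| ) ^c |M| =o ctwo ^c ( |Pow M| *c |M| )"
      by (rule cexp_cprod[OF Card_order_ctwo])
    moreover have "ctwo ^c ( |Pow M| *c |M| ) =o ctwo ^c |Pow M|"
    proof (rule cexp_cong2)
      show "|Pow M| *c |M| =o |Pow M|"
        unfolding cprod_def Field_card_of
        using card_of_Times_infinite[OF iPM _ ordLess_imp_ordLeq[OF card_of_Pow[of M]]] M by auto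
    qed (auto simp: Card_order_ctwo card_of_Card_order cprod_def)
    moreover have "ctwo ^c |Pow M| =o |Pow (Pow M)|"
      using card_of_Pow_ctwo ordIso_symmetric by blast
    ultimately show ?thesis
      by (metis ordIso_imp_ordLeq ordLeq_transitive)
  qed
  then have "|(\<lambda>f. f ` M) ` Func M C| \<le>o |Pow (Pow M)|"
    using card_of_image ordLeq_transitive by blast
  then have "|insert {} ((\<lambda>f. f ` M) ` Func M C)| \<le>o |Pow (Pow M)|"
    using iPPM card_of_Un_ordLeq_infinite_Field[of "|Pow (Pow M)|" "{{}}"]
    by (metis Field_card_of card_of_Card_order card_of_singl_ordLeq insert_is_Un Pow_not_empty)
  with 1 show ?thesis using ordLeq_transitive by blast
qed

section \<open>Closing off under operations on small sets, and large cliques\<close>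

lemma card_of_UN_le:
  assumes "infinite K" "|I| \<le>o |K|" "\<And>i. i \<in> I \<Longrightarrow> |A i| \<le>o |K|"
  shows "|\<Union>i\<in>I. A i| \<le>o |K|"
  using assms card_of_UNION_ordLeq_infinite by blast

lemma card_of_Un_le:
  assumes "infinite K" "|A| \<le>o |K|" "|B| \<le>o |K|"
  shows "|A \<union> B| \<le>o |K|"
  using assms by (metis Field_card_of card_of_Card_order card_of_Un_ordLeq_infinite_Field)

text \<open>The closure is an increasing union along the successor cardinal of \<open>|M|\<close>.
  That cardinal is regular, so a subset of size at most \<open>|M|\<close> is complete at some index
  and its value under \<open>G\<close> is added at the next one; it is at most
  \<open>|Pow M|\<close>, so the union stays small.\<close>

lemma ex_closed_superset:
  fixes M :: "'m set" and G :: "'u set \<Rightarrow> 'u set"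
  assumes M: "infinite M" and C0: "|C0| \<le>o |Pow (Pow M)|"
    and G: "\<And>B. |B| \<le>o |M| \<Longrightarrow> |G B| \<le>o |Pow (Pow M)|"
  shows "\<exists>C. C0 \<subseteq> C \<and> |C| \<le>o |Pow (Pow M)| \<and> (\<forall>B \<subseteq> C. |B| \<le>o |M| \<longrightarrow> G B \<subseteq> C)"
proof -
  let ?K = "Pow (Pow M)"
  let ?r = "cardSuc |M|"
  have iK: "infinite ?K" using M by simp
  have Cr: "Card_order ?r" by (simp add: cardSuc_Card_order card_of_Card_order)
  have wor: "Well_order ?r" using Cr card_order_on_well_order_on by blast
  then have wf: "wf (?r - Id)" using well_order_on_def by blast
  have infF: "infinite (Field ?r)" using M by (simp add: cardSuc_finite[OF card_of_Card_order] Field_card_of)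
  have rle: "|Field ?r| \<le>o |?K|"
  proof -
    have "?r \<le>o |Pow M|" by (rule cardSuc_least[OF card_of_Card_order card_of_Card_order card_of_Pow])
    then show ?thesis using card_of_Field_ordIso[OF Cr] ordIso_ordLeq_trans
        ordLess_imp_ordLeq[OF card_of_Pow[of "Pow M"]] ordLeq_transitive by blast
  qed
  define step where "step X = X \<union> (\<Union>B \<in> {B. B \<subseteq> X \<and> |B| \<le>o |M| }. G B)" for X
  have step: "|step X| \<le>o |?K|" if "|X| \<le>o |?K|" for X
    unfolding step_def
    by (intro card_of_Un_le[OF iK] that card_of_UN_le[OF iK] card_of_small_subsets[OF M that] G) auto
  have "\<exists>f. \<forall>i. f i = C0 \<union> (\<Union>j \<in> {j. (j, i) \<in> ?r - Id}. step (f j))"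
    by (rule dependent_wf_choice[OF wf]) auto
  then obtain f where f: "\<And>i. f i = C0 \<union> (\<Union>j \<in> {j. (j, i) \<in> ?r - Id}. step (f j))" by blast
  have fs: "|f i| \<le>o |?K|" for i
    using wf
  proof (induction i)
    case (less i)
    have "{j. (j, i) \<in> ?r - Id} \<subseteq> Field ?r" by (auto simp: Field_def)
    then have "|{j. (j, i) \<in> ?r - Id}| \<le>o |?K|"
      using ordLeq_transitive[OF card_of_mono1 rle] by simp
    moreover have "|step (f j)| \<le>o |?K|" if "j \<in> {j. (j, i) \<in> ?r - Id}" for j
      by (rule step) (use that less.IH in simp)
    ultimately have "|\<Union>j \<in> {j. (j, i) \<in> ?r - Id}. step (f j)| \<le>o |?K|"
      by (rule card_of_UN_le[OF iK])
    then show ?case by (subst f) (rule card_of_Un_le[OF iK C0])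
  qed
  have sub: "step (f j) \<subseteq> f i" if "(j, i) \<in> ?r - Id" for i j
    using that by (subst (2) f) blast
  have chain: "relChain ?r f"
    unfolding relChain_def
  proof (intro allI impI)
    fix i j assume "(i, j) \<in> ?r"
    then show "f i \<subseteq> f j" using sub[of i j] by (cases "i = j") (auto simp: step_def)
  qed
  let ?C = "\<Union>i \<in> Field ?r. f i"
  have "C0 \<subseteq> ?C"
  proof -
    obtain i where "i \<in> Field ?r" using infF by fastforce
    moreover have "C0 \<subseteq> f i" by (subst f) blast
    ultimately show ?thesis by blast
  qed
  moreover have "|?C| \<le>o |?K|" by (intro card_of_UN_le[OF iK] rle fs)
  moreover have "G B \<subseteq> ?C" if B: "B \<subseteq> ?C" "|B| \<le>o |M|" for B
  proof -
    obtain i where i: "i \<in> Field ?r" "B \<subseteq> f i"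
      using cardSuc_UNION[OF card_of_Card_order _ chain B] M by (auto simp: Field_card_of)
    obtain j where j: "j \<in> Field ?r" "i \<noteq> j" "(i, j) \<in> ?r"
      using infinite_Card_order_limit[OF Cr infF i(1)] by blast
    have "G B \<subseteq> step (f i)" using i B(2) by (auto simp: step_def)
    also have "\<dots> \<subseteq> f j" using j sub by blast
    finally show ?thesis using j by blast
  qed
  ultimately show ?thesis by blast
qed

text \<open>A maximal clique, given by Zorn's lemma, cannot be small, because \<open>ext\<close>
  would supply one more element.\<close>

lemma ex_large_clique:
  fixes K :: "'m set"
  assumes ext: "\<And>X. X \<subseteq> W \<Longrightarrow> |X| \<le>o |K| \<Longrightarrow> \<exists>w \<in> W - X. \<forall>x \<in> X. R x w \<and> R w x"
  shows "\<exists>X \<subseteq> W. (\<forall>x \<in> X. \<forall>y \<in> X. x \<noteq> y \<longrightarrow> R x y) \<and> \<not> |X| \<le>o |K|"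
proof -
  define S where "S = {X. X \<subseteq> W \<and> (\<forall>x \<in> X. \<forall>y \<in> X. x \<noteq> y \<longrightarrow> R x y)}"
  have "\<exists>X \<in> S. \<forall>Y \<in> S. X \<subseteq> Y \<longrightarrow> Y = X"
  proof (rule subset_Zorn')
    fix \<C> assume c: "subset.chain S \<C>"
    have CS: "\<C> \<subseteq> S" and ch: "\<And>X Y. X \<in> \<C> \<Longrightarrow> Y \<in> \<C> \<Longrightarrow> X \<subseteq> Y \<or> Y \<subseteq> X"
      using c unfolding subset.chain_def by fast+
    have "R x y" if xy: "x \<in> X" "y \<in> Y" "X \<in> \<C>" "Y \<in> \<C>" "x \<noteq> y" for x y X Y
    proof -
      obtain Z where "Z \<in> \<C>" "x \<in> Z" "y \<in> Z"
        using ch[OF \<open>X \<in> \<C>\<close> \<open>Y \<in> \<C>\<close>] xy by blast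
      then show ?thesis using CS \<open>x \<noteq> y\<close> unfolding S_def by blast
    qed
    then show "\<Union>\<C> \<in> S" using CS unfolding S_def by blast
  qed
  then obtain X where X: "X \<in> S" and mx: "\<And>Y. Y \<in> S \<Longrightarrow> X \<subseteq> Y \<Longrightarrow> Y = X" by blast
  have "\<not> |X| \<le>o |K|"
  proof
    assume "|X| \<le>o |K|"
    then obtain w where w: "w \<in> W - X" "\<forall>x \<in> X. R x w \<and> R w x" using ext[of X] X unfolding S_def by blast
    then have "insert w X \<in> S" using X unfolding S_def by auto
    then show False using mx[of "insert w X"] w by blast
  qed
  then show ?thesis using X unfolding S_def by blast
qed

text \<open>A diagonal argument as in Koenig's theorem: a short cofinal set would allow to diagonalize
  over an enumeration of \<open>weak_power r\<close> of length \<open>r\<close>.\<close>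

lemma regularCard_if_weak_power:
  fixes r :: "'s rel"
  assumes r: "Card_order r" and inf: "infinite (Field r)" and wp: "r =o weak_power r"
  shows "regularCard r"
  unfolding regularCard_def
proof (intro allI impI)
  fix K assume K: "K \<subseteq> Field r \<and> cofinal K r"
  have wor: "Well_order r" using r card_order_on_well_order_on by blast
  have le: "|K| \<le>o r" using K card_of_mono1 card_of_Field_ordIso[OF r] ordLeq_ordIso_trans by blast
  have "\<not> |K| <o r"
  proof
    assume lt: "|K| <o r"
    then obtain a where a: "a \<in> Field r" "|K| =o Restr r (underS r a)"
      using ordLess_iff_ordIso_Restr[OF wor card_of_Well_order] by blast
    have "Field (Restr r (underS r a)) = underS r a"
      using wor by (intro Refl_Field_Restr2) (auto simp: order_on_defs underS_def Field_def)
    then have "|underS r a| =o |K|"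
      using card_of_cong[OF ordIso_symmetric[OF a(2)]] by (simp add: Field_card_of)
    then obtain g where g: "bij_betw g (underS r a) K" using card_of_ordIso by blast
    let ?W = "{f. \<exists>a \<in> Field r. dom f = underS r a \<and> ran f \<subseteq> Field r}"
    have "|Field r| =o |?W|" using wp card_of_Field_ordIso[OF r] ordIso_transitive
      unfolding weak_power_def by blast
    then obtain F where F: "bij_betw F (Field r) ?W" using card_of_ordIso by blast
    \<comment> \<open>Fewer than \<open>|Field r|\<close> indices \<open>b\<close> lie below
      \<open>g x\<close>, so some value differs from all their values at \<open>x\<close>. The
      function collecting such values is missed by the enumeration, since every index lies below
      some \<open>g x\<close>.\<close>
    have "\<exists>y \<in> Field r. \<forall>b. (b, g x) \<in> r \<and> b \<noteq> g x \<longrightarrow> F b x \<noteq> Some y" if "x \<in> underS r a" for x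
    proof (rule ccontr)
      assume n: "\<not> ?thesis"
      have gx: "g x \<in> Field r" using g that K by (auto simp: bij_betw_def)
      have "Field r \<subseteq> (\<lambda>b. the (F b x)) ` underS r (g x)"
        using n by (force simp: underS_def)
      then have "|Field r| \<le>o |underS r (g x)|" using surj_imp_ordLeq by blast
      then show False using card_of_underS[OF r gx]
        by (meson card_of_Field_ordIso not_ordLess_ordIso ordIso_symmetric ordLeq_ordLess_trans r)
    qed
    then obtain h where h: "\<And>x. x \<in> underS r a \<Longrightarrow> h x \<in> Field r"
      "\<And>x b. x \<in> underS r a \<Longrightarrow> (b, g x) \<in> r \<Longrightarrow> b \<noteq> g x \<Longrightarrow> F b x \<noteq> Some (h x)"
      by metis
    define f where "f = (\<lambda>x. if x \<in> underS r a then Some (h x) else None)"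
    have "f \<in> ?W" using a h(1) by (auto simp: f_def dom_def ran_def)
    then obtain b where b: "b \<in> Field r" "F b = f"
      using bij_betw_imp_surj_on[OF F] by (elim equalityE subsetCE imageE) auto
    obtain c where c: "c \<in> K" "b \<noteq> c" "(b, c) \<in> r" using K b by (auto simp: cofinal_def)
    then obtain x where x: "x \<in> underS r a" "g x = c" using g by (auto simp: bij_betw_def)
    then show False using h(2)[of x b] b c by (auto simp: f_def)
  qed
  then show "|K| =o r" using le ordLeq_iff_ordLess_or_ordIso by blast
qed

section \<open>Cohen conditions and closed sets\<close>

lemma card_of_Pow_mono:
  assumes "|A| \<le>o |B|" shows "|Pow A| \<le>o |Pow B|"
proof -
  obtain f where f: "inj_on f A" "f ` A \<subseteq> B" using assms card_of_ordLeq[of A B] by blast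
  then have "inj_on (image f) (Pow A)" "image f ` Pow A \<subseteq> Pow B"
    by (auto simp: inj_on_image_Pow)
  then show ?thesis using card_of_ordLeq[of "Pow A" "Pow B"] by blast
qed

lemma card_of_Times_le:
  assumes "infinite K" "|A| \<le>o |K|" "|B| \<le>o |K|"
  shows "|A \<times> B| \<le>o |K|"
  using assms by (metis Field_card_of card_of_Card_order card_of_Times_ordLeq_infinite_Field)

lemma card_of_finite_le:
  assumes "infinite K" "finite A" shows "|A| \<le>o |K|"
  using ordLess_imp_ordLeq[of "|A|" natLeq] finite_iff_ordLess_natLeq infinite_iff_natLeq_ordLeq
    ordLeq_transitive assms by metis

lemma card_of_Times_bool_le:
  assumes "infinite K" "|A| \<le>o |K|" shows "|A \<times> (UNIV :: bool set)| \<le>o |K|"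
  by (rule card_of_Times_le[OF assms card_of_finite_le[OF assms(1)]]) simp

lemma card_of_image_le: "|A| \<le>o r \<Longrightarrow> |f ` A| \<le>o r"
  using card_of_image ordLeq_transitive by blast

lemma card_of_subset_le: "A \<subseteq> B \<Longrightarrow> |B| \<le>o r \<Longrightarrow> |A| \<le>o r"
  using card_of_mono1 ordLeq_transitive by blast

text \<open>Conditions are represented as graphs, so that extension is inclusion and the limit of a
  chain is its union; \<open>Map.graph\<close> translates from partial maps at the end.\<close>

definition cond :: "'s rel \<Rightarrow> 'c set \<Rightarrow> ('c \<times> bool) set \<Rightarrow> bool" where
  "cond s N p \<longleftrightarrow> single_valued p \<and> fst ` p \<subseteq> N \<and> |p| <o s"

text \<open>Ordinals and coordinates of conditions live in one sum type, so that a single set can be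
  closed under operations on both, in the way of an elementary submodel.\<close>

definition coords :: "('c \<times> bool) set \<Rightarrow> ('l + 'c) set" where
  "coords p = Inr ` fst ` p"

definition restr :: "('l + 'c) set \<Rightarrow> ('c \<times> bool) set \<Rightarrow> ('c \<times> bool) set" where
  "restr C p = {x \<in> p. Inr (fst x) \<in> C}"

lemma coords_iff [simp]: "coords p \<subseteq> C \<longleftrightarrow> (\<forall>x\<in>p. Inr (fst x) \<in> C)"
  by (auto simp: coords_def)

lemma coords_restr [simp]: "coords (restr C p) \<subseteq> C"
  by (auto simp: restr_def)

lemma restr_subset: "restr C p \<subseteq> p"
  by (auto simp: restr_def)

text \<open>Everything that the parameters mention. Requiring this support to lie in a closed set
  replaces membership of the parameters in an elementary submodel.\<close>

definition param_supp ::
  "('l \<times> ('c \<times> bool) set \<times> bool) set \<Rightarrow> 'l set \<Rightarrow> ('c \<times> bool) set \<Rightarrow> ('l + 'c) set \<Rightarrow> ('l + 'c) set" where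
  "param_supp F y r D =
     Inl ` fst ` F \<union> (\<Union>x\<in>F. coords (fst (snd x))) \<union> Inl ` y \<union> coords r \<union> D"

text \<open>Only symmetry and monotonicity of greenness enter the combinatorics, so
  \<open>Grn\<close> is abstract here; it is later instantiated by forcing that the colour is
  one.\<close>

locale cohen =
  fixes s :: "'s rel" and N :: "'c set" and lam :: "'l rel"
    and Grn :: "'l \<Rightarrow> 'l \<Rightarrow> ('c \<times> bool) set \<Rightarrow> bool"
  assumes s_card: "Card_order s" and s_inf: "infinite (Field s)" and s_reg: "regularCard s"
    and lam_card: "Card_order lam" and s_lam: "s <o lam"
    and Grn_sym: "Grn a b p \<Longrightarrow> Grn b a p"
    and Grn_mono: "Grn a b p \<Longrightarrow> p \<subseteq> q \<Longrightarrow> cond s N q \<Longrightarrow> Grn a b q"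
begin

abbreviation cnd where "cnd \<equiv> cond s N"

section \<open>Unions and amalgamation of conditions\<close>

definition below :: "'l \<Rightarrow> 'l \<Rightarrow> bool" where
  "below a b \<longleftrightarrow> a \<noteq> b \<and> (a, b) \<in> lam"

definition Red :: "'l \<Rightarrow> 'l \<Rightarrow> ('c \<times> bool) set \<Rightarrow> bool" where
  "Red a b p \<longleftrightarrow> (\<forall>q. cnd q \<longrightarrow> p \<subseteq> q \<longrightarrow> \<not> Grn a b q)"

lemma Red_sym: "Red a b p \<Longrightarrow> Red b a p"
  unfolding Red_def using Grn_sym by blast

lemma Red_mono: "Red a b p \<Longrightarrow> p \<subseteq> q \<Longrightarrow> Red a b q"
  unfolding Red_def by blast

text \<open>Regularity of \<open>s\<close> bounds the union of fewer than \<open>s\<close>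
  conditions.\<close>

lemma cnd_Union:
  assumes "\<And>p. p \<in> \<F> \<Longrightarrow> cnd p" and "\<And>p q. p \<in> \<F> \<Longrightarrow> q \<in> \<F> \<Longrightarrow> p \<subseteq> q \<or> q \<subseteq> p"
    and "|\<F>| <o s"
  shows "cnd (\<Union>\<F>)"
proof -
  have "single_valued (\<Union>\<F>)"
  proof (rule single_valuedI)
    fix x y z assume "(x, y) \<in> \<Union>\<F>" "(x, z) \<in> \<Union>\<F>"
    then obtain p q where pq: "p \<in> \<F>" "q \<in> \<F>" "(x, y) \<in> p" "(x, z) \<in> q" by blast
    then obtain r where "r \<in> \<F>" "(x, y) \<in> r" "(x, z) \<in> r" using assms(2)[of p q] by blast
    then show "y = z" using assms(1)[of r] by (auto simp: cond_def single_valued_def)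
  qed
  moreover have "fst ` \<Union>\<F> \<subseteq> N" using assms(1) unfolding cond_def by fast
  moreover have "|\<Union>p\<in>\<F>. p| <o s"
    using assms(1) card_of_UNION_ordLess_infinite_Field_regularCard[of s \<F> "\<lambda>p. p"]
      s_card s_inf s_reg assms(3)
    by (simp add: cond_def cinfinite_def)
  ultimately show ?thesis by (simp add: cond_def)
qed

lemma insert_small: "|X| <o s \<Longrightarrow> |insert q X| <o s"
proof -
  assume X: "|X| <o s"
  have "|{q}| <o s"
    by (rule finite_ordLess_infinite[OF card_of_Well_order])
      (use s_card s_inf card_order_on_well_order_on in \<open>auto simp: Field_card_of\<close>)
  then have "|{q} \<union> X| <o s" by (rule card_of_Un_ordLess_infinite_Field[OF s_inf s_card _ X])
  then show ?thesis by simp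
qed

lemma cnd_Un_chain:
  assumes q: "cnd q" and I: "|I| <o s" and f: "\<And>i. i \<in> I \<Longrightarrow> cnd (f i)" "\<And>i. i \<in> I \<Longrightarrow> q \<subseteq> f i"
    and chain: "\<And>i j. i \<in> I \<Longrightarrow> j \<in> I \<Longrightarrow> f i \<subseteq> f j \<or> f j \<subseteq> f i"
  shows "cnd (q \<union> (\<Union>i\<in>I. f i))"
proof -
  have "cnd (\<Union>(insert q (f ` I)))"
  proof (rule cnd_Union)
    show "p \<subseteq> p' \<or> p' \<subseteq> p" if "p \<in> insert q (f ` I)" "p' \<in> insert q (f ` I)" for p p'
      using that by (elim insertE imageE) (simp_all add: f(2) chain)
    show "|insert q (f ` I)| <o s" by (rule insert_small[OF ordLeq_ordLess_trans[OF card_of_image I]])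
  qed (use q f(1) in auto)
  then show ?thesis by simp
qed

text \<open>Two conditions whose domains meet only in the domain of a common part \<open>r\<close>
  agree wherever both are defined.\<close>

lemma cnd_Un:
  assumes p: "cnd p" and q: "cnd q" and r: "r \<subseteq> p" "r \<subseteq> q" "fst ` p \<inter> fst ` q \<subseteq> fst ` r"
  shows "cnd (p \<union> q)"
proof -
  have sp: "single_valued p" and sq: "single_valued q" using p q by (simp_all add: cond_def)
  have pq: "y = z" if "(x, y) \<in> p" "(x, z) \<in> q" for x y z
  proof -
    have "x \<in> fst ` r" using that r(3) by force
    then obtain w where "(x, w) \<in> r" by auto
    then have "(x, w) \<in> p" "(x, w) \<in> q" using r(1,2) by auto
    then show ?thesis
      using single_valuedD[OF sp that(1)] single_valuedD[OF sq that(2)] by simp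
  qed
  have "single_valued (p \<union> q)"
  proof (rule single_valuedI)
    fix x y z assume "(x, y) \<in> p \<union> q" "(x, z) \<in> p \<union> q"
    then show "y = z"
      using pq[of x y z] pq[of x z y] single_valuedD[OF sp, of x y z] single_valuedD[OF sq, of x y z]
      by auto
  qed
  moreover have "|p \<union> q| <o s"
    using p q card_of_Un_ordLess_infinite_Field[OF s_inf s_card, of p q] by (simp add: cond_def)
  ultimately show ?thesis using p q by (auto simp: cond_def)
qed

lemma cnd_subset: "cnd p \<Longrightarrow> q \<subseteq> p \<Longrightarrow> cnd q"
  unfolding cond_def by (meson card_of_mono1 image_mono order_trans ordLeq_ordLess_trans single_valued_subset)

lemma cnd_Un_restr:
  assumes "cnd p" "cnd q" "restr C p \<subseteq> q" "coords q \<subseteq> (C :: ('l + 'c) set)"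
  shows "cnd (p \<union> q)"
  by (rule cnd_Un[OF assms(1,2) restr_subset assms(3)]) (use assms(4) in \<open>force simp: restr_def\<close>)

lemma coords_small: "cnd p \<Longrightarrow> |coords p| <o s"
  unfolding cond_def coords_def image_image by (meson card_of_image ordLeq_ordLess_trans)

section \<open>Reflection into closed sets\<close>

text \<open>\<open>F\<close> prescribes the colours of pairs \<open>{b, d}\<close>; the last three conjuncts of \<open>refl_ok\<close>
  say that \<open>(d, p)\<close> is disjoint from \<open>D\<close> and that no ordinal in \<open>D\<close> can be forced to prolong
  the green set \<open>insert d y\<close>.\<close>

definition refl_ok ::
  "'l set \<Rightarrow> ('l \<times> ('c \<times> bool) set \<times> bool) set \<Rightarrow> 'l set \<Rightarrow> ('c \<times> bool) set \<Rightarrow> ('l + 'c) set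
    \<Rightarrow> 'l \<Rightarrow> ('c \<times> bool) set \<Rightarrow> bool" where
  "refl_ok Bl F y r D d p \<longleftrightarrow>
     cnd p \<and> d \<in> Bl \<and> (\<forall>b\<in>y. below b d) \<and>
     (\<forall>(b, t, c) \<in> F. if c then Grn b d (t \<union> p) else Red b d (t \<union> p)) \<and>
     Inl d \<notin> D \<and> coords p \<inter> D = {} \<and>
     (\<forall>a \<in> Bl. Inl a \<in> D \<longrightarrow> (\<forall>b\<in>y. below b a) \<longrightarrow>
        (\<forall>q. cnd q \<longrightarrow> r \<union> p \<subseteq> q \<longrightarrow> \<not> (Grn a d q \<and> (\<forall>b\<in>y. Grn a b q))))"

abbreviation all_green :: "'l set \<Rightarrow> ('c \<times> bool) set \<Rightarrow> ('c \<times> bool) set \<Rightarrow> bool" where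
  "all_green y r q \<equiv> cnd q \<and> r \<subseteq> q \<and> (\<forall>a\<in>y. \<forall>b\<in>y. a \<noteq> b \<longrightarrow> Grn a b q)"

text \<open>Witnesses for three existential statements: the first clause serves to decide colours,
  the second to find the next member of a reflecting family, and the third, used contrapositively,
  to show that no set of size at most \<open>|Pow (Pow M)|\<close> obstructs reflection. The
  quantified \<open>D\<close> of the third clause hides the parameter \<open>D\<close>.\<close>

definition witnessed_in ::
  "'u set \<Rightarrow> 'l set \<Rightarrow> ('l \<times> ('c \<times> bool) set \<times> bool) set \<Rightarrow> 'l set \<Rightarrow> ('c \<times> bool) set \<Rightarrow> ('l + 'c) set
    \<Rightarrow> ('l + 'c) set \<Rightarrow> bool" where
  "witnessed_in M Bl F y r D W \<longleftrightarrow>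
     ((\<exists>q. all_green y r q) \<longrightarrow> (\<exists>q. all_green y r q \<and> coords q \<subseteq> W)) \<and>
     ((\<exists>d p. refl_ok Bl F y r D d p) \<longrightarrow>
        (\<exists>d p. refl_ok Bl F y r D d p \<and> Inl d \<in> W \<and> coords p \<subseteq> W)) \<and>
     ((\<exists>D. |D| \<le>o |Pow (Pow M)| \<and> \<not> (\<exists>d p. refl_ok Bl F y r D d p)) \<longrightarrow>
        (\<exists>D \<subseteq> W. |D| \<le>o |Pow (Pow M)| \<and> \<not> (\<exists>d p. refl_ok Bl F y r D d p)))"

lemma witnessed_in_mono:
  assumes "witnessed_in M Bl F y r D W" "W \<subseteq> W'" shows "witnessed_in M Bl F y r D W'"
proof -
  have c: "(coords p :: ('l + 'c) set) \<subseteq> W \<Longrightarrow> coords p \<subseteq> W'" for p :: "('c \<times> bool) set"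
    using assms(2) by (rule order_trans[rotated])
  show ?thesis
    unfolding witnessed_in_def
  proof (intro conjI impI)
    assume "\<exists>q. all_green y r q"
    from assms(1)[unfolded witnessed_in_def, THEN conjunct1, THEN mp, OF this]
    show "\<exists>q. all_green y r q \<and> coords q \<subseteq> W'"
      by (elim exE conjE) (intro exI conjI, assumption+, rule c)
  next
    assume "\<exists>d p. refl_ok Bl F y r D d p"
    from assms(1)[unfolded witnessed_in_def, THEN conjunct2, THEN conjunct1, THEN mp, OF this]
    show "\<exists>d p. refl_ok Bl F y r D d p \<and> Inl d \<in> W' \<and> coords p \<subseteq> W'"
      by (elim exE conjE) (intro exI conjI, assumption, rule subsetD[OF assms(2)], assumption, rule c)
  next
    assume "\<exists>D. |D| \<le>o |Pow (Pow M)| \<and> \<not> (\<exists>d p. refl_ok Bl F y r D d p)"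
    from assms(1)[unfolded witnessed_in_def, THEN conjunct2, THEN conjunct2, THEN mp, OF this]
    show "\<exists>D \<subseteq> W'. |D| \<le>o |Pow (Pow M)| \<and> \<not> (\<exists>d p. refl_ok Bl F y r D d p)"
      using assms(2) by (elim exE conjE) (intro exI conjI, rule order_trans, assumption+)
  qed
qed

text \<open>A substitute for an elementary submodel closed under \<open>|M|\<close>-sequences,
  restricted to the three statements of \<open>witnessed_in\<close>.\<close>

definition closed_for :: "'u set \<Rightarrow> 'l set \<Rightarrow> ('l + 'c) set \<Rightarrow> bool" where
  "closed_for M Bl C \<longleftrightarrow> (\<forall>F y r D. param_supp F y r D \<subseteq> C \<and> |param_supp F y r D| \<le>o |M| \<longrightarrow>
     witnessed_in M Bl F y r D C)"

text \<open>The middle entry of a triple in \<open>F\<close> ranges over subsets of a set of size at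
  most \<open>|M|\<close>, so there are at most \<open>|Pow M|\<close> triples, and \<open>F\<close>
  is a set of them; this is where the second power set arises.\<close>

lemma card_of_params:
  fixes M :: "'m set" and B :: "('l + 'c) set"
  assumes M: "infinite M" and B: "|B| \<le>o |M|"
  shows "|{(F, y, r, D). param_supp F y r D \<subseteq> B}| \<le>o |Pow (Pow M)|"
proof -
  let ?L = "Inl -` B" and ?C = "Inr -` B"
  let ?T = "Pow (?L \<times> Pow (?C \<times> (UNIV :: bool set)) \<times> (UNIV :: bool set)) \<times> Pow ?L
      \<times> Pow (?C \<times> (UNIV :: bool set)) \<times> Pow B"
  have iPM: "infinite (Pow M)" and iPP: "infinite (Pow (Pow M))" using M by auto
  have L: "|?L| \<le>o |M|"
    by (rule card_of_subset_le[OF _ card_of_image_le[OF B, of projl]]) force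
  have C: "|?C| \<le>o |M|"
    by (rule card_of_subset_le[OF _ card_of_image_le[OF B, of projr]]) force
  note CU = card_of_Times_bool_le[OF M C]
  have M1: "|Pow M| \<le>o |Pow (Pow M)|" by (rule ordLess_imp_ordLeq[OF card_of_Pow])
  have L': "|?L| \<le>o |Pow M|" by (rule ordLeq_transitive[OF L ordLess_imp_ordLeq[OF card_of_Pow]])
  note P = ordLeq_transitive[OF card_of_Pow_mono M1]
  have "|?T| \<le>o |Pow (Pow M)|"
    by (rule card_of_Times_le[OF iPP card_of_Pow_mono card_of_Times_le[OF iPP P[OF L]
          card_of_Times_le[OF iPP P[OF CU] P[OF B]]]])
      (rule card_of_Times_le[OF iPM L' card_of_Times_le[OF iPM card_of_Pow_mono[OF CU]
          card_of_finite_le[OF iPM]]], simp)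
  moreover have "{(F, y, r, D). param_supp F y r D \<subseteq> B} \<subseteq>
     ?T"
  proof
    fix z :: "('l \<times> ('c \<times> bool) set \<times> bool) set \<times> 'l set \<times> ('c \<times> bool) set \<times> ('l + 'c) set"
    assume "z \<in> {(F, y, r, D). param_supp F y r D \<subseteq> B}"
    then obtain F y r D where z: "z = (F, y, r, D)" and S: "param_supp F y r D \<subseteq> B" by blast
    have "x \<in> ?L \<times> Pow (?C \<times> UNIV) \<times> UNIV" if "x \<in> F" for x
    proof -
      have "Inl (fst x) \<in> B" using S that unfolding param_supp_def by blast
      moreover have "(coords (fst (snd x)) :: ('l + 'c) set) \<subseteq> B"
        using S that unfolding param_supp_def by blast
      ultimately show ?thesis by (cases x) auto
    qed
    moreover have "y \<subseteq> ?L" "D \<subseteq> B" using S unfolding param_supp_def by blast+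
    moreover have "(coords r :: ('l + 'c) set) \<subseteq> B" using S unfolding param_supp_def by blast
    then have "r \<subseteq> ?C \<times> UNIV" by auto
    ultimately show "z \<in> ?T" unfolding z by blast
  qed
  ultimately show ?thesis by (rule card_of_subset_le[rotated])
qed

text \<open>Each clause has a witness of support at most \<open>|Pow (Pow M)|\<close>: conditions
  have size below \<open>s\<close>, and the set in the third clause is bounded by the clause
  itself.\<close>

lemma ex_witnessed_in:
  fixes M :: "'m set" and D :: "('l + 'c) set"
  assumes M: "infinite M" and sM: "s \<le>o |M|"
  shows "\<exists>W. |W| \<le>o |Pow (Pow M)| \<and> witnessed_in M Bl F y r D W"
proof -
  let ?K = "Pow (Pow M)"
  have iK: "infinite ?K" using M by auto
  have small: "|coords p :: ('l + 'c) set| \<le>o |?K|" if "cnd p" for p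
    by (rule ordLess_imp_ordLeq[OF ordLess_ordLeq_trans[OF coords_small[OF that]
          ordLeq_transitive[OF sM card_of_Pow_Pow]]])
  have "\<exists>W. |W| \<le>o |?K| \<and>
     ((\<exists>q. all_green y r q) \<longrightarrow> (\<exists>q. all_green y r q \<and> coords q \<subseteq> (W :: ('l + 'c) set)))"
  proof (cases "\<exists>q. all_green y r q")
    case True
    then obtain q where q: "all_green y r q" by blast
    then have "|coords q :: ('l + 'c) set| \<le>o |?K|" using small by blast
    then show ?thesis using q by blast
  qed (use card_of_empty in blast)
  then obtain W1 :: "('l + 'c) set" where W1: "|W1| \<le>o |?K|"
    "(\<exists>q. all_green y r q) \<longrightarrow> (\<exists>q. all_green y r q \<and> coords q \<subseteq> W1)" by blast
  have "\<exists>W. |W| \<le>o |?K| \<and> ((\<exists>d p. refl_ok Bl F y r D d p) \<longrightarrow>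
      (\<exists>d p. refl_ok Bl F y r D d p \<and> Inl d \<in> W \<and> coords p \<subseteq> W))"
  proof (cases "\<exists>d p. refl_ok Bl F y r D d p")
    case True
    then obtain d p where dp: "refl_ok Bl F y r D d p" by blast
    then have "|coords p :: ('l + 'c) set| \<le>o |?K|" using small by (auto simp: refl_ok_def)
    then have "|{Inl d} \<union> coords p| \<le>o |?K|"
      by (rule card_of_Un_le[OF iK card_of_finite_le[OF iK], rotated]) simp
    then show ?thesis using dp by (intro exI[of _ "{Inl d} \<union> coords p"]) (auto simp: coords_def)
  qed (use card_of_empty in blast)
  then obtain W2 where W2: "|W2| \<le>o |?K|" "(\<exists>d p. refl_ok Bl F y r D d p) \<longrightarrow>
      (\<exists>d p. refl_ok Bl F y r D d p \<and> Inl d \<in> W2 \<and> coords p \<subseteq> W2)" by blast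
  obtain W3 where W3: "|W3| \<le>o |?K|"
    "(\<exists>D. |D| \<le>o |?K| \<and> \<not> (\<exists>d p. refl_ok Bl F y r D d p)) \<longrightarrow>
      (\<exists>D \<subseteq> W3. |D| \<le>o |?K| \<and> \<not> (\<exists>d p. refl_ok Bl F y r D d p))"
    using card_of_empty by (metis order_refl)
  have "|W1 \<union> W2 \<union> W3| \<le>o |?K|" by (intro card_of_Un_le[OF iK] W1 W2 W3)
  then show ?thesis
    unfolding witnessed_in_def
    apply (intro exI[of _ "W1 \<union> W2 \<union> W3"] conjI)
    subgoal .
    subgoal using W1(2) by (meson Un_upper1 order_trans)
    subgoal using W2(2) by (meson Un_iff Un_upper1 Un_upper2 order_trans)
    subgoal using W3(2) by (meson Un_upper2 order_trans)
    done
qed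

text \<open>A Skolem hull: \<open>w\<close> chooses witnesses for each choice of parameters, and
  \<open>G B\<close> collects them for all parameters supported by \<open>B\<close>.\<close>

lemma ex_closed_for:
  fixes M :: "'m set" and C0 :: "('l + 'c) set"
  assumes M: "infinite M" and sM: "s \<le>o |M|" and C0: "|C0| \<le>o |Pow (Pow M)|"
  shows "\<exists>C. C0 \<subseteq> C \<and> |C| \<le>o |Pow (Pow M)| \<and> closed_for M Bl C"
proof -
  let ?K = "Pow (Pow M)"
  have iK: "infinite ?K" using M by auto
  obtain w where w: "\<And>F y r D. |w F y r D| \<le>o |?K| \<and> witnessed_in M Bl F y r D (w F y r D)"
    using ex_witnessed_in[OF M sM] by metis
  define G where "G B = (\<Union>(F, y, r, D) \<in> {(F, y, r, D). param_supp F y r D \<subseteq> B}. w F y r D)" for B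
  have GB: "|G B| \<le>o |?K|" if "|B| \<le>o |M|" for B
    unfolding G_def
  proof (rule card_of_UN_le[OF iK card_of_params[OF M that]])
    fix x :: "('l \<times> ('c \<times> bool) set \<times> bool) set \<times> 'l set \<times> ('c \<times> bool) set \<times> ('l + 'c) set"
    obtain F y r D where "x = (F, y, r, D)" by (rule prod_cases4)
    then show "|case x of (F, y, r, D) \<Rightarrow> w F y r D| \<le>o |?K|" using w by simp
  qed
  have "\<exists>C. C0 \<subseteq> C \<and> |C| \<le>o |?K| \<and> (\<forall>B\<subseteq>C. |B| \<le>o |M| \<longrightarrow> G B \<subseteq> C)"
    by (rule ex_closed_superset[OF M C0]) (rule GB)
  then obtain C where C: "C0 \<subseteq> C" "|C| \<le>o |?K|" and CG: "\<forall>B\<subseteq>C. |B| \<le>o |M| \<longrightarrow> G B \<subseteq> C"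
    by (elim exE conjE)
  have "witnessed_in M Bl F y r D C"
    if ps: "param_supp F y r D \<subseteq> C" "|param_supp F y r D| \<le>o |M|" for F y r D
  proof -
    have "w F y r D \<subseteq> G (param_supp F y r D)"
      unfolding G_def by (rule subsetI, rule UN_I[of "(F, y, r, D)"]) simp_all
    also have "\<dots> \<subseteq> C" using CG ps by simp
    finally show ?thesis by (rule witnessed_in_mono[OF conjunct2[OF w]])
  qed
  then show ?thesis using C unfolding closed_for_def by blast
qed

end

section \<open>Deciding colours and thinning out\<close>

lemma Restr_image_ordIso:
  assumes r: "Well_order r" and z: "Well_order z" and f: "f ` Field z \<subseteq> Field r"
    and mono: "\<And>i j. (i, j) \<in> z \<Longrightarrow> i \<noteq> j \<Longrightarrow> f i \<noteq> f j \<and> (f i, f j) \<in> r"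
  shows "Restr r (f ` Field z) =o z"
proof -
  let ?Y = "f ` Field z"
  have tot: "(i, j) \<in> z \<or> (j, i) \<in> z" if "i \<in> Field z" "j \<in> Field z" for i j
    using z that wo_rel.TOTALS[of z] by (auto simp: wo_rel_def)
  have ref: "(x, x) \<in> r" if "x \<in> Field r" for x
    using r that wo_rel.REFL[of r] by (auto simp: wo_rel_def refl_on_def)
  have refz: "(x, x) \<in> z" if "x \<in> Field z" for x
    using z that wo_rel.REFL[of z] by (auto simp: wo_rel_def refl_on_def)
  have anti: "antisym r" using r wo_rel.ANTISYM[of r] by (auto simp: wo_rel_def)
  have inj: "inj_on f (Field z)"
  proof (rule inj_onI, rule ccontr)
    fix i j assume ij: "i \<in> Field z" "j \<in> Field z" "f i = f j" "i \<noteq> j"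
    show False using tot[OF ij(1,2)] mono[of i j] mono[of j i] ij(3,4) by auto
  qed
  have F: "Field (Restr r ?Y) = ?Y" 
    using f r by (intro Refl_Field_Restr2) (simp_all add: order_on_defs)
  have "iso z (Restr r ?Y) f"
    unfolding iso_iff2 F
  proof (intro conjI ballI)
    show "bij_betw f (Field z) ?Y" using inj by (simp add: bij_betw_def)
    fix i j assume ij: "i \<in> Field z" "j \<in> Field z"
    show "(i, j) \<in> z \<longleftrightarrow> (f i, f j) \<in> Restr r ?Y"
    proof
      assume "(i, j) \<in> z"
      then show "(f i, f j) \<in> Restr r ?Y" using mono[of i j] ij f ref by (cases "i = j") auto
    next
      assume a: "(f i, f j) \<in> Restr r ?Y"
      show "(i, j) \<in> z"
      proof (rule ccontr)
        assume n: "(i, j) \<notin> z"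
        then have "(j, i) \<in> z" "i \<noteq> j" using tot[OF ij] refz ij by auto
        then have "f j \<noteq> f i \<and> (f j, f i) \<in> r" using mono by blast
        then show False using a anti by (auto simp: antisym_def)
      qed
    qed
  qed
  moreover have "Well_order (Restr r ?Y)" using r by (rule Well_order_Restr)
  ultimately have "z =o Restr r ?Y" using z unfolding ordIso_def by blast
  then show ?thesis by (rule ordIso_symmetric)
qed

context cohen
begin

section \<open>Maximal green sets, decided colours and Delta-systems\<close>

lemma lam_wo: "Well_order lam"
  using lam_card card_order_on_well_order_on by blast

lemma below_trans: "below a b \<Longrightarrow> below b c \<Longrightarrow> below a c"
  using lam_wo wo_rel.TRANS[of lam] wo_rel.ANTISYM[of lam]
  unfolding below_def wo_rel_def trans_def antisym_def by metis

text \<open>If the search never got stuck, recursion along \<open>z\<close> would produce an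
  increasing sequence in \<open>Z\<close>, each member green with \<open>d\<close> and with all
  earlier ones; the union of the conditions would force a green set of type \<open>z\<close>,
  against \<open>no_green\<close>.\<close>

lemma ex_stuck_green:
  fixes z :: "'z rel"
  assumes z: "Well_order z" "|Field z| <o s"
    and no_green: "\<And>q Y. cnd q \<Longrightarrow> q0 \<subseteq> q \<Longrightarrow> Y \<subseteq> Field lam \<Longrightarrow> Restr lam Y =o z \<Longrightarrow>
      (\<And>a b. a \<in> Y \<Longrightarrow> b \<in> Y \<Longrightarrow> a \<noteq> b \<Longrightarrow> Grn a b q) \<Longrightarrow> False"
    and q: "cnd q" "q0 \<subseteq> q" and Z: "Z \<subseteq> Field lam"
  shows "\<exists>r y. cnd r \<and> q \<subseteq> r \<and> y \<subseteq> Z \<and> |y| <o s \<and> (\<forall>b\<in>y. Grn b d r) \<and>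
    (\<forall>a\<in>Z. (\<forall>b\<in>y. below b a) \<longrightarrow>
       (\<forall>q. cnd q \<longrightarrow> r \<subseteq> q \<longrightarrow> \<not> (Grn a d q \<and> (\<forall>b\<in>y. Grn a b q))))"
proof (rule ccontr)
  assume neg: "\<not> ?thesis"
  define pre where "pre i = {j. (j, i) \<in> z - Id}" for i
  have pre_F: "pre i \<subseteq> Field z" for i by (auto simp: pre_def Field_def)
  \<comment> \<open>Outside \<open>Field z\<close> the requirement is vacuous, so that the recursion
    can range over the whole type.\<close>
  define P where "P f i x \<longleftrightarrow> (i \<in> Field z \<longrightarrow>
      fst x \<in> Z \<and> cnd (snd x) \<and> q \<subseteq> snd x \<and> Grn (fst x) d (snd x) \<and>
      (\<forall>j \<in> pre i. below (fst (f j)) (fst x) \<and> snd (f j) \<subseteq> snd x \<and> Grn (fst x) (fst (f j)) (snd x)))"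
    for f :: "'z \<Rightarrow> 'l \<times> ('c \<times> bool) set" and i x
  have wf: "wf (z - Id)" using z(1) well_order_on_def by blast
  have tot: "j \<in> pre i \<or> i \<in> pre j \<or> i = j" if "i \<in> Field z" "j \<in> Field z" for i j
    using z(1) that wo_rel.TOTALS[of z] by (auto simp: wo_rel_def pre_def)
  have union: "cnd (q \<union> (\<Union>j\<in>I. snd (f j)))" 
    if I: "I \<subseteq> Field z" and f: "\<And>j. j \<in> I \<Longrightarrow> P f j (f j)" for f I
  proof (rule cnd_Un_chain[OF q(1) ordLeq_ordLess_trans[OF card_of_mono1[OF I] z(2)]])
    show "cnd (snd (f j))" "q \<subseteq> snd (f j)" if "j \<in> I" for j
      using f[OF that] subsetD[OF I that] unfolding P_def by blast+
    show "snd (f i) \<subseteq> snd (f j) \<or> snd (f j) \<subseteq> snd (f i)" if "i \<in> I" "j \<in> I" for i j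
      using tot[of i j] that f I unfolding P_def by blast
  qed
  have "\<exists>f. \<forall>i. P f i (f i)"
  proof (rule dependent_wf_choice[OF wf])
    fix f g :: "'z \<Rightarrow> 'l \<times> ('c \<times> bool) set" and x r
    assume "\<And>w. (w, x) \<in> z - Id \<Longrightarrow> f w = g w"
    then have "\<And>w. w \<in> pre x \<Longrightarrow> f w = g w" by (simp add: pre_def)
    then show "P f x r = P g x r" unfolding P_def by auto
  next
    fix i and f :: "'z \<Rightarrow> 'l \<times> ('c \<times> bool) set"
    assume IH0: "\<And>j. (j, i) \<in> z - Id \<Longrightarrow> P f j (f j)"
    then have IH: "\<And>j. j \<in> pre i \<Longrightarrow> P f j (f j)" by (simp add: pre_def)
    show "\<exists>x. P f i x"
    proof (rule ccontr)
      assume no: "\<nexists>x. P f i x"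
      let ?r = "q \<union> (\<Union>j\<in>pre i. snd (f j))" and ?y = "(\<lambda>j. fst (f j)) ` pre i"
      have r: "cnd ?r" by (rule union[OF pre_F IH])
      have sub: "snd (f j) \<subseteq> ?r" if "j \<in> pre i" for j using that by blast
      have y: "?y \<subseteq> Z" using IH pre_F by (fastforce simp: P_def)
      have ysm: "|?y| <o s"
        using ordLeq_ordLess_trans[OF card_of_image ordLeq_ordLess_trans[OF card_of_mono1[OF pre_F] z(2)]] .
      have g: "\<forall>b\<in>?y. Grn b d ?r"
      proof
        fix b assume "b \<in> ?y"
        then obtain j where j: "j \<in> pre i" "b = fst (f j)" by blast
        have "Grn b d (snd (f j))" using IH[OF j(1)] j pre_F by (auto simp: P_def)
        then show "Grn b d ?r" by (rule Grn_mono[OF _ sub[OF j(1)] r])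
      qed
      \<comment> \<open>A green prolongation \<open>a\<close>, forced by \<open>q'\<close>, would be
        the missing value of the recursion at \<open>i\<close>.\<close>
      have "\<forall>a\<in>Z. (\<forall>b\<in>?y. below b a) \<longrightarrow>
       (\<forall>q. cnd q \<longrightarrow> ?r \<subseteq> q \<longrightarrow> \<not> (Grn a d q \<and> (\<forall>b\<in>?y. Grn a b q)))"
      proof (intro ballI allI impI notI, elim conjE)
        fix a q' assume a: "a \<in> Z" "\<forall>b\<in>?y. below b a" "cnd q'" "?r \<subseteq> q'" "Grn a d q'"
          "\<forall>b\<in>?y. Grn a b q'"
        have "P f i (a, q')" using a unfolding P_def by auto
        then show False using no by blast
      qed
      then show False using neg r y ysm g by blast
    qed
  qed
  then obtain f where f: "\<And>i. P f i (f i)" by blast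
  let ?Y = "(\<lambda>j. fst (f j)) ` Field z" and ?q = "q \<union> (\<Union>j\<in>Field z. snd (f j))"
  have cq: "cnd ?q" by (rule union[OF order_refl f])
  have fi: "fst (f j) \<in> Z" "q \<subseteq> snd (f j)" if "j \<in> Field z" for j
    using f[of j] that by (auto simp: P_def)
  have lt: "below (fst (f j)) (fst (f i))" "Grn (fst (f i)) (fst (f j)) (snd (f i))" if "j \<in> pre i" for i j
    using f[of i] that by (auto simp: P_def pre_def Field_def)
  show False
  proof (rule no_green[OF cq, of ?Y])
    show "q0 \<subseteq> ?q" using q by blast
    show "?Y \<subseteq> Field lam" using fi Z by blast
    show "Restr lam ?Y =o z"
    proof (rule Restr_image_ordIso[OF lam_wo z(1)])
      show "(\<lambda>j. fst (f j)) ` Field z \<subseteq> Field lam" using fi Z by blast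
      fix i j assume "(i, j) \<in> z" "i \<noteq> j"
      then show "fst (f i) \<noteq> fst (f j) \<and> (fst (f i), fst (f j)) \<in> lam"
        using lt(1)[of i j] by (simp add: pre_def below_def)
    qed
    have up: "Grn (fst (f i)) (fst (f j)) ?q" if "j \<in> pre i" for i j
    proof -
      have "i \<in> Field z" using that by (auto simp: pre_def Field_def)
      then show ?thesis by (intro Grn_mono[OF lt(2)[OF that] _ cq]) blast
    qed
    fix a b assume "a \<in> ?Y" "b \<in> ?Y" "a \<noteq> b"
    then obtain i j where "i \<in> Field z" "j \<in> Field z" "a = fst (f i)" "b = fst (f j)" "i \<noteq> j" by blast
    then show "Grn a b ?q" using tot[of i j] up[of i j] up[of j i] Grn_sym by blast
  qed
qed

text \<open>Redness is asserted already of \<open>run i\<close>, because \<open>run i\<close> goes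
  beyond \<open>q0\<close> only at coordinates in the \<open>E j\<close> with \<open>j\<close>
  before \<open>i\<close>, whereas \<open>tot\<close> also involves later ones. For greenness, which
  persists, \<open>tot\<close> is enough.\<close>

definition decides ::
  "'k rel \<Rightarrow> 'k set \<Rightarrow> ('k \<Rightarrow> ('l + 'c) set) \<Rightarrow> ('k \<Rightarrow> 'l) \<Rightarrow> ('c \<times> bool) set \<Rightarrow> 'l \<Rightarrow>
    ('k \<Rightarrow> ('c \<times> bool) set) \<Rightarrow> ('c \<times> bool) set \<Rightarrow> 'k set \<Rightarrow> bool" where
  "decides k J E dl q0 a run tot u \<longleftrightarrow> cnd tot \<and> q0 \<subseteq> tot \<and> (\<forall>i\<in>J. run i \<subseteq> tot \<and>
    run i \<subseteq> q0 \<union> {x. \<exists>j\<in>J. (j, i) \<in> k - Id \<and> Inr (fst x) \<in> E j} \<and>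
    (i \<in> u \<longrightarrow> Grn a (dl i) tot) \<and> (i \<notin> u \<longrightarrow> Red a (dl i) (run i)))"

text \<open>Along \<open>J\<close> the condition is made green with \<open>dl i\<close> whenever
  some extension allows it. By \<open>ext\<close> the part inside \<open>E i\<close> then has a
  green extension with coordinates in \<open>E i\<close>; this is compatible with the whole
  condition and adds nothing outside \<open>E i\<close>.\<close>

lemma ex_decide_colours:
  fixes k :: "'k rel"
  assumes k: "Well_order k" "|Field k| <o s" and J: "J \<subseteq> Field k" and q0: "cnd q0"
    and ext: "\<And>i r. i \<in> J \<Longrightarrow> cnd r \<Longrightarrow> coords r \<subseteq> E i \<Longrightarrow> \<exists>q. cnd q \<and> r \<subseteq> q \<and> Grn a (dl i) q \<Longrightarrow>
      \<exists>q. cnd q \<and> r \<subseteq> q \<and> Grn a (dl i) q \<and> coords q \<subseteq> (E i :: ('l + 'c) set)"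
  shows "\<exists>run tot u. decides k J E dl q0 a run tot u"
proof -
  define pre where "pre i = {j \<in> J. (j, i) \<in> k - Id}" for i
  define run where "run f i = q0 \<union> (\<Union>j\<in>pre i. f j)" for f :: "'k \<Rightarrow> ('c \<times> bool) set" and i
  define P where "P f i x \<longleftrightarrow> (i \<in> J \<longrightarrow> cnd x \<and> run f i \<subseteq> x \<and> x \<subseteq> run f i \<union> {x. Inr (fst x) \<in> E i} \<and>
    (Grn a (dl i) x \<or> Red a (dl i) (run f i)))" for f i x
  have wf: "wf (k - Id)" using k(1) well_order_on_def by blast
  have tot: "j \<in> pre i \<or> i \<in> pre j \<or> i = j" if "i \<in> J" "j \<in> J" for i j
    using k(1) that J wo_rel.TOTALS[of k] by (auto simp: wo_rel_def pre_def)
  have union: "cnd (q0 \<union> (\<Union>j\<in>I. f j))" 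
    if I: "I \<subseteq> J" and f: "\<And>j. j \<in> I \<Longrightarrow> P f j (f j)" for f I
  proof (rule cnd_Un_chain[OF q0 ordLeq_ordLess_trans[OF card_of_mono1[OF order_trans[OF I J]] k(2)]])
    show "cnd (f j)" "q0 \<subseteq> f j" if "j \<in> I" for j
      using f[OF that] subsetD[OF I that] unfolding P_def run_def by blast+
    show "f i \<subseteq> f j \<or> f j \<subseteq> f i" if "i \<in> I" "j \<in> I" for i j
      using tot[of i j] that f[of i] f[of j] I unfolding P_def run_def by blast
  qed
  have "\<exists>f. \<forall>i. P f i (f i)"
  proof (rule dependent_wf_choice[OF wf])
    fix f g :: "'k \<Rightarrow> ('c \<times> bool) set" and x r
    assume "\<And>w. (w, x) \<in> k - Id \<Longrightarrow> f w = g w"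
    then have "run f x = run g x" by (simp add: pre_def run_def)
    then show "P f x r = P g x r" unfolding P_def by auto
  next
    fix i and f :: "'k \<Rightarrow> ('c \<times> bool) set"
    assume IH0: "\<And>j. (j, i) \<in> k - Id \<Longrightarrow> P f j (f j)"
    then have IH: "\<And>j. j \<in> pre i \<Longrightarrow> P f j (f j)" by (simp add: pre_def)
    show "\<exists>x. P f i x"
    proof (cases "i \<in> J \<and> (\<exists>q. cnd q \<and> run f i \<subseteq> q \<and> Grn a (dl i) q)")
      case True
      have r: "cnd (run f i)" unfolding run_def by (rule union[OF _ IH]) (auto simp: pre_def)
      have "cnd (restr (E i) (run f i))" by (rule cnd_subset[OF r restr_subset])
      moreover have "\<exists>q. cnd q \<and> restr (E i) (run f i) \<subseteq> q \<and> Grn a (dl i) q"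
        using True restr_subset[of "E i" "run f i"] by blast
      ultimately obtain q where q: "cnd q" "restr (E i) (run f i) \<subseteq> q" "Grn a (dl i) q"
        "coords q \<subseteq> E i"
        using ext[of i "restr (E i) (run f i)"] True coords_restr by blast
      have c: "cnd (run f i \<union> q)" by (rule cnd_Un_restr[OF r q(1,2,4)])
      have "P f i (run f i \<union> q)"
        unfolding P_def using c q(4) Grn_mono[OF q(3) _ c] by (auto simp: image_subset_iff)
      then show ?thesis by blast
    next
      case False
      have "i \<in> J \<Longrightarrow> Red a (dl i) (run f i)" using False unfolding Red_def by blast
      moreover have "cnd (run f i)" unfolding run_def by (rule union[OF _ IH]) (auto simp: pre_def)
      ultimately have "P f i (run f i)" unfolding P_def by blast
      then show ?thesis by blast
    qed
  qed
  then obtain f where f: "\<And>i. P f i (f i)" by blast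
  let ?t = "q0 \<union> (\<Union>j\<in>J. f j)"
  have t: "cnd ?t" by (rule union[OF order_refl f])
  have trans: "(l, i) \<in> k - Id" if "(l, j) \<in> k - Id" "(j, i) \<in> k - Id" for i j l
    using that k(1) wo_rel.TRANS[of k] wo_rel.ANTISYM[of k]
    unfolding wo_rel_def trans_def antisym_def by blast
  have sub: "f i \<subseteq> run f i \<union> {x. Inr (fst x) \<in> E i}" "run f i \<subseteq> f i"
    "Grn a (dl i) (f i) \<or> Red a (dl i) (run f i)" if "i \<in> J" for i
    using f[of i] that unfolding P_def by blast+
  have run: "run f i \<subseteq> q0 \<union> {x. \<exists>j\<in>J. (j, i) \<in> k - Id \<and> Inr (fst x) \<in> E j}" for i
    using wf
  proof (induction i)
    case (less i)
    have "f j \<subseteq> q0 \<union> {x. \<exists>j\<in>J. (j, i) \<in> k - Id \<and> Inr (fst x) \<in> E j}" if "j \<in> pre i" for j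
    proof -
      have j: "j \<in> J" "(j, i) \<in> k - Id" using that by (auto simp: pre_def)
      show ?thesis
      proof
        fix x assume "x \<in> f j"
        then consider "x \<in> run f j" | "Inr (fst x) \<in> E j" using sub(1)[OF j(1)] by blast
        then show "x \<in> q0 \<union> {x. \<exists>j\<in>J. (j, i) \<in> k - Id \<and> Inr (fst x) \<in> E j}"
        proof cases
          case 1
          then have "x \<in> q0 \<union> {x. \<exists>l\<in>J. (l, j) \<in> k - Id \<and> Inr (fst x) \<in> E l}"
            using less.IH[OF j(2)] by (rule rev_subsetD)
          then show ?thesis using trans[OF _ j(2)] by blast
        next
          case 2
          then show ?thesis using j by blast
        qed
      qed
    qed
    then show ?case unfolding run_def by blast
  qed
  have main: "run f i \<subseteq> ?t" if "i \<in> J" for i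
    using sub(2)[OF that] that by (auto simp: run_def)
  have green: "Grn a (dl i) ?t" if "i \<in> J" "Grn a (dl i) (f i)" for i
    by (rule Grn_mono[OF that(2) _ t]) (use that(1) in blast)
  show ?thesis
    unfolding decides_def
  proof (intro exI[of _ "run f"] exI[of _ ?t] exI[of _ "{i. Grn a (dl i) (f i)}"] conjI ballI)
    fix i assume i: "i \<in> J"
    show "run f i \<subseteq> ?t" by (rule main[OF i])
    show "run f i \<subseteq> q0 \<union> {x. \<exists>j\<in>J. (j, i) \<in> k - Id \<and> Inr (fst x) \<in> E j}" by (rule run)
    show "i \<in> {i. Grn a (dl i) (f i)} \<longrightarrow> Grn a (dl i) ?t" using green[OF i] by simp
    show "i \<notin> {i. Grn a (dl i) (f i)} \<longrightarrow> Red a (dl i) (run f i)" using sub(3)[OF i] by blast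
  qed (use t in simp_all)
qed

text \<open>A closed set \<open>C\<close> of coordinates takes the role of an elementary submodel.
  For \<open>a\<close> outside all the small sets chosen for roots in \<open>C\<close>, the trace of
  \<open>Q a\<close> on \<open>C\<close> is a root over which \<open>Q a\<close> is disjoint from
  \<open>Q x\<close> for every \<open>x\<close> in the set chosen for it, contradicting that choice.
  The label is constant because sets are chosen separately for each label.\<close>

lemma ex_delta_system:
  fixes M :: "'m set" and Q :: "'a \<Rightarrow> ('c \<times> bool) set" and lab :: "'a \<Rightarrow> 'v"
  assumes M: "infinite M" and sM: "s \<le>o |M|"
    and Q: "\<And>a. a \<in> A \<Longrightarrow> cnd (Q a)" and lab: "|lab ` A| \<le>o |Pow (Pow M)|"
    and A: "\<not> |A| \<le>o |Pow (Pow M)|"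
  shows "\<exists>B \<subseteq> A. \<exists>root v. \<not> |B| \<le>o |Pow (Pow M)| \<and> (\<forall>a\<in>B. lab a = v \<and> root \<subseteq> Q a) \<and>
    (\<forall>a\<in>B. \<forall>b\<in>B. a \<noteq> b \<longrightarrow> fst ` Q a \<inter> fst ` Q b \<subseteq> fst ` root)"
proof (rule ccontr)
  let ?K = "Pow (Pow M)"
  assume neg: "\<not> ?thesis"
  have iK: "infinite ?K" using M by auto
  define W where "W root v = {a \<in> A. lab a = v \<and> root \<subseteq> Q a}" for root v
  define R where "R root a b \<longleftrightarrow> fst ` Q a \<inter> fst ` Q b \<subseteq> fst ` root" for root :: "('c \<times> bool) set" and a b
  \<comment> \<open>By \<open>neg\<close> every clique for \<open>R root\<close> in
    \<open>W root v\<close> is small, so some small subset admits no further element compatible with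
    all of it.\<close>
  have "\<exists>X \<subseteq> W root v. |X| \<le>o |?K| \<and> \<not> (\<exists>w \<in> W root v - X. \<forall>x\<in>X. R root x w \<and> R root w x)" for root v
  proof (rule ccontr)
    assume "\<not> ?thesis"
    then have "\<And>X. X \<subseteq> W root v \<Longrightarrow> |X| \<le>o |?K| \<Longrightarrow> \<exists>w \<in> W root v - X. \<forall>x\<in>X. R root x w \<and> R root w x"
      by blast
    from ex_large_clique[of "W root v" ?K "R root", OF this]
    obtain X where X: "X \<subseteq> W root v" "\<forall>x\<in>X. \<forall>y\<in>X. x \<noteq> y \<longrightarrow> R root x y" "\<not> |X| \<le>o |?K|" by auto
    have "X \<subseteq> A" "\<forall>a\<in>X. lab a = v \<and> root \<subseteq> Q a" using X(1) by (auto simp: W_def)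
    then show False using neg X(2,3) unfolding R_def by blast
  qed
  then obtain X where X: "\<And>root v. |X root v| \<le>o |?K|"
    "\<And>root v w. w \<in> W root v \<Longrightarrow> w \<notin> X root v \<Longrightarrow> \<exists>x\<in>X root v. \<not> (R root x w \<and> R root w x)"
    "\<And>root v. X root v \<subseteq> W root v"
    by (metis DiffI)
  define G where "G B = (\<Union>(root, v) \<in> Pow (B \<times> UNIV) \<times> lab ` A. \<Union>x\<in>X root v. fst ` Q x)" for B
  have Qsm: "|fst ` Q a| \<le>o |?K|" if "a \<in> A" for a
  proof -
    have "|Q a| <o s" using Q[OF that] by (simp add: cond_def)
    then show ?thesis
      by (rule card_of_image_le[OF ordLess_imp_ordLeq[OF ordLess_ordLeq_trans[OF _ ordLeq_transitive[OF sM card_of_Pow_Pow]]]])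
  qed
  have XA: "x \<in> A" if "x \<in> X root v" for x root v using X(3) that by (auto simp: W_def)
  have G: "|G B| \<le>o |?K|" if B: "|B| \<le>o |M|" for B
    unfolding G_def
  proof (rule card_of_UN_le[OF iK])
    have "|Pow (B \<times> (UNIV :: bool set))| \<le>o |?K|"
      by (rule ordLeq_transitive[OF card_of_Pow_mono[OF card_of_Times_bool_le[OF M B]] ordLess_imp_ordLeq[OF card_of_Pow]])
    then show "|Pow (B \<times> (UNIV :: bool set)) \<times> lab ` A| \<le>o |?K|"
      by (rule card_of_Times_le[OF iK _ lab])
    fix p :: "('c \<times> bool) set \<times> 'v"
    have "|\<Union>x\<in>X (fst p) (snd p). fst ` Q x| \<le>o |?K|"
      by (rule card_of_UN_le[OF iK X(1) Qsm]) (rule XA)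
    then show "|case p of (root, v) \<Rightarrow> \<Union>x\<in>X root v. fst ` Q x| \<le>o |?K|" by (simp add: split_beta)
  qed
  have "\<exists>C. {} \<subseteq> C \<and> |C| \<le>o |?K| \<and> (\<forall>B\<subseteq>C. |B| \<le>o |M| \<longrightarrow> G B \<subseteq> C)"
    by (rule ex_closed_superset[OF M card_of_empty]) (rule G)
  then obtain C where C: "|C| \<le>o |?K|" "\<forall>B\<subseteq>C. |B| \<le>o |M| \<longrightarrow> G B \<subseteq> C" by (elim exE conjE)
  let ?S = "{r. r \<subseteq> C \<times> (UNIV :: bool set) \<and> |r| \<le>o |M| }"
  have "|?S| \<le>o |?K|" by (rule card_of_small_subsets[OF M card_of_Times_bool_le[OF iK C(1)]])
  then have SL: "|?S \<times> lab ` A| \<le>o |?K|" by (rule card_of_Times_le[OF iK _ lab])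
  have "|\<Union>p\<in>?S \<times> lab ` A. X (fst p) (snd p)| \<le>o |?K|"
    by (rule card_of_UN_le[OF iK SL X(1)])
  then have "\<not> A \<subseteq> (\<Union>p\<in>?S \<times> lab ` A. X (fst p) (snd p))"
    using A card_of_subset_le[of A] by blast
  then obtain a where a: "a \<in> A" "a \<notin> (\<Union>p\<in>?S \<times> lab ` A. X (fst p) (snd p))" by blast
  \<comment> \<open>The trace on \<open>C\<close> has size below \<open>s\<close>, hence at most
    \<open>|M|\<close>, so closure puts the domains of \<open>Q x\<close>, for \<open>x\<close> in
    \<open>X r (lab a)\<close>, inside \<open>C\<close>.\<close>
  define r where "r = Q a \<inter> C \<times> UNIV"
  have "|r| \<le>o |Q a|" unfolding r_def by (rule card_of_mono1) blast
  also have "|Q a| <o s" using Q[OF a(1)] by (simp add: cond_def)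
  also note sM
  finally have rM: "|r| \<le>o |M|" by (rule ordLess_imp_ordLeq)
  have rC: "r \<subseteq> C \<times> UNIV" by (auto simp: r_def)
  then have "(r, lab a) \<in> ?S \<times> lab ` A" using a(1) rM by simp
  then have aX: "a \<notin> X r (lab a)" using a(2) by fastforce
  have "a \<in> W r (lab a)" using a(1) by (simp add: W_def r_def)
  then obtain x where x: "x \<in> X r (lab a)" "\<not> (R r x a \<and> R r a x)" using X(2) aX by blast
  have "r \<subseteq> fst ` r \<times> UNIV" by (metis mem_Times_iff UNIV_I image_eqI subsetI)
  then have "(r, lab a) \<in> Pow (fst ` r \<times> UNIV) \<times> lab ` A" using a(1) by simp
  then have "(case (r, lab a) of (root, v) \<Rightarrow> \<Union>x\<in>X root v. fst ` Q x) \<subseteq> G (fst ` r)"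
    unfolding G_def by (rule UN_upper)
  then have "fst ` Q x \<subseteq> G (fst ` r)" using x(1) by (simp add: UN_subset_iff)
  also have "\<dots> \<subseteq> C"
  proof -
    have "fst ` r \<subseteq> C" using rC by auto
    then show ?thesis using C(2) card_of_image_le[OF rM, of fst] by simp
  qed
  finally have "fst ` Q x \<subseteq> C" .
  then have Cx: "z \<in> C" if "z \<in> fst ` Q x" for z using that by blast
  have sub: "fst ` Q x \<inter> fst ` Q a \<subseteq> fst ` r"
  proof
    fix z assume "z \<in> fst ` Q x \<inter> fst ` Q a"
    then obtain b where "(z, b) \<in> Q a" "z \<in> C" using Cx by (elim IntE imageE) (metis prod.collapse image_eqI)
    then have "(z, b) \<in> r" by (simp add: r_def)
    then show "z \<in> fst ` r" by (rule image_eqI[rotated]) simp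
  qed
  then have "R r x a" "R r a x" unfolding R_def by (simp_all only: Int_commute)
  then show False using x(2) by simp
qed

section \<open>Reflecting the new ordinal to a large red family\<close>

lemma refl_ok_mono: "refl_ok Bl F y r D d p \<Longrightarrow> D' \<subseteq> D \<Longrightarrow> refl_ok Bl F y r D' d p"
  unfolding refl_ok_def by blast

lemma refl_ok_stuck:
  assumes "refl_ok Bl F y r D d p" "a \<in> Bl" "\<forall>b\<in>y. below b a" "Inl a \<in> D"
    "cnd q" "r \<union> p \<subseteq> q" "Grn a d q"
  shows "\<exists>b\<in>y. \<not> Grn a b q"
proof -
  have "\<forall>a\<in>Bl. Inl a \<in> D \<longrightarrow> (\<forall>b\<in>y. below b a) \<longrightarrow>
      (\<forall>q. cnd q \<longrightarrow> r \<union> p \<subseteq> q \<longrightarrow> \<not> (Grn a d q \<and> (\<forall>b\<in>y. Grn a b q)))"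
    using assms(1) unfolding refl_ok_def by (elim conjE)
  then show ?thesis using assms(2-) by blast
qed

text \<open>If some set of size at most \<open>|Pow (Pow M)|\<close> obstructed all candidates,
  closure would give one inside \<open>C\<close>, but \<open>d\<close> with the part of
  \<open>r\<close> outside \<open>C\<close> is not obstructed by such a set. So candidates avoiding
  any small set exist, and closure of \<open>E\<close> finds them in \<open>E\<close>. A candidate
  \<open>a\<close> avoiding earlier ones is red with them: a green pair would let the earlier
  ordinal prolong the green set \<open>insert a y\<close>, which \<open>refl_ok\<close>
  excludes.\<close>

lemma ex_reflection_family:
  fixes M :: "'m set" and M' :: "'n set" and C E :: "('l + 'c) set"
  assumes M: "infinite M" and sM: "s \<le>o |M|" and MM': "|Pow (Pow M)| \<le>o |M'|"
    and C: "closed_for M Bl C" "|C| \<le>o |Pow (Pow M)|" and E: "closed_for M' Bl E" and CE: "C \<subseteq> E"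
    and supp: "param_supp F y (restr C r) {} \<subseteq> C" "|param_supp F y (restr C r) {}| \<le>o |M|"
    and r: "cnd r" and d: "d \<in> Bl" "Inl d \<notin> C" "\<And>b. b \<in> y \<Longrightarrow> below b d"
    and F: "\<And>b t c. (b, t, c) \<in> F \<Longrightarrow>
        if c then Grn b d (t \<union> (r - restr C r)) else Red b d (t \<union> (r - restr C r))"
    and Fy: "\<And>b. b \<in> y \<Longrightarrow> (b, restr C r, True) \<in> F"
    and stuck: "\<And>a q. a \<in> Bl \<Longrightarrow> Inl a \<in> C \<Longrightarrow> (\<And>b. b \<in> y \<Longrightarrow> below b a) \<Longrightarrow>
        cnd q \<Longrightarrow> r \<subseteq> q \<Longrightarrow> Grn a d q \<Longrightarrow> (\<And>b. b \<in> y \<Longrightarrow> Grn a b q) \<Longrightarrow> False"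
  obtains A S where "A \<subseteq> Bl" and "\<not> |A| \<le>o |Pow (Pow M)|"
    and "\<forall>a\<in>A. Inl a \<in> E \<and> Inl a \<notin> C \<and> cnd (S a) \<and> coords (S a) \<subseteq> E \<and>
        coords (S a) \<inter> (C \<union> coords r) = {} \<and>
        (\<forall>(b, t, c) \<in> F. if c then Grn b a (t \<union> S a) else Red b a (t \<union> S a))"
    and "\<forall>a\<in>A. \<forall>a'\<in>A. a \<noteq> a' \<longrightarrow> Red a a' (restr C r \<union> S a \<union> S a')"
proof -
  let ?K = "Pow (Pow M)" and ?r = "restr C r"
  have iK: "infinite ?K" using M by auto
  have iM': "infinite M'" using iK MM' card_of_ordLeq_infinite by blast
  have sK: "s \<le>o |?K|"
    by (rule ordLeq_transitive[OF sM card_of_Pow_Pow])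
  have small: "|coords p| \<le>o |?K|" if "cnd p" for p
    by (rule ordLess_imp_ordLeq[OF ordLess_ordLeq_trans[OF coords_small[OF that] sK]])
  have many: "\<exists>d p. refl_ok Bl F y ?r D d p" if D: "|D| \<le>o |?K|" for D
  proof (rule ccontr)
    assume no: "\<not> ?thesis"
    have "\<exists>D \<subseteq> C. |D| \<le>o |?K| \<and> \<not> (\<exists>d p. refl_ok Bl F y ?r D d p)"
      using C(1)[unfolded closed_for_def, rule_format, OF conjI, OF supp, unfolded witnessed_in_def, THEN conjunct2, THEN conjunct2, THEN mp]
        D no by blast
    then obtain D' where D': "D' \<subseteq> C" "\<not> (\<exists>d p. refl_ok Bl F y ?r D' d p)" by blast
    have rr: "?r \<union> (r - ?r) = r" using restr_subset[of C r] by blast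
    have "refl_ok Bl F y ?r D' d (r - ?r)"
      unfolding refl_ok_def rr
    proof (intro conjI ballI impI allI)
      show "cnd (r - ?r)" by (rule cnd_subset[OF r]) blast
      show "coords (r - ?r) \<inter> D' = {}" using D'(1) by (auto simp: coords_def restr_def)
      show "Inl d \<notin> D'" using d D' by blast
      show "case x of (b, t, c) \<Rightarrow> if c then Grn b d (t \<union> (r - ?r)) else Red b d (t \<union> (r - ?r))"
        if "x \<in> F" for x using F[of "fst x" "fst (snd x)" "snd (snd x)"] that by (simp add: split_beta)
      show "\<not> (Grn a d q \<and> (\<forall>b\<in>y. Grn a b q))"
        if "a \<in> Bl" "Inl a \<in> D'" "\<forall>b\<in>y. below b a" "cnd q" "r \<subseteq> q" for a q
        using stuck[of a q] that D'(1) by blast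
    qed (use d in blast)+
    then show False using D'(2) by blast
  qed
  \<comment> \<open>Coordinates of \<open>r\<close> are avoided as well, so that reflected
    conditions are compatible with \<open>r\<close>. Intersecting with \<open>E\<close> keeps the
    excluded set inside \<open>E\<close> and loses nothing, as the candidates lie in
    \<open>E\<close>.\<close>
  let ?B = "C \<union> (coords r \<inter> E)"
  have D0: "|?B| \<le>o |?K|"
    by (rule card_of_Un_le[OF iK C(2) card_of_subset_le[OF _ small[OF r]]]) blast
  define W where "W = {(a, p). refl_ok Bl F y ?r ?B a p \<and> Inl a \<in> E \<and> coords p \<subseteq> E}"
  define R where "R v w \<longleftrightarrow> fst v \<noteq> fst w \<and> Red (fst v) (fst w) (?r \<union> snd v \<union> snd w)"
    for v w :: "'l \<times> ('c \<times> bool) set"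
  have ext: "\<exists>w \<in> W - X. \<forall>x\<in>X. R x w \<and> R w x" if X: "X \<subseteq> W" "|X| \<le>o |?K|" for X
  proof -
    let ?D = "?B \<union> (\<Union>x\<in>X. {Inl (fst x)} \<union> coords (snd x))"
    have XW: "refl_ok Bl F y ?r ?B (fst x) (snd x)" "Inl (fst x) \<in> E" "coords (snd x) \<subseteq> E" if "x \<in> X" for x
    proof -
      have "(fst x, snd x) \<in> W" using X(1) that by auto
      then show "refl_ok Bl F y ?r ?B (fst x) (snd x)" "Inl (fst x) \<in> E" "coords (snd x) \<subseteq> E"
        unfolding W_def by blast+
    qed
    have "|{Inl (fst x)} \<union> (coords (snd x) :: ('l + 'c) set)| \<le>o |?K|" if "x \<in> X" for x
      by (rule card_of_Un_le[OF iK card_of_finite_le[OF iK] small])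
        (use XW(1)[OF that] in \<open>simp_all add: refl_ok_def\<close>)
    then have D: "|?D| \<le>o |?K|" by (intro card_of_Un_le[OF iK D0] card_of_UN_le[OF iK X(2)])
    have DE: "?D \<subseteq> E" using CE XW(2,3) by blast
    have ps: "param_supp F y ?r ?D = param_supp F y ?r {} \<union> ?D" by (simp add: param_supp_def)
    have "|param_supp F y ?r {}| \<le>o |?K|"
      by (rule ordLeq_transitive[OF supp(2) card_of_Pow_Pow])
    then have "|param_supp F y ?r ?D| \<le>o |?K|" unfolding ps by (rule card_of_Un_le[OF iK _ D])
    then have 1: "|param_supp F y ?r ?D| \<le>o |M'|" by (rule ordLeq_transitive[OF _ MM'])
    have 2: "param_supp F y ?r ?D \<subseteq> E" unfolding ps using supp(1) CE DE by blast
    obtain a p where ap: "refl_ok Bl F y ?r ?D a p" "Inl a \<in> E" "coords p \<subseteq> E"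
      using E[unfolded closed_for_def, rule_format, OF conjI, OF 2 1, unfolded witnessed_in_def, THEN conjunct2, THEN conjunct1, THEN mp]
        many[OF D] by blast
    have "(a, p) \<in> W" using refl_ok_mono[OF ap(1), of ?B] ap(2,3) unfolding W_def by blast
    moreover have "R x (a, p) \<and> R (a, p) x" if x: "x \<in> X" for x
    proof -
      have "fst x \<noteq> a" using ap(1) x unfolding refl_ok_def by blast
      moreover have "Red (fst x) a (?r \<union> snd x \<union> p)"
        unfolding Red_def
      proof (intro allI impI notI)
        fix q assume q: "cnd q" "?r \<union> snd x \<union> p \<subseteq> q" "Grn (fst x) a q"
        have gr: "Grn (fst x) b q" if b: "b \<in> y" for b
        proof -
          have "Grn b (fst x) (?r \<union> snd x)"
            using XW(1)[OF x] Fy[OF b] unfolding refl_ok_def by force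
          then have "Grn b (fst x) q" by (rule Grn_mono) (use q in auto)
          then show ?thesis by (rule Grn_sym)
        qed
        have "fst x \<in> Bl" "\<forall>b\<in>y. below b (fst x)"
          using XW(1)[OF x] unfolding refl_ok_def by blast+
        moreover have "Inl (fst x) \<in> ?D" using x by blast
        moreover have "?r \<union> p \<subseteq> q" using q(2) by blast
        ultimately have "\<exists>b\<in>y. \<not> Grn (fst x) b q" by (rule refl_ok_stuck[OF ap(1) _ _ _ q(1) _ q(3)])
        then show False using gr by blast
      qed
      ultimately show ?thesis using Red_sym[of "fst x" a] by (auto simp: R_def Un_ac)
    qed
    moreover have "(a, p) \<notin> X"
    proof
      assume "(a, p) \<in> X"
      then have "Inl a \<in> ?D" by force
      then show False using ap(1) unfolding refl_ok_def by blast
    qed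
    ultimately show ?thesis by (intro bexI[of _ "(a, p)"]) simp_all
  qed
  have "\<exists>X \<subseteq> W. (\<forall>v\<in>X. \<forall>w\<in>X. v \<noteq> w \<longrightarrow> R v w) \<and> \<not> |X| \<le>o |?K|"
    by (rule ex_large_clique) (rule ext)
  then obtain X where X: "X \<subseteq> W" "\<forall>v\<in>X. \<forall>w\<in>X. v \<noteq> w \<longrightarrow> R v w" "\<not> |X| \<le>o |?K|"
    by (elim exE conjE)
  \<comment> \<open>\<open>R\<close> demands distinct ordinals, so each ordinal occurring in
    \<open>X\<close> carries a single condition, named \<open>S a\<close> below.\<close>
  have inj: "inj_on fst X" using X(2) unfolding R_def inj_on_def by blast
  define S where "S a = snd (inv_into X fst a)" for a
  have S: "(a, S a) \<in> X" if "a \<in> fst ` X" for a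
  proof -
    have "inv_into X fst a \<in> X" "fst (inv_into X fst a) = a"
      using that by (simp_all add: inv_into_into f_inv_into_f)
    then show ?thesis unfolding S_def by (metis prod.collapse)
  qed
  have XW: "refl_ok Bl F y ?r ?B a (S a)" "Inl a \<in> E" "coords (S a) \<subseteq> E" if "a \<in> fst ` X" for a
    using S[OF that] X(1) unfolding W_def by auto
  show ?thesis
  proof (rule that[of "fst ` X" S]; (intro conjI ballI impI)?)
    show "fst ` X \<subseteq> Bl" using XW(1) unfolding refl_ok_def by blast
    have "|X| \<le>o |fst ` X|" using inj card_of_ordLeq[of X "fst ` X"] by blast
    then show "\<not> |fst ` X| \<le>o |?K|" using X(3) ordLeq_transitive by blast
    show "Red a a' (?r \<union> S a \<union> S a')" if "a \<in> fst ` X" "a' \<in> fst ` X" "a \<noteq> a'" for a a'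
      using X(2)[rule_format, OF S[OF that(1)] S[OF that(2)]] that(3) by (simp add: R_def)
    fix a assume a: "a \<in> fst ` X"
    show "Inl a \<in> E" "coords (S a) \<subseteq> E" by (fact XW[OF a])+
    show "Inl a \<notin> C" "cnd (S a)" using XW(1)[OF a] unfolding refl_ok_def by blast+
    show "coords (S a) \<inter> (C \<union> coords r) = {}"
      using XW(1,3)[OF a] unfolding refl_ok_def by blast
    show "case x of (b, t, c) \<Rightarrow> if c then Grn b a (t \<union> S a) else Red b a (t \<union> S a)" if "x \<in> F" for x
      using XW(1)[OF a] that unfolding refl_ok_def by blast
  qed
qed

end

section \<open>The stages\<close>

locale cohen_singular = cohen s N lam Grn
  for s :: "'s rel" and N :: "'c set" and lam :: "'l rel"
    and Grn :: "'l \<Rightarrow> 'l \<Rightarrow> ('c \<times> bool) set \<Rightarrow> bool" +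
  fixes k :: "'k rel"
  assumes k_card: "Card_order k" and k_inf: "natLeq <o k" and k_s: "k <o s"
    and cof: "is_cofinality k lam" and limit: "strong_limit lam"
begin

section \<open>Cardinal arithmetic below the singular strong limit \<open>lam\<close>\<close>

lemma lam_inf: "infinite (Field lam)"
  using s_inf s_lam card_of_ordLeq_infinite[of "Field s" "Field lam"] s_card lam_card
  by (meson card_of_mono2 ordLess_imp_ordLeq)

lemma k_wo: "Well_order k"
  using k_card card_order_on_well_order_on by blast

lemma Field_k_s: "|Field k| <o s"
  by (rule ordIso_ordLess_trans[OF card_of_Field_ordIso[OF k_card] k_s])

lemma lam_total: "a \<in> Field lam \<Longrightarrow> b \<in> Field lam \<Longrightarrow> below a b \<or> a = b \<or> below b a"
  using lam_wo wo_rel.TOTALS[of lam] by (auto simp: wo_rel_def below_def)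

lemma underS_lam_iff: "x \<in> underS lam b \<longleftrightarrow> below x b"
  by (auto simp: underS_def below_def)

lemma underS_lam_mono: "below a b \<Longrightarrow> underS lam a \<subseteq> underS lam b"
  unfolding subset_iff underS_lam_iff using below_trans by blast

lemma wf_k: "wf (k - Id)" and wf_lam: "wf (lam - Id)"
  using k_wo lam_wo well_order_on_def by blast+

lemma underS_lam: "b \<in> Field lam \<Longrightarrow> |underS lam b| <o lam"
  by (rule card_of_underS[OF lam_card])

lemma ex_underS_lam:
  assumes "|X| <o lam"
  shows "\<exists>b \<in> Field lam. |X| =o |underS lam b|"
proof -
  obtain b where b: "b \<in> Field lam" "|X| =o Restr lam (underS lam b)"
    using assms ordLess_iff_ordIso_Restr[OF lam_wo card_of_Well_order] by blast
  have "Field (Restr lam (underS lam b)) = underS lam b"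
    using lam_wo by (intro Refl_Field_Restr2) (auto simp: order_on_defs underS_def Field_def)
  then have "|X| =o |underS lam b|"
    using card_of_cong[OF b(2)] by (simp add: Field_card_of)
  then show ?thesis using b(1) by blast
qed

text \<open>\<open>strong_limit\<close> quantifies over cardinals on the type of \<open>lam\<close>,
  so \<open>X\<close> is first replaced by an initial segment of \<open>lam\<close> of the same
  size.\<close>

lemma Pow_lam: assumes "|X| <o lam" shows "|Pow X| <o lam"
proof -
  obtain b where b: "b \<in> Field lam" "|X| =o |underS lam b|"
    using ex_underS_lam[OF assms] by blast
  let ?B = "underS lam b"
  have "ctwo ^c |?B| <o lam"
    using limit underS_lam[OF b(1)] card_of_Card_order unfolding strong_limit_def by blast
  then have "|Pow ?B| <o lam" by (rule ordIso_ordLess_trans[OF card_of_Pow_ctwo])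
  then show ?thesis
    by (rule ordLeq_ordLess_trans[OF card_of_Pow_mono[OF ordIso_imp_ordLeq[OF b(2)]]])
qed

lemma Un_lam: "|A| <o lam \<Longrightarrow> |B| <o lam \<Longrightarrow> |A \<union> B| <o lam"
  by (rule card_of_Un_ordLess_infinite_Field[OF lam_inf lam_card])

lemma image_lam: "|A| <o lam \<Longrightarrow> |f ` A| <o lam"
  by (rule ordLeq_ordLess_trans[OF card_of_image])

lemma Field_s_lam: "|Field s| <o lam"
  by (rule ordIso_ordLess_trans[OF card_of_Field_ordIso[OF s_card] s_lam])

text \<open>Fewer than \<open>k\<close> sizes are not cofinal in \<open>lam\<close>, hence bounded
  by one initial segment. Adding \<open>Field s\<close> to it makes the bound infinite and at least
  \<open>|I|\<close>.\<close>

lemma UN_lam: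
  fixes X :: "'i \<Rightarrow> 'x set"
  assumes I: "|I| <o k" and X: "\<And>i. i \<in> I \<Longrightarrow> |X i| <o lam"
  shows "|\<Union>i\<in>I. X i| <o lam"
proof -
  let ?u = "underS lam"
  have "\<exists>b. \<forall>i\<in>I. b i \<in> Field lam \<and> |X i| =o |?u (b i)|"
    by (rule bchoice) (use ex_underS_lam[OF X] in blast)
  then obtain b where b: "\<And>i. i \<in> I \<Longrightarrow> b i \<in> Field lam" "\<And>i. i \<in> I \<Longrightarrow> |X i| =o |?u (b i)|" by blast
  have "|b ` I| <o k" by (rule ordLeq_ordLess_trans[OF card_of_image I])
  then have "\<not> k \<le>o |b ` I|" using not_ordLess_ordLeq by blast
  then have "\<not> cofinal (b ` I) lam" using cof b(1) unfolding is_cofinality_def by blast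
  then obtain x where x: "x \<in> Field lam" "\<And>i. i \<in> I \<Longrightarrow> \<not> below x (b i)"
    unfolding cofinal_def below_def by blast
  obtain x' where x': "x' \<in> Field lam" "below x x'"
    using infinite_Card_order_limit[OF lam_card lam_inf x(1)] by (auto simp: below_def)
  have sub: "?u (b i) \<subseteq> ?u x'" if "i \<in> I" for i
    by (rule underS_lam_mono)
      (use lam_total[OF x(1) b(1)[OF that]] x(2)[OF that] x'(2) below_trans in blast)
  let ?K = "Inl ` Field s \<union> Inr ` ?u x'"
  have K: "|?K| <o lam" by (intro Un_lam image_lam Field_s_lam underS_lam x'(1))
  have sK: "|Field s| \<le>o |?K|" by (rule card_of_ordLeqI[of Inl]) auto
  then have iK: "infinite ?K" using s_inf card_of_ordLeq_infinite by blast
  have uK: "|?u x'| \<le>o |?K|" by (rule card_of_ordLeqI[of Inr]) auto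
  have IK: "|I| \<le>o |?K|"
    by (rule ordLeq_transitive[OF ordLess_imp_ordLeq[OF ordLess_transitive[OF I k_s]]])
      (rule ordIso_ordLeq_trans[OF ordIso_symmetric[OF card_of_Field_ordIso[OF s_card]] sK])
  have XK: "|X i| \<le>o |?K|" if "i \<in> I" for i
    by (rule ordIso_ordLeq_trans[OF b(2)[OF that] ordLeq_transitive[OF card_of_mono1[OF sub[OF that]] uK]])
  show ?thesis
    by (rule ordLeq_ordLess_trans[OF card_of_UN_le[OF iK IK] K]) (rule XK)
qed

text \<open>Padding by \<open>Field s\<close> makes the closure parameter infinite and at least
  \<open>s\<close>, so that every condition is a small parameter.\<close>

definition with_s :: "'x set \<Rightarrow> ('x + 's) set" where
  "with_s X = Inl ` X \<union> Inr ` Field s"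

lemma with_s_inf: "infinite (with_s X)" and s_with_s: "s \<le>o |with_s X|" and with_s_ge: "|X| \<le>o |with_s X|"
proof -
  have 1: "|Field s| \<le>o |with_s X|" unfolding with_s_def by (rule card_of_ordLeqI[of Inr]) auto
  then show "infinite (with_s X)" using s_inf card_of_ordLeq_infinite by blast
  show "s \<le>o |with_s X|"
    by (rule ordIso_ordLeq_trans[OF ordIso_symmetric[OF card_of_Field_ordIso[OF s_card]] 1])
  show "|X| \<le>o |with_s X|" unfolding with_s_def by (rule card_of_ordLeqI[of Inl]) auto
qed

lemma with_s_lam: "|X| <o lam \<Longrightarrow> |with_s X| <o lam"
  unfolding with_s_def by (intro Un_lam image_lam Field_s_lam)

text \<open>\<open>C\<close> is small enough to leave room for \<open>d\<close> above its part of
  the block, while \<open>E\<close> is closed for larger supports and swallows the whole block. As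
  the block is an initial segment of \<open>lam\<close>, ordinals outside \<open>E\<close> lie above
  it, which later makes the picked ordinals increase.\<close>

definition stage_sets ::
  "('l + 'c) set \<Rightarrow> ('l + 'c) set \<Rightarrow> ('l + 'c) set \<Rightarrow> 'l set \<Rightarrow> 'l \<Rightarrow> (('l + 'c) + 's) set \<Rightarrow> bool" where
  "stage_sets X C E Bl d M' \<longleftrightarrow>
     closed_for (with_s X) Bl C \<and> X \<subseteq> C \<and> |C| \<le>o |Pow (Pow (with_s X))| \<and>
     closed_for M' Bl E \<and> |Pow (Pow (with_s X))| \<le>o |M'| \<and> C \<subseteq> E \<and> Inl ` Bl \<subseteq> E \<and> |E| <o lam \<and>
     (\<exists>b\<in>Field lam. Bl = underS lam b) \<and>
     d \<in> Bl \<and> Inl d \<notin> C \<and> (\<forall>c\<in>Bl. Inl c \<in> C \<longrightarrow> below c d)"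

text \<open>The block is the least initial segment of \<open>lam\<close> with more than
  \<open>|Pow (Pow (with_s X))|\<close> elements. Its proper initial segments are no larger than
  this bound, so the ordinals of \<open>C\<close>, being no more numerous, cannot be cofinal in it;
  this gives \<open>d\<close>.\<close>

lemma ex_stage_sets:
  assumes X: "|X| <o lam"
  shows "\<exists>C E Bl d M'. stage_sets X C E Bl d M'"
proof -
  let ?u = "underS lam"
  let ?K = "Pow (Pow (with_s X))"
  have iK: "infinite ?K" using with_s_inf by auto
  have K: "|?K| <o lam" by (intro Pow_lam with_s_lam X)
  define T where "T = {b \<in> Field lam. \<not> |?u b| \<le>o |?K| }"
  obtain b0 where b0: "b0 \<in> Field lam" "|Pow ?K| =o |?u b0|"
    using ex_underS_lam[OF Pow_lam[OF K]] by blast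
  have "\<not> |?u b0| \<le>o |?K|"
    using ordIso_ordLeq_trans[OF b0(2)] card_of_Pow[of ?K] not_ordLess_ordLeq by blast
  then have "b0 \<in> T" using b0(1) by (simp add: T_def)
  with wf_lam obtain b where b: "b \<in> T" and min: "\<And>c. (c, b) \<in> lam - Id \<Longrightarrow> c \<notin> T"
    by (auto elim: wfE_min)
  have bF: "b \<in> Field lam" and nb: "\<not> |?u b| \<le>o |?K|" using b by (auto simp: T_def)
  let ?Bl = "?u b"
  have BlF: "?Bl \<subseteq> Field lam" by (auto simp: underS_def Field_def)
  have uK: "|?u c| \<le>o |?K|" if "c \<in> ?Bl" for c
    using min[of c] that BlF by (auto simp: T_def underS_def)
  have "|X| \<le>o |?K|"
    by (rule ordLeq_transitive[OF with_s_ge card_of_Pow_Pow])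
  then obtain C where C: "X \<subseteq> C" "|C| \<le>o |?K|" "closed_for (with_s X) ?Bl C"
    using ex_closed_for[OF with_s_inf s_with_s, of X X ?Bl] by blast
  let ?I = "{c \<in> ?Bl. Inl c \<in> C}"
  have "|?I| \<le>o |C|" by (rule card_of_ordLeqI[of Inl]) auto
  then have I: "|?I| \<le>o |?K|" by (rule ordLeq_transitive[OF _ C(2)])
  have "|{c} \<union> ?u c| \<le>o |?K|" if "c \<in> ?I" for c
    by (rule card_of_Un_le[OF iK card_of_finite_le[OF iK] uK]) (use that in auto)
  then have "|\<Union>c\<in>?I. {c} \<union> ?u c| \<le>o |?K|" by (rule card_of_UN_le[OF iK I])
  then have "\<not> ?Bl \<subseteq> (\<Union>c\<in>?I. {c} \<union> ?u c)" using nb card_of_subset_le[of ?Bl] by blast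
  then obtain d where d: "d \<in> ?Bl" "\<And>c. c \<in> ?I \<Longrightarrow> d \<noteq> c \<and> d \<notin> ?u c" by blast
  have d2: "below c d" if "c \<in> ?Bl" "Inl c \<in> C" for c
  proof -
    have "\<not> below d c" "d \<noteq> c"
      using d(2)[of c] that by (auto simp: underS_def below_def)
    then show ?thesis using lam_total[of c d] that(1) d(1) BlF by blast
  qed
  let ?M' = "with_s (C \<union> Inl ` ?Bl)"
  have "|C| <o lam" by (rule ordLeq_ordLess_trans[OF C(2) K])
  then have M'l: "|?M'| <o lam" by (intro with_s_lam Un_lam image_lam underS_lam bF)
  have "|?K| \<le>o |?u b|" using nb ordLeq_total[OF card_of_Well_order card_of_Well_order] by blast
  moreover have "|?u b| \<le>o |C \<union> Inl ` ?Bl|" by (rule card_of_ordLeqI[of Inl]) auto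
  ultimately have KM': "|?K| \<le>o |?M'|"
    using ordLeq_transitive[OF ordLeq_transitive with_s_ge] by blast
  have "|C \<union> Inl ` ?Bl| \<le>o |Pow (Pow ?M')|"
    by (rule ordLeq_transitive[OF with_s_ge card_of_Pow_Pow])
  from ex_closed_for[OF with_s_inf s_with_s this, of ?Bl]
  obtain E where E: "C \<union> Inl ` ?Bl \<subseteq> E" "|E| \<le>o |Pow (Pow ?M')|" "closed_for ?M' ?Bl E"
    by (elim exE conjE)
  have "|E| <o lam" by (rule ordLeq_ordLess_trans[OF E(2) Pow_lam[OF Pow_lam[OF M'l]]])
  moreover have "Inl d \<notin> C" using d(2)[of d] d(1) by blast
  ultimately have "stage_sets X C E ?Bl d ?M'"
    unfolding stage_sets_def using C E KM' bF d(1) d2 by blast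
  then show ?thesis by blast
qed

text \<open>Each \<open>X i\<close> contains the earlier sets \<open>E j\<close> and the ordinals
  below \<open>a i\<close>. Fewer than \<open>k\<close> stages precede \<open>i\<close>, so
  \<open>UN_lam\<close> keeps \<open>X i\<close> below \<open>lam\<close>; the cofinal values
  \<open>a i\<close> later make the union of the families reach size \<open>lam\<close>.\<close>

lemma ex_stages:
  "\<exists>a X C E Bl d M'. a ` Field k \<subseteq> Field lam \<and> cofinal (a ` Field k) lam \<and>
     (\<forall>i\<in>Field k. stage_sets (X i) (C i) (E i) (Bl i) (d i) (M' i) \<and>
        Inl ` underS lam (a i) \<subseteq> X i \<and>
        (\<forall>j\<in>underS k i. E j \<subseteq> X i))"
proof -
  obtain A where A: "A \<subseteq> Field lam" "cofinal A lam" "|A| =o k"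
    using cof unfolding is_cofinality_def by blast
  have "|Field k| =o |A|"
    by (rule ordIso_transitive[OF card_of_Field_ordIso[OF k_card] ordIso_symmetric[OF A(3)]])
  then obtain a where a: "bij_betw a (Field k) A" using card_of_ordIso by blast
  have aA: "a ` Field k = A" using a by (simp add: bij_betw_def)
  obtain C E Bl d M' where st: "\<And>X. |X| <o lam \<Longrightarrow> stage_sets X (C X) (E X) (Bl X) (d X) (M' X)"
    using ex_stage_sets by metis

  have "\<exists>X. \<forall>i. X i = (\<Union>j\<in>{j. (j, i) \<in> k - Id}. E (X j)) \<union> Inl ` underS lam (a i)"
    by (rule dependent_wf_choice[OF wf_k]) auto
  then obtain X where X0: "\<And>i. X i = (\<Union>j\<in>{j. (j, i) \<in> k - Id}. E (X j)) \<union> Inl ` underS lam (a i)"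
    by blast
  have uS: "{j. (j, i) \<in> k - Id} = underS k i" for i
    by (auto simp: underS_def)
  note X = X0[unfolded uS]
  have Xl: "i \<in> Field k \<longrightarrow> |X i| <o lam" for i
    using wf_k
  proof (induction i)
    case (less i)
    show ?case
    proof
      assume i: "i \<in> Field k"
      have "|\<Union>j\<in>underS k i. E (X j)| <o lam"
      proof (rule UN_lam[OF card_of_underS[OF k_card i]])
        fix j assume "j \<in> underS k i"
        then have "(j, i) \<in> k - Id" "j \<in> Field k" by (auto simp: underS_def Field_def)
        then have "|X j| <o lam" using less.IH by blast
        then show "|E (X j)| <o lam" using st unfolding stage_sets_def by blast
      qed
      moreover have "a i \<in> Field lam" using i aA A(1) by blast
      ultimately show "|X i| <o lam"
        by (subst X) (intro Un_lam image_lam underS_lam)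
    qed
  qed
  show ?thesis
  proof (intro exI conjI ballI)
    show "a ` Field k \<subseteq> Field lam" "cofinal (a ` Field k) lam" using aA A by auto
    fix i assume i: "i \<in> Field k"
    show "stage_sets (X i) (C (X i)) (E (X i)) (Bl (X i)) (d (X i)) (M' (X i))"
      using st Xl i by blast
    show "Inl ` underS lam (a i) \<subseteq> X i" by (subst X) blast
    show "E (X j) \<subseteq> X i" if "j \<in> underS k i" for j
      using that by (subst (2) X) blast
  qed
qed

end

text \<open>The outcome of a stage: a large family of ordinals, for each \<open>e\<close> in it the condition \<open>run e i\<close>
  reached before the colour of \<open>{e, d i}\<close> is decided and the final condition \<open>tot e\<close>, the common
  set of those \<open>i\<close> for which this colour is green, one element of the family, the root of the
  Delta-system of the \<open>tot e\<close>, and the condition from which all of them were started.\<close>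

datatype ('l, 'k, 'c) stage =
  Stage (fam: "'l set") (run: "'l \<Rightarrow> 'k \<Rightarrow> ('c \<times> bool) set") (tot: "'l \<Rightarrow> ('c \<times> bool) set")
    (up: "'k set") (pick: 'l) (root: "('c \<times> bool) set") (base: "('c \<times> bool) set")

locale cohen_stages = cohen_singular s N lam Grn k
  for s :: "'s rel" and N :: "'c set" and lam :: "'l rel"
    and Grn :: "'l \<Rightarrow> 'l \<Rightarrow> ('c \<times> bool) set \<Rightarrow> bool" and k :: "'k rel" +
  fixes z :: "'z rel" and q0 :: "('c \<times> bool) set"
    and a :: "'k \<Rightarrow> 'l" and X C E :: "'k \<Rightarrow> ('l + 'c) set" and Bl :: "'k \<Rightarrow> 'l set"
    and d :: "'k \<Rightarrow> 'l" and M' :: "'k \<Rightarrow> (('l + 'c) + 's) set"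
  assumes z: "Well_order z" "z <o k" and arrow: "arrow k z" and q0: "cond s N q0"
    and no_green: "\<And>q Y. cond s N q \<Longrightarrow> q0 \<subseteq> q \<Longrightarrow> Y \<subseteq> Field lam \<Longrightarrow> Restr lam Y =o z \<Longrightarrow>
      (\<And>a b. a \<in> Y \<Longrightarrow> b \<in> Y \<Longrightarrow> a \<noteq> b \<Longrightarrow> Grn a b q) \<Longrightarrow> False"
    and a: "a ` Field k \<subseteq> Field lam" "cofinal (a ` Field k) lam"
    and stage_sets: "\<And>i. i \<in> Field k \<Longrightarrow> stage_sets (X i) (C i) (E i) (Bl i) (d i) (M' i)"
    and aX: "\<And>i. i \<in> Field k \<Longrightarrow> Inl ` underS lam (a i) \<subseteq> X i"
    and EX: "\<And>i j. i \<in> Field k \<Longrightarrow> j \<in> underS k i \<Longrightarrow> E j \<subseteq> X i"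
begin

section \<open>The construction of one stage from the earlier ones\<close>

abbreviation pr where "pr \<equiv> underS k"
abbreviation chi where "chi i \<equiv> |Pow (Pow (with_s (X i)))|"

lemma pr_F: "j \<in> pr i \<Longrightarrow> j \<in> Field k" "j \<in> pr i \<Longrightarrow> i \<in> Field k"
  by (auto simp: underS_def Field_def)

lemma pr_trans: "i \<in> pr j \<Longrightarrow> j \<in> pr l \<Longrightarrow> i \<in> pr l"
  using k_wo wo_rel.TRANS[of k] wo_rel.ANTISYM[of k]
  unfolding wo_rel_def trans_def antisym_def underS_def by blast

lemma pr_total: "i \<in> Field k \<Longrightarrow> j \<in> Field k \<Longrightarrow> i \<in> pr j \<or> i = j \<or> j \<in> pr i"
  using k_wo wo_rel.TOTALS[of k] by (auto simp: wo_rel_def underS_def)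

lemma pr_small: "i \<in> Field k \<Longrightarrow> |pr i| <o s"
  by (rule ordLess_transitive[OF card_of_underS[OF k_card] k_s])

lemma CE: "i \<in> Field k \<Longrightarrow> C i \<subseteq> E i"
  and XC: "i \<in> Field k \<Longrightarrow> X i \<subseteq> C i"
  and BlE: "i \<in> Field k \<Longrightarrow> Inl ` Bl i \<subseteq> E i"
  and dBl: "i \<in> Field k \<Longrightarrow> d i \<in> Bl i"
  and dC: "i \<in> Field k \<Longrightarrow> Inl (d i) \<notin> C i"
  and d_above: "i \<in> Field k \<Longrightarrow> c \<in> Bl i \<Longrightarrow> Inl c \<in> C i \<Longrightarrow> below c (d i)"
  using stage_sets[of i] unfolding stage_sets_def by blast+

lemma EC: "j \<in> pr i \<Longrightarrow> E j \<subseteq> C i"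
  using EX[of i j] XC[of i] pr_F by blast

lemma Bl_F: "i \<in> Field k \<Longrightarrow> Bl i \<subseteq> Field lam"
  using stage_sets[of i] unfolding stage_sets_def by (auto simp: underS_def Field_def)

definition start :: "('k \<Rightarrow> ('l, 'k, 'c) stage) \<Rightarrow> 'k \<Rightarrow> ('c \<times> bool) set" where
  "start f j = q0 \<union> (\<Union>i\<in>pr j. tot (f i) (pick (f i)))"

text \<open>The set \<open>up (f i)\<close> is found at stage \<open>i\<close> from the colours with
  \<open>d j\<close>; the last conjunct says that these carry over to the whole family of stage
  \<open>j\<close>. Greenness is kept only for the picked element, whose condition belongs to the
  sequence, but redness for all of \<open>fam (f i)\<close>, as the red set uses whole
  families.\<close>

definition stage_ok :: "('k \<Rightarrow> ('l, 'k, 'c) stage) \<Rightarrow> 'k \<Rightarrow> ('l, 'k, 'c) stage \<Rightarrow> bool" where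
  "stage_ok f j x \<longleftrightarrow>
    cnd (base x) \<and> start f j \<subseteq> base x \<and> fam x \<subseteq> Bl j \<and> \<not> |fam x| \<le>o chi j \<and> pick x \<in> fam x \<and>
    (\<forall>e\<in>fam x. Inl e \<in> E j \<and> Inl e \<notin> C j \<and> cnd (tot x e) \<and> base x \<subseteq> tot x e \<and> root x \<subseteq> tot x e) \<and>
    (\<forall>e\<in>fam x. \<forall>i. j \<in> pr i \<longrightarrow> run x e i \<subseteq> tot x e \<and>
        run x e i \<subseteq> base x \<union> {v. Inr (fst v) \<in> C i} \<and>
        (if i \<in> up x then Grn e (d i) (tot x e) else Red e (d i) (run x e i))) \<and>
    (\<forall>e\<in>fam x. \<forall>e'\<in>fam x. e \<noteq> e' \<longrightarrow> Red e e' (tot x e \<union> tot x e') \<and>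
        fst ` tot x e \<inter> fst ` tot x e' \<subseteq> fst ` root x) \<and>
    (\<forall>e\<in>fam x. \<forall>i\<in>pr j. if j \<in> up (f i) then Grn (pick (f i)) e (tot x e)
        else (\<forall>e'\<in>fam (f i). Red e' e (tot (f i) e' \<union> tot x e)))"

lemma stage_okD:
  assumes "stage_ok f j x"
  shows "cnd (base x)" "start f j \<subseteq> base x" "fam x \<subseteq> Bl j" "\<not> |fam x| \<le>o chi j" "pick x \<in> fam x"
    "e \<in> fam x \<Longrightarrow> Inl e \<in> E j" "e \<in> fam x \<Longrightarrow> Inl e \<notin> C j" "e \<in> fam x \<Longrightarrow> cnd (tot x e)"
    "e \<in> fam x \<Longrightarrow> base x \<subseteq> tot x e" "e \<in> fam x \<Longrightarrow> root x \<subseteq> tot x e"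
    "e \<in> fam x \<Longrightarrow> j \<in> pr i \<Longrightarrow> run x e i \<subseteq> tot x e"
    "e \<in> fam x \<Longrightarrow> j \<in> pr i \<Longrightarrow> run x e i \<subseteq> base x \<union> {v. Inr (fst v) \<in> C i}"
    "e \<in> fam x \<Longrightarrow> j \<in> pr i \<Longrightarrow> if i \<in> up x then Grn e (d i) (tot x e) else Red e (d i) (run x e i)"
    "e \<in> fam x \<Longrightarrow> e' \<in> fam x \<Longrightarrow> e \<noteq> e' \<Longrightarrow> Red e e' (tot x e \<union> tot x e')"
    "e \<in> fam x \<Longrightarrow> e' \<in> fam x \<Longrightarrow> e \<noteq> e' \<Longrightarrow> fst ` tot x e \<inter> fst ` tot x e' \<subseteq> fst ` root x"
    "e \<in> fam x \<Longrightarrow> i \<in> pr j \<Longrightarrow> j \<in> up (f i) \<Longrightarrow> Grn (pick (f i)) e (tot x e)"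
    "e \<in> fam x \<Longrightarrow> i \<in> pr j \<Longrightarrow> j \<notin> up (f i) \<Longrightarrow> e' \<in> fam (f i) \<Longrightarrow> Red e' e (tot (f i) e' \<union> tot x e)"
  using assms by (simp_all add: stage_ok_def)

lemma cnd_start:
  assumes f: "\<And>i. i \<in> I \<Longrightarrow> stage_ok f i (f i)" and I: "I \<subseteq> Field k" "\<And>i j. i \<in> I \<Longrightarrow> j \<in> pr i \<Longrightarrow> j \<in> I"
    and sm: "|I| <o s"
  shows "cnd (q0 \<union> (\<Union>i\<in>I. tot (f i) (pick (f i))))"
proof -
  let ?t = "\<lambda>i. tot (f i) (pick (f i))"
  have t: "cnd (?t i)" "start f i \<subseteq> ?t i" if "i \<in> I" for i
    using stage_okD(8)[OF f[OF that]] stage_okD(5)[OF f[OF that]]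
      order_trans[OF stage_okD(2)[OF f[OF that]] stage_okD(9)[OF f[OF that]]] by blast+
  have q0t: "q0 \<subseteq> ?t i" if "i \<in> I" for i
    using t(2)[OF that] unfolding start_def by (rule order_trans[OF Un_upper1])
  have tt: "?t i \<subseteq> ?t j" if "i \<in> pr j" "j \<in> I" for i j
    by (rule order_trans[OF _ t(2)[OF that(2)]]) (use that(1) in \<open>auto simp: start_def\<close>)
  show ?thesis
  proof (rule cnd_Un_chain[OF q0 sm t(1) q0t])
    fix i j assume ij: "i \<in> I" "j \<in> I"
    then have "i \<in> Field k" "j \<in> Field k" using I(1) by auto
    then consider "i \<in> pr j" | "i = j" | "j \<in> pr i" using pr_total by blast
    then show "?t i \<subseteq> ?t j \<or> ?t j \<subseteq> ?t i" by cases (use tt ij in simp_all)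
  qed
qed

lemma small_le_with_s: "|A| <o s \<Longrightarrow> |A| \<le>o |with_s Y|"
  by (rule ordLess_imp_ordLeq[OF ordLess_ordLeq_trans[OF _ s_with_s]])

text \<open>The ordinal \<open>d j\<close> already has prescribed colours with the earlier families.
  These, and its greenness with a maximal set \<open>y\<close>, are collected in \<open>F\<close>
  and inherited by the reflected family; then the colours with later \<open>d i\<close> are decided
  for each member and the family is thinned out.\<close>

lemma ex_stage:
  assumes j: "j \<in> Field k" and f: "\<And>i. i \<in> pr j \<Longrightarrow> stage_ok f i (f i)"
  shows "\<exists>x. stage_ok f j x"
proof -
  let ?M = "with_s (X j)"
  have iM: "infinite ?M" by (rule with_s_inf)
  have z_s: "|Field z| <o s"
    using z(2) k_s z(1) by (meson card_of_least ordLeq_ordLess_trans ordLess_transitive)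
  have q: "cnd (start f j)" "q0 \<subseteq> start f j"
    unfolding start_def
    by (rule cnd_start[OF f _ pr_trans pr_small[OF j]]) (auto intro: pr_F)
  let ?Z = "{c \<in> Bl j. Inl c \<in> C j}"
  have Z: "?Z \<subseteq> Field lam" using Bl_F[OF j] by blast
  have "\<exists>r y. cnd r \<and> start f j \<subseteq> r \<and> y \<subseteq> ?Z \<and> |y| <o s \<and> (\<forall>b\<in>y. Grn b (d j) r) \<and>
    (\<forall>a\<in>?Z. (\<forall>b\<in>y. below b a) \<longrightarrow>
       (\<forall>q. cnd q \<longrightarrow> r \<subseteq> q \<longrightarrow> \<not> (Grn a (d j) q \<and> (\<forall>b\<in>y. Grn a b q))))"
    by (rule ex_stuck_green[OF z(1) z_s _ q Z]) (rule no_green)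
  then obtain r y where r: "cnd r" "start f j \<subseteq> r" and y: "y \<subseteq> ?Z" "|y| <o s" "\<forall>b\<in>y. Grn b (d j) r"
    and stuck: "\<forall>a\<in>?Z. (\<forall>b\<in>y. below b a) \<longrightarrow>
       (\<forall>q. cnd q \<longrightarrow> r \<subseteq> q \<longrightarrow> \<not> (Grn a (d j) q \<and> (\<forall>b\<in>y. Grn a b q)))" by (elim exE conjE)
  let ?r = "restr (C j) r"
  let ?I1 = "{i \<in> pr j. j \<notin> up (f i)}" and ?I2 = "{i \<in> pr j. j \<in> up (f i)}"
  \<comment> \<open>For red pairs the parameter is the part in \<open>C j\<close> of the condition
    reached before \<open>d j\<close>; for green pairs the picked condition is contained in
    \<open>r\<close>, so the part of \<open>r\<close> in \<open>C j\<close> serves.\<close>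
  define F where "F = (\<Union>i\<in>?I1. (\<lambda>e'. (e', restr (C j) (run (f i) e' j), False)) ` fam (f i)) \<union>
    (\<lambda>i. (pick (f i), ?r, True)) ` ?I2 \<union> (\<lambda>b. (b, ?r, True)) ` y"
  have fE: "e' \<in> fam (f i) \<Longrightarrow> Inl e' \<in> E i" "e' \<in> fam (f i) \<Longrightarrow> cnd (tot (f i) e')" "pick (f i) \<in> fam (f i)"
    "base (f i) \<subseteq> tot (f i) (pick (f i))" if "i \<in> pr j" for i e'
    using stage_okD(6,8)[OF f[OF that]] stage_okD(5)[OF f[OF that]]
      stage_okD(9)[OF f[OF that] stage_okD(5)[OF f[OF that]]] by simp_all
  have frun: "run (f i) e' j \<subseteq> tot (f i) e'" "run (f i) e' j \<subseteq> base (f i) \<union> {v. Inr (fst v) \<in> C j}"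
    "if j \<in> up (f i) then Grn e' (d j) (tot (f i) e') else Red e' (d j) (run (f i) e' j)"
    if "i \<in> pr j" "e' \<in> fam (f i)" for i e'
    using stage_okD(11,12,13)[OF f[OF that(1)] that(2,1)] by simp_all
  have tr: "tot (f i) (pick (f i)) \<subseteq> r" if "i \<in> pr j" for i
    using r(2) that unfolding start_def by blast
  have prM: "|I| \<le>o |?M|" if "I \<subseteq> pr j" for I
    by (rule small_le_with_s[OF ordLeq_ordLess_trans[OF card_of_mono1[OF that] pr_small[OF j]]])
  have famM: "|fam (f i)| \<le>o |?M|" if i: "i \<in> pr j" for i
  proof -
    have "|fam (f i)| \<le>o |X j|" by (rule card_of_ordLeqI[of Inl]) (use fE(1)[OF i] EX[OF j i] in auto)
    then show ?thesis by (rule ordLeq_transitive[OF _ with_s_ge])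
  qed
  have "|F| \<le>o |?M|"
    unfolding F_def
    by (intro card_of_Un_le[OF iM] card_of_UN_le[OF iM] card_of_image_le small_le_with_s[OF y(2)] famM prM) auto
  have Fmem: "Inl b \<in> C j \<and> (coords t :: ('l + 'c) set) \<subseteq> C j \<and> cnd t \<and>
      (if c then Grn b (d j) (t \<union> (r - ?r)) else Red b (d j) (t \<union> (r - ?r)))"
    if "(b, t, c) \<in> F" for b t c
  proof -
    have rr: "?r \<union> (r - ?r) = r" using restr_subset[of "C j" r] by blast
    have cr: "cnd ?r" by (rule cnd_subset[OF r(1) restr_subset])
    from that consider (1) i where "i \<in> ?I1" "b \<in> fam (f i)" "t = restr (C j) (run (f i) b j)" "\<not> c"
      | (2) i where "i \<in> ?I2" "b = pick (f i)" "t = ?r" c | (3) "b \<in> y" "t = ?r" c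
      unfolding F_def by blast
    then show ?thesis
    proof cases
      case 1
      then have i: "i \<in> pr j" and nu: "j \<notin> up (f i)" by auto
      \<comment> \<open>Outside \<open>C j\<close> the condition \<open>run (f i) b j\<close> lies
        in \<open>base (f i)\<close>, which the picked member has passed on to
        \<open>r\<close>.\<close>
      have "run (f i) b j \<subseteq> t \<union> (r - ?r)"
      proof
        fix v assume v: "v \<in> run (f i) b j"
        show "v \<in> t \<union> (r - ?r)"
        proof (cases "Inr (fst v) \<in> C j")
          case True then show ?thesis using v 1(3) by (simp add: restr_def)
        next
          case False
          then have "v \<in> base (f i)" using frun(2)[OF i 1(2)] v by blast
          then have "v \<in> r" using fE(4)[OF i] tr[OF i] by blast
          then show ?thesis using False by (simp add: restr_def)
        qed
      qed
      moreover have "Red b (d j) (run (f i) b j)" using frun(3)[OF i 1(2)] nu by simp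
      ultimately have "Red b (d j) (t \<union> (r - ?r))" by (rule Red_mono[rotated])
      moreover have "cnd t"
        unfolding 1(3) by (rule cnd_subset[OF fE(2)[OF i 1(2)] order_trans[OF restr_subset frun(1)[OF i 1(2)]]])
      moreover have "Inl b \<in> C j" using fE(1)[OF i 1(2)] EC[OF i] by blast
      ultimately show ?thesis using 1(3,4) coords_restr by metis
    next
      case 2
      then have i: "i \<in> pr j" and u: "j \<in> up (f i)" by auto
      have "Grn b (d j) (tot (f i) b)" using frun(3)[OF i fE(3)[OF i]] u 2(2) by simp
      then have "Grn b (d j) r" by (rule Grn_mono) (use tr[OF i] 2(2) r(1) in auto)
      moreover have "Inl b \<in> C j" using fE(1)[OF i fE(3)[OF i]] EC[OF i] 2(2) by blast
      ultimately show ?thesis using 2 rr cr coords_restr by metis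
    next
      case 3
      then show ?thesis using y(1,3) rr cr coords_restr[of "C j" r] by (auto simp del: coords_iff coords_restr)
    qed
  qed
  have supp: "param_supp F y ?r {} \<subseteq> C j"
    using Fmem y(1) unfolding param_supp_def by (fastforce simp: restr_def coords_def)
  have suppM: "|param_supp F y ?r {}| \<le>o |?M|"
  proof -
    have "|coords (fst (snd x)) :: ('l + 'c) set| \<le>o |?M|" if "x \<in> F" for x
      by (rule small_le_with_s[OF coords_small]) (use Fmem[of "fst x" "fst (snd x)" "snd (snd x)"] that in simp)
    moreover have "|coords ?r :: ('l + 'c) set| \<le>o |?M|"
      by (rule small_le_with_s[OF coords_small[OF cnd_subset[OF r(1) restr_subset]]])
    ultimately show ?thesis
      unfolding param_supp_def
      by (intro card_of_Un_le[OF iM] card_of_UN_le[OF iM] card_of_image_le \<open>|F| \<le>o |?M|\<close>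
          small_le_with_s[OF y(2)] card_of_empty)
  qed
  have st: "closed_for ?M (Bl j) (C j)" "|C j| \<le>o chi j" "closed_for (M' j) (Bl j) (E j)" "chi j \<le>o |M' j|"
    using stage_sets[OF j] unfolding stage_sets_def by blast+
  obtain A S where A: "A \<subseteq> Bl j" "\<not> |A| \<le>o chi j"
    and AS: "\<forall>a\<in>A. Inl a \<in> E j \<and> Inl a \<notin> C j \<and> cnd (S a) \<and> coords (S a) \<subseteq> E j \<and>
        coords (S a) \<inter> (C j \<union> coords r) = {} \<and>
        (\<forall>(b, t, c) \<in> F. if c then Grn b a (t \<union> S a) else Red b a (t \<union> S a))"
    and Ared: "\<forall>a\<in>A. \<forall>a'\<in>A. a \<noteq> a' \<longrightarrow> Red a a' (?r \<union> S a \<union> S a')"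
  proof (rule ex_reflection_family[OF iM s_with_s st(4) st(1,2,3) CE[OF j] supp suppM r(1) dBl[OF j] dC[OF j]])
    show "below b (d j)" if "b \<in> y" for b using d_above[OF j] y(1) that by blast
    show "if c then Grn b (d j) (t \<union> (r - ?r)) else Red b (d j) (t \<union> (r - ?r))"
      if "(b, t, c) \<in> F" for b t c using Fmem[OF that] by blast
    show "(b, ?r, True) \<in> F" if "b \<in> y" for b using that by (simp add: F_def)
    show False if "a \<in> Bl j" "Inl a \<in> C j" "\<And>b. b \<in> y \<Longrightarrow> below b a" "cnd q" "r \<subseteq> q" "Grn a (d j) q"
      "\<And>b. b \<in> y \<Longrightarrow> Grn a b q" for a q
      using stuck that by blast
  qed
  let ?J = "{i \<in> Field k. j \<in> pr i}"
  have "\<exists>rn tt u. decides k ?J E d (r \<union> S e) e rn tt u" if e: "e \<in> A" for e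
  proof (rule ex_decide_colours[OF k_wo Field_k_s])
    show "?J \<subseteq> Field k" by blast
    have "fst ` r \<inter> fst ` S e = {}" using AS e unfolding coords_def by blast
    then show "cnd (r \<union> S e)" using AS e r(1) by (intro cnd_Un[of r "S e" "{}"]) auto
    fix i p assume i: "i \<in> ?J" and p: "cnd p" "coords p \<subseteq> E i" and ex: "\<exists>q. cnd q \<and> p \<subseteq> q \<and> Grn e (d i) q"
    have iF: "i \<in> Field k" and ji: "j \<in> pr i" using i by auto
    have aC: "Inl e \<in> C i" using AS e EC[OF ji] by blast
    then have ne: "e \<noteq> d i" using dC[OF iF] by blast
    \<comment> \<open>The first clause of closure is applied to the two-element green set
      \<open>{e, d i}\<close>. This needs \<open>E i\<close>, because \<open>d i\<close> is not in
      \<open>C i\<close>.\<close>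
    let ?s = "param_supp {} {e, d i} p {}"
    have 1: "?s \<subseteq> E i"
      using p(2) aC CE[OF iF] BlE[OF iF] dBl[OF iF] unfolding param_supp_def by blast
    have st: "closed_for (M' i) (Bl i) (E i)" "chi i \<le>o |M' i|"
      using stage_sets[OF iF] unfolding stage_sets_def by blast+
    have M'i: "infinite (M' i)" "|with_s (X i)| \<le>o |M' i|"
    proof -
      show "|with_s (X i)| \<le>o |M' i|"
        by (rule ordLeq_transitive[OF card_of_Pow_Pow st(2)])
      then show "infinite (M' i)" using with_s_inf card_of_ordLeq_infinite by blast
    qed
    have "|?s| \<le>o |M' i|"
      unfolding param_supp_def
      by (intro card_of_Un_le[OF M'i(1)] ordLeq_transitive[OF small_le_with_s[OF coords_small[OF p(1)]] M'i(2)]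
          card_of_finite_le[OF M'i(1)]) auto
    from st(1)[unfolded closed_for_def, rule_format, OF conjI, OF 1 this, unfolded witnessed_in_def, THEN conjunct1, THEN mp]
    have "\<exists>q. cnd q \<and> p \<subseteq> q \<and> (\<forall>a\<in>{e, d i}. \<forall>b\<in>{e, d i}. a \<noteq> b \<longrightarrow> Grn a b q) \<and> coords q \<subseteq> E i"
      using ex Grn_sym by blast
    then show "\<exists>q. cnd q \<and> p \<subseteq> q \<and> Grn e (d i) q \<and> coords q \<subseteq> E i" using ne by blast
  qed
  then obtain rn tt u' where dec: "\<And>e. e \<in> A \<Longrightarrow> decides k ?J E d (r \<union> S e) e (rn e) (tt e) (u' e)"
    by metis
  \<comment> \<open>\<open>decides\<close> does not restrict \<open>u' e\<close> outside
    \<open>?J\<close>; cutting it to \<open>Field k\<close> leaves at most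
    \<open>|Pow (Field k)|\<close> labels for the Delta-system.\<close>
  define u where "u e = u' e \<inter> Field k" for e
  have tt: "cnd (tt e)" "r \<union> S e \<subseteq> tt e" if "e \<in> A" for e
    using dec[OF that] unfolding decides_def by blast+
  have rn: "rn e i \<subseteq> tt e" "rn e i \<subseteq> (r \<union> S e) \<union> {x. \<exists>l\<in>?J. (l, i) \<in> k - Id \<and> Inr (fst x) \<in> E l}"
     "i \<in> u e \<Longrightarrow> Grn e (d i) (tt e)" "i \<notin> u e \<Longrightarrow> Red e (d i) (rn e i)"
    if "e \<in> A" "j \<in> pr i" for e i
  proof -
    have i: "i \<in> ?J" using that(2) pr_F by blast
    note w = bspec[OF conjunct2[OF conjunct2[OF dec[OF that(1), unfolded decides_def]]] i]
    show "rn e i \<subseteq> tt e" "rn e i \<subseteq> (r \<union> S e) \<union> {x. \<exists>l\<in>?J. (l, i) \<in> k - Id \<and> Inr (fst x) \<in> E l}"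
      by (fact w[THEN conjunct1] w[THEN conjunct2, THEN conjunct1])+
    show "i \<in> u e \<Longrightarrow> Grn e (d i) (tt e)" using w unfolding u_def by simp
    show "i \<notin> u e \<Longrightarrow> Red e (d i) (rn e i)" using w i unfolding u_def by simp
  qed
  have "|Field k| \<le>o |?M|" by (rule small_le_with_s[OF Field_k_s])
  then have "|Pow (Field k)| \<le>o chi j"
    by (rule ordLeq_transitive[OF card_of_Pow_mono ordLess_imp_ordLeq[OF card_of_Pow]])
  then have uA: "|u ` A| \<le>o chi j" by (rule card_of_subset_le[rotated]) (auto simp: u_def)
  have "\<exists>B \<subseteq> A. \<exists>rt v. \<not> |B| \<le>o chi j \<and> (\<forall>a\<in>B. u a = v \<and> rt \<subseteq> tt a) \<and>
    (\<forall>a\<in>B. \<forall>b\<in>B. a \<noteq> b \<longrightarrow> fst ` tt a \<inter> fst ` tt b \<subseteq> fst ` rt)"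
    by (rule ex_delta_system[OF iM s_with_s _ uA A(2)]) (rule tt(1))
  then obtain B rt v where B: "B \<subseteq> A" "\<not> |B| \<le>o chi j" "\<forall>a\<in>B. u a = v \<and> rt \<subseteq> tt a"
    "\<forall>a\<in>B. \<forall>b\<in>B. a \<noteq> b \<longrightarrow> fst ` tt a \<inter> fst ` tt b \<subseteq> fst ` rt" by (elim exE conjE)
  have "B \<noteq> {}" using B(2) card_of_empty by blast
  then obtain p where p: "p \<in> B" by blast
  have BA: "e \<in> A" if "e \<in> B" for e using B(1) that by blast
  have "stage_ok f j (Stage B rn tt v p rt r)"
    unfolding stage_ok_def stage.sel
  proof (intro conjI ballI allI impI)
    show "cnd r" "start f j \<subseteq> r" "\<not> |B| \<le>o chi j" "p \<in> B" by fact+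
    show "B \<subseteq> Bl j" using A(1) B(1) by blast
    fix e assume e: "e \<in> B"
    note eA = BA[OF e]
    show "Inl e \<in> E j" "Inl e \<notin> C j" using AS eA by blast+
    show "cnd (tt e)" by (rule tt(1)[OF eA])
    show "r \<subseteq> tt e" using tt(2)[OF eA] by blast
    show "rt \<subseteq> tt e" using B(3) e by blast
    {
      fix i assume i: "j \<in> pr i"
      show "rn e i \<subseteq> tt e" by (rule rn(1)[OF eA i])
      \<comment> \<open>\<open>E l\<close> lies in \<open>C i\<close> for \<open>l\<close> before
        \<open>i\<close>, so the decisions made before \<open>i\<close> stay inside
        \<open>C i\<close>.\<close>
      show "rn e i \<subseteq> r \<union> {v. Inr (fst v) \<in> C i}"
      proof
        fix v assume "v \<in> rn e i"
        then consider "v \<in> r" | "v \<in> S e" | l where "l \<in> pr i" "Inr (fst v) \<in> E l"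
          using rn(2)[OF eA i] by (auto simp: underS_def)
        then show "v \<in> r \<union> {v. Inr (fst v) \<in> C i}"
        proof cases
          case 2
          then have "Inr (fst v) \<in> E j" using AS eA unfolding coords_iff by blast
          then show ?thesis using EC[OF i] by blast
        next
          case 3
          then show ?thesis using EC[OF 3(1)] by blast
        qed blast
      qed
      have "u e = v" using B(3) e by blast
      then show "if i \<in> v then Grn e (d i) (tt e) else Red e (d i) (rn e i)"
        using rn(3,4)[OF eA i] by simp
    next
      fix e' assume e': "e' \<in> B" "e \<noteq> e'"
      have "Red e e' (?r \<union> S e \<union> S e')" using Ared eA BA[OF e'(1)] e'(2) by blast
      then show "Red e e' (tt e \<union> tt e')"
        by (rule Red_mono) (use tt(2)[OF eA] tt(2)[OF BA[OF e'(1)]] restr_subset[of "C j" r] in blast)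
      show "fst ` tt e \<inter> fst ` tt e' \<subseteq> fst ` rt" using B(4) e e' by blast
    next
      fix i assume i: "i \<in> pr j"
      have AF: "if c then Grn b e (t \<union> S e) else Red b e (t \<union> S e)" if "(b, t, c) \<in> F" for b t c
        using AS eA that by fast
      show "if j \<in> up (f i) then Grn (pick (f i)) e (tt e) else \<forall>e'\<in>fam (f i). Red e' e (tot (f i) e' \<union> tt e)"
      proof (cases "j \<in> up (f i)")
        case True
        then have "(pick (f i), ?r, True) \<in> F" using i unfolding F_def by blast
        from AF[OF this] have "Grn (pick (f i)) e (?r \<union> S e)" by simp
        then have "Grn (pick (f i)) e (tt e)"
          by (rule Grn_mono) (use tt[OF eA] restr_subset[of "C j" r] in blast)+
        then show ?thesis using True by simp
      next
        case False
        have "Red e' e (tot (f i) e' \<union> tt e)" if e': "e' \<in> fam (f i)" for e'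
        proof -
          have "(e', restr (C j) (run (f i) e' j), False) \<in> F" using i False e' unfolding F_def by blast
          from AF[OF this] have "Red e' e (restr (C j) (run (f i) e' j) \<union> S e)" by simp
          then show ?thesis
            by (rule Red_mono)
              (use tt(2)[OF eA] frun(1)[OF i e'] restr_subset[of "C j" "run (f i) e' j"] in blast)
        qed
        then show ?thesis using False by simp
      qed
    }
  qed
  then show ?thesis by blast
qed

end

section \<open>The combinatorial dichotomy\<close>

text \<open>\<open>En m x r\<close> reads that \<open>r\<close> forces the \<open>m\<close>-th
  element to be \<open>x\<close>. The clauses describe a name, below \<open>q\<close>, of an
  injective enumeration of a red set indexed by \<open>Field lam\<close>.\<close>

definition (in cohen) red_enumeration ::
  "('c \<times> bool) set \<Rightarrow> ('l \<Rightarrow> 'l \<Rightarrow> ('c \<times> bool) set \<Rightarrow> bool) \<Rightarrow> bool" where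
  "red_enumeration q En \<longleftrightarrow>
     (\<forall>m x r. En m x r \<longrightarrow> m \<in> Field lam \<and> x \<in> Field lam \<and> cnd r) \<and>
     (\<forall>m x r r'. En m x r \<longrightarrow> cnd r' \<longrightarrow> r \<subseteq> r' \<longrightarrow> En m x r') \<and>
     (\<forall>m\<in>Field lam. \<forall>r. cnd r \<longrightarrow> q \<subseteq> r \<longrightarrow> (\<exists>x r'. r \<subseteq> r' \<and> En m x r')) \<and>
     (\<forall>m m' x x' r. En m x r \<longrightarrow> En m' x' r \<longrightarrow> (m = m' \<longleftrightarrow> x = x')) \<and>
     (\<forall>m m' x x' r. En m x r \<longrightarrow> En m' x' r \<longrightarrow> x \<noteq> x' \<longrightarrow> Red x x' r)"

context cohen_stages
begin

section \<open>All stages, and the colouring of \<open>k\<close> that they induce\<close>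

lemma stage_ok_cong:
  assumes "\<And>i. i \<in> pr j \<Longrightarrow> f i = g i"
  shows "stage_ok f j x = stage_ok g j x"
proof -
  have "start f j = start g j" using assms by (simp add: start_def)
  then show ?thesis using assms by (simp add: stage_ok_def)
qed

lemma ex_stages_ok: "\<exists>f. \<forall>j\<in>Field k. stage_ok f j (f j)"
proof -
  have "\<exists>f. \<forall>j. j \<in> Field k \<longrightarrow> stage_ok f j (f j)"
  proof (rule dependent_wf_choice[OF wf_k])
    fix f g :: "'k \<Rightarrow> ('l, 'k, 'c) stage" and j x
    assume "\<And>w. (w, j) \<in> k - Id \<Longrightarrow> f w = g w"
    then have "stage_ok f j x = stage_ok g j x"
      by (intro stage_ok_cong) (auto simp: underS_def)
    then show "(j \<in> Field k \<longrightarrow> stage_ok f j x) = (j \<in> Field k \<longrightarrow> stage_ok g j x)" by simp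
  next
    fix j and f :: "'k \<Rightarrow> ('l, 'k, 'c) stage"
    assume IH: "\<And>i. (i, j) \<in> k - Id \<Longrightarrow> i \<in> Field k \<longrightarrow> stage_ok f i (f i)"
    have "stage_ok f i (f i)" if "i \<in> pr j" for i
      using IH[of i] pr_F(1)[OF that] that by (simp add: underS_def)
    then show "\<exists>x. j \<in> Field k \<longrightarrow> stage_ok f j x" using ex_stage by blast
  qed
  then show ?thesis by blast
qed

text \<open>Pairs \<open>{i, j}\<close> of \<open>k\<close> are coloured by membership of
  \<open>j\<close> in \<open>up (f i)\<close>. The green alternative of \<open>arrow k z\<close> is
  refuted by the picked ordinals, so the red one supplies the families to be enumerated.\<close>

lemma ex_red_enumeration: "\<exists>q En. cnd q \<and> q0 \<subseteq> q \<and> red_enumeration q En"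
proof -
  obtain f where f: "\<And>j. j \<in> Field k \<Longrightarrow> stage_ok f j (f j)" using ex_stages_ok by blast
  define q where "q = q0 \<union> (\<Union>i\<in>Field k. tot (f i) (pick (f i)))"
  have q: "cnd q" unfolding q_def by (rule cnd_start[OF f _ _ Field_k_s]) (auto intro: pr_F)
  have q0q: "q0 \<subseteq> q" by (auto simp: q_def)
  have pick: "pick (f i) \<in> fam (f i)" "tot (f i) (pick (f i)) \<subseteq> q" if "i \<in> Field k" for i
    using stage_okD(5)[OF f[OF that]] that by (auto simp: q_def)
  have famF: "fam (f i) \<subseteq> Field lam" if "i \<in> Field k" for i
    using stage_okD(3)[OF f[OF that]] Bl_F[OF that] by blast
  have pr_asym: "i \<in> pr j \<Longrightarrow> j \<notin> pr i" for i j
    using pr_trans[of i j i] by (auto simp: underS_def)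
  define c where "c e = (if \<exists>i j. e = {i, j} \<and> i \<in> pr j \<and> j \<in> up (f i) then Green else colour.Red)" for e
  have c: "c {i, j} = Green \<longleftrightarrow> j \<in> up (f i)" if "i \<in> pr j" for i j
  proof
    assume "c {i, j} = Green"
    then obtain i' j' where "{i, j} = {i', j'}" "i' \<in> pr j'" "j' \<in> up (f i')"
      unfolding c_def by (auto split: if_splits)
    then show "j \<in> up (f i)" using pr_asym[OF that] by (auto simp: doubleton_eq_iff)
  next
    assume "j \<in> up (f i)"
    then show "c {i, j} = Green" using that unfolding c_def by auto
  qed
  from arrow[unfolded arrow_def, THEN spec, of c]
  consider (red) K where "K \<subseteq> Field k" "|K| =o k" "\<forall>x\<in>K. \<forall>y\<in>K. x \<noteq> y \<longrightarrow> c {x, y} = colour.Red"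
    | (green) I where "I \<subseteq> Field k" "Restr k I =o z" "\<forall>x\<in>I. \<forall>y\<in>I. x \<noteq> y \<longrightarrow> c {x, y} = Green"
    by blast
  then show ?thesis
  proof cases
    case green
    let ?p = "\<lambda>i. pick (f i)"
    have FI: "Field (Restr k I) = I"
      using k_wo green(1) by (intro Refl_Field_Restr2) (simp_all add: order_on_defs)
    \<comment> \<open>Otherwise \<open>?p j\<close> would lie in the initial segment
      \<open>Bl i\<close>, hence in \<open>E i\<close>, which is contained in \<open>C j\<close>;
      but the family of stage \<open>j\<close> avoids \<open>C j\<close>.\<close>
    have mono: "below (?p i) (?p j)" if ij: "i \<in> pr j" for i j
    proof (rule ccontr)
      assume n: "\<not> ?thesis"
      have iF: "i \<in> Field k" and jF: "j \<in> Field k" using pr_F[OF ij] by auto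
      have ji: "Inl (?p j) \<notin> E i"
        using stage_okD(7)[OF f[OF jF] pick(1)[OF jF]] EC[OF ij] by blast
      have piB: "?p i \<in> Bl i" using stage_okD(3,5)[OF f[OF iF]] by blast
      then have "?p j \<noteq> ?p i" using ji BlE[OF iF] by auto
      then have b: "below (?p j) (?p i)"
        using n lam_total[of "?p i" "?p j"] pick(1)[OF iF] pick(1)[OF jF] famF[OF iF] famF[OF jF] by auto
      obtain b' where "Bl i = underS lam b'"
        using stage_sets[OF iF] unfolding stage_sets_def by blast
      then have "?p j \<in> Bl i"
        using below_trans[OF b, of b'] piB by (auto simp: underS_def below_def)
      then show False using ji BlE[OF iF] by blast
    qed
    have "Restr lam (?p ` Field (Restr k I)) =o Restr k I"
    proof (rule Restr_image_ordIso[OF lam_wo Well_order_Restr[OF k_wo]])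
      show "?p ` Field (Restr k I) \<subseteq> Field lam" unfolding FI using green(1) pick(1) famF by blast
      fix i j assume "(i, j) \<in> Restr k I" "i \<noteq> j"
      then show "?p i \<noteq> ?p j \<and> (?p i, ?p j) \<in> lam"
        using mono[of i j] by (auto simp: underS_def below_def)
    qed
    then have ot: "Restr lam (?p ` I) =o z" unfolding FI by (rule ordIso_transitive[OF _ green(2)])
    have gr: "Grn (?p i) (?p j) q" if "i \<in> pr j" "i \<in> I" "j \<in> I" for i j
    proof -
      have "i \<noteq> j" using that(1) by (auto simp: underS_def)
      then have "j \<in> up (f i)" using green(3) that c[OF that(1)] by blast
      then have "Grn (?p i) (?p j) (tot (f j) (?p j))"
        using stage_okD(16)[OF f pick(1) that(1)] green(1) that(3) by blast
      then show ?thesis by (rule Grn_mono) (use pick(2) green(1) that(3) q in auto)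
    qed
    have False
    proof (rule no_green[OF q q0q _ ot])
      show "?p ` I \<subseteq> Field lam" using green(1) pick(1) famF by blast
      fix x y assume "x \<in> ?p ` I" "y \<in> ?p ` I" "x \<noteq> y"
      then obtain i j where ij: "i \<in> I" "j \<in> I" "x = ?p i" "y = ?p j" "i \<noteq> j" by blast
      then have "i \<in> pr j \<or> j \<in> pr i" using pr_total green(1) by blast
      then show "Grn x y q" using gr[of i j] gr[of j i] ij Grn_sym by blast
    qed
    then show ?thesis ..
  next
    case red
    note KF = subsetD[OF red(1)]
    define J where "J e = (THE j. j \<in> K \<and> e \<in> fam (f j))" for e
    define Pool where "Pool = (\<Union>j\<in>K. fam (f j))"
    define t where "t e = tot (f (J e)) e" for e
    have disj: "False" if "i \<in> pr j" "e \<in> fam (f i)" "e \<in> fam (f j)" for i j e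
      using stage_okD(6)[OF f that(2)] stage_okD(7)[OF f that(3)] EC[OF that(1)] pr_F[OF that(1)] by blast
    have J: "J e = j" if "j \<in> K" "e \<in> fam (f j)" for j e
      unfolding J_def
    proof (rule the_equality)
      fix i assume "i \<in> K \<and> e \<in> fam (f i)"
      then show "i = j" using disj[of i j e] disj[of j i e] that pr_total[of i j] KF by blast
    qed (use that in blast)
    have JP: "J e \<in> K" "e \<in> fam (f (J e))" if "e \<in> Pool" for e
      using that J unfolding Pool_def by auto
    have tc: "cnd (t e)" if "e \<in> Pool" for e
      unfolding t_def by (rule stage_okD(8)[OF f JP(2)]) (use JP that KF in auto)
    have redlt: "Red e e' (t e \<union> t e')" if "e \<in> Pool" "e' \<in> Pool" "J e \<in> pr (J e')" for e e'
    proof -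
      have "J e \<noteq> J e'" using that(3) by (auto simp: underS_def)
      then have "J e' \<notin> up (f (J e))" using red(3) JP[OF that(1)] JP[OF that(2)] c[OF that(3)] by force
      then show ?thesis unfolding t_def
        using stage_okD(17)[OF f[OF KF[OF JP(1)[OF that(2)]]] JP(2)[OF that(2)] that(3) _ JP(2)[OF that(1)]] by blast
    qed
    have pred: "Red e e' (t e \<union> t e')" if "e \<in> Pool" "e' \<in> Pool" "e \<noteq> e'" for e e'
    proof -
      have "J e \<in> Field k" "J e' \<in> Field k" using JP(1) that KF by blast+
      then consider "J e \<in> pr (J e')" | "J e' \<in> pr (J e)" | "J e = J e'"
        using pr_total by blast
      then show ?thesis
      proof cases
        case 2
        then show ?thesis using Red_sym[OF redlt[OF that(2,1)]] by (simp add: Un_commute)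
      next
        case 3
        then show ?thesis
          using stage_okD(14)[OF f[OF KF[OF JP(1)[OF that(1)]]] JP(2)[OF that(1)]] JP(2)[OF that(2)] that(3)
          by (simp add: t_def)
      qed (use redlt that in blast)
    qed
    \<comment> \<open>Over the root the domains of the \<open>t e\<close> are disjoint, so
      incompatibility of \<open>r\<close> with all of them would send \<open>G\<close> injectively
      into the domain of \<open>r\<close>, which has size below \<open>s\<close>.\<close>
    have large: "\<exists>e\<in>G. cnd (r \<union> t e)"
      if j: "j \<in> K" and G: "G \<subseteq> fam (f j)" "\<not> |G| <o s" and r: "cnd r" "q \<subseteq> r" for j G r
    proof (rule ccontr)
      assume n: "\<not> ?thesis"
      note fj = f[OF KF[OF j]]
      have GP: "e \<in> Pool" "t e = tot (f j) e" if "e \<in> G" for e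
        using that G(1) j J[of j e] by (auto simp: Pool_def t_def)
      have rootq: "root (f j) \<subseteq> r"
        using stage_okD(10)[OF fj stage_okD(5)[OF fj]] pick(2)[OF KF[OF j]] r(2) by blast
      have "\<exists>v. v \<in> fst ` t e \<and> v \<in> fst ` r \<and> v \<notin> fst ` root (f j)" if "e \<in> G" for e
      proof (rule ccontr)
        assume "\<not> ?thesis"
        then have "fst ` r \<inter> fst ` t e \<subseteq> fst ` root (f j)" by blast
        moreover have "root (f j) \<subseteq> t e" using stage_okD(10)[OF fj] G(1) that GP(2)[OF that] by auto
        ultimately have "cnd (r \<union> t e)" by (rule cnd_Un[OF r(1) tc[OF GP(1)[OF that]] rootq, rotated])
        then show False using n that by blast
      qed
      then obtain v where v: "\<And>e. e \<in> G \<Longrightarrow> v e \<in> fst ` t e \<and> v e \<in> fst ` r \<and> v e \<notin> fst ` root (f j)"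
        by metis
      have "inj_on v G"
      proof (rule inj_onI, rule ccontr)
        fix e e' assume ab: "e \<in> G" "e' \<in> G" "v e = v e'" "e \<noteq> e'"
        have "fst ` t e \<inter> fst ` t e' \<subseteq> fst ` root (f j)"
          using stage_okD(15)[OF fj _ _ ab(4)] ab G(1) GP(2) by auto
        then show False using v[OF ab(1)] v[OF ab(2)] ab(3) by auto
      qed
      then have "|G| \<le>o |fst ` r|" by (rule card_of_ordLeqI) (use v in blast)
      also have "|fst ` r| \<le>o |r|" by (rule card_of_image)
      also have "|r| <o s" using r(1) by (simp add: cond_def)
      finally show False using G(2) by blast
    qed
    have PoolF: "Pool \<subseteq> Field lam" using famF KF unfolding Pool_def by blast
    have chi_fam: "\<not> |fam (f j)| \<le>o chi j" if "j \<in> K" for j by (rule stage_okD(4)[OF f[OF KF[OF that]]])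
    \<comment> \<open>Otherwise some \<open>X i\<close> contains a segment of the size of the pool.
      As \<open>K\<close> is unbounded in \<open>k\<close>, some \<open>j\<close> in
      \<open>K\<close> is not before \<open>i\<close>, and its family is larger than
      \<open>X j\<close>, which contains that segment.\<close>
    have "\<not> |Pool| <o lam"
    proof
      assume "|Pool| <o lam"
      then obtain b where b: "b \<in> Field lam" "|Pool| =o |underS lam b|"
        using ex_underS_lam by blast
      then obtain i where i: "i \<in> Field k" "below b (a i)"
        using a(2) unfolding cofinal_def below_def by blast
      have "\<not> K \<subseteq> pr i"
      proof
        assume "K \<subseteq> pr i"
        from ordLeq_ordLess_trans[OF card_of_mono1[OF this] card_of_underS[OF k_card i(1)]]
        have "|K| <o k" .
        then show False using red(2) not_ordLess_ordIso by blast
      qed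
      then obtain j where j: "j \<in> K" "j \<notin> pr i" by blast
      have "X i \<subseteq> X j"
      proof (cases "i = j")
        case False
        then have "i \<in> pr j" using pr_total[OF i(1) KF[OF j(1)]] j(2) by blast
        then show ?thesis using XC[OF i(1)] CE[OF i(1)] EX[OF KF[OF j(1)]] by blast
      qed simp
      then have ux: "Inl ` underS lam b \<subseteq> X j" using aX[OF i(1)] underS_lam_mono[OF i(2)] by blast
      have "|fam (f j)| \<le>o |Pool|" using j(1) by (intro card_of_mono1) (auto simp: Pool_def)
      also note b(2)
      also have "|underS lam b| \<le>o |X j|" by (rule card_of_ordLeqI[of Inl]) (use ux in auto)
      also have "|X j| \<le>o |with_s (X j)|" by (rule with_s_ge)
      also have "|with_s (X j)| \<le>o chi j"
        by (rule card_of_Pow_Pow)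
      finally show False using chi_fam[OF j(1)] by simp
    qed
    moreover have "|Pool| \<le>o lam"
      by (rule ordLeq_ordIso_trans[OF card_of_mono1[OF PoolF] card_of_Field_ordIso[OF lam_card]])
    ultimately have "|Pool| =o lam" using ordLeq_iff_ordLess_or_ordIso by blast
    then have "|Field lam| =o |Pool|"
      by (rule ordIso_transitive[OF card_of_Field_ordIso[OF lam_card] ordIso_symmetric])
    then obtain bb where bb: "bij_betw bb (Field lam) Pool" using card_of_ordIso by blast
    \<comment> \<open>Each family is split into pieces of size \<open>|Field s|\<close> indexed by
      its own elements. Thus each ordinal of the pool, and through \<open>bb\<close> each
      \<open>m\<close> in \<open>Field lam\<close>, gets a piece \<open>W m\<close> of its
      own.\<close>
    have "\<exists>h. bij_betw h (fam (f j)) (fam (f j) \<times> Field s)" if j: "j \<in> K" for j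
    proof -
      have "chi j \<le>o |fam (f j)|"
        using chi_fam[OF j] ordLeq_total[OF card_of_Well_order card_of_Well_order] by blast
      then have wf: "|with_s (X j)| \<le>o |fam (f j)|"
        by (rule ordLeq_transitive[OF card_of_Pow_Pow])
      have inf: "infinite (fam (f j))" using wf with_s_inf card_of_ordLeq_infinite by blast
      have "|Field s| \<le>o |fam (f j)|"
        by (rule ordIso_ordLeq_trans[OF card_of_Field_ordIso[OF s_card] ordLeq_transitive[OF s_with_s wf]])
      from conjunct1[OF card_of_Times_infinite[OF inf _ this]]
      have "|fam (f j) \<times> Field s| =o |fam (f j)|" using s_inf by fastforce
      then have "|fam (f j)| =o |fam (f j) \<times> Field s|" by (rule ordIso_symmetric)
      then show ?thesis using card_of_ordIso by blast
    qed
    then have "\<forall>j\<in>K. \<exists>h. bij_betw h (fam (f j)) (fam (f j) \<times> Field s)" by simp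
    from bchoice[OF this] obtain h where h: "\<forall>j\<in>K. bij_betw (h j) (fam (f j)) (fam (f j) \<times> Field s)"
      by (elim exE)
    define g where "g e = fst (h (J e) e)" for e
    define W where "W m = {e \<in> Pool. g e = bb m}" for m
    have Wlarge: "\<exists>j\<in>K. \<exists>G. G \<subseteq> W m \<and> G \<subseteq> fam (f j) \<and> \<not> |G| <o s" if m: "m \<in> Field lam" for m
    proof -
      let ?\<gamma> = "bb m"
      have gP: "?\<gamma> \<in> Pool" using bij_betwE[OF bb] m by blast
      define j where "j = J ?\<gamma>"
      have j: "j \<in> K" "?\<gamma> \<in> fam (f j)" using JP[OF gP] by (simp_all add: j_def)
      define G where "G = {e \<in> fam (f j). fst (h j e) = ?\<gamma>}"
      have "G \<subseteq> W m" using j(1) J[OF j(1)] by (auto simp: G_def W_def g_def Pool_def)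
      moreover have "\<not> |G| <o s"
      proof -
        have "Field s \<subseteq> (\<lambda>e. snd (h j e)) ` G"
        proof
          fix v assume "v \<in> Field s"
          then have "(?\<gamma>, v) \<in> h j ` fam (f j)" using bspec[OF h j(1)] j(2) by (simp add: bij_betw_def)
          then obtain e where "e \<in> fam (f j)" "h j e = (?\<gamma>, v)" by auto
          then show "v \<in> (\<lambda>e. snd (h j e)) ` G" by (force simp: G_def)
        qed
        then have "|Field s| \<le>o |G|" by (rule surj_imp_ordLeq)
        then have "s \<le>o |G|"
          by (rule ordIso_ordLeq_trans[OF ordIso_symmetric[OF card_of_Field_ordIso[OF s_card]]])
        then show ?thesis using not_ordLess_ordLeq by blast
      qed
      ultimately show ?thesis using j(1) by (intro bexI[of _ j] exI[of _ G]) (auto simp: G_def)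
    qed
    \<comment> \<open>Uniqueness needs a canonical choice: \<open>x\<close> is the least member of
      \<open>W m\<close> whose condition is in the generic filter, all smaller ones being
      incompatible with \<open>r\<close>.\<close>
    define En where "En m x r \<longleftrightarrow> m \<in> Field lam \<and> x \<in> W m \<and> cnd r \<and> t x \<subseteq> r \<and>
      (\<forall>x'\<in>W m. below x' x \<longrightarrow> \<not> cnd (r \<union> t x'))" for m x r
    have WP: "W m \<subseteq> Pool" for m by (auto simp: W_def)
    have dense: "\<exists>x r'. r \<subseteq> r' \<and> En m x r'" if m: "m \<in> Field lam" and r: "cnd r" "q \<subseteq> r" for m r
    proof -
      \<comment> \<open>A least \<open>x\<close> that some extension of \<open>r\<close> admits is
        final: a further extension admitting a smaller one would also extend
        \<open>r\<close>.\<close>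
      let ?T = "{x \<in> W m. \<exists>r'. cnd r' \<and> r \<subseteq> r' \<and> t x \<subseteq> r'}"
      obtain x0 where "x0 \<in> W m" "cnd (r \<union> t x0)" using Wlarge[OF m] large r by blast
      then have x0: "x0 \<in> ?T" by blast
      obtain x where x: "x \<in> ?T" "\<And>y. (y, x) \<in> lam - Id \<Longrightarrow> y \<notin> ?T"
        by (rule wfE_min[OF wf_lam x0]) (rule that)
      then obtain r' where r': "cnd r'" "r \<subseteq> r'" "t x \<subseteq> r'" by blast
      have "En m x r'"
        unfolding En_def
      proof (intro conjI ballI impI notI)
        fix x' assume x': "x' \<in> W m" "below x' x" "cnd (r' \<union> t x')"
        have "x' \<in> ?T" using x' r' by blast
        then show False using x(2)[of x'] x'(2) by (simp add: below_def)
      qed (use m x r' in auto)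
      then show ?thesis using r' by blast
    qed
    have uniq: "x = x'" if "En m x r" "En m x' r" for m x x' r
    proof (rule ccontr)
      assume "x \<noteq> x'"
      moreover have "x \<in> Field lam" "x' \<in> Field lam" using that WP PoolF unfolding En_def by blast+
      ultimately have "below x x' \<or> below x' x" using lam_total by blast
      moreover have "r \<union> t x = r" "r \<union> t x' = r" "cnd r" using that unfolding En_def by blast+
      ultimately show False using that unfolding En_def by metis
    qed
    have inj: "m = m'" if "En m x r" "En m' x r'" for m m' x r r'
    proof -
      have "bb m = bb m'" "m \<in> Field lam" "m' \<in> Field lam" using that by (auto simp: En_def W_def)
      then show ?thesis using bb by (auto simp: bij_betw_def inj_on_def)
    qed
    have "red_enumeration q En"
      unfolding red_enumeration_def
    proof (intro conjI allI ballI impI)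
      fix m x r assume e: "En m x r"
      then show "m \<in> Field lam" "x \<in> Field lam" "cnd r" using WP PoolF unfolding En_def by blast+
      fix r' assume r': "cnd r'" "r \<subseteq> r'"
      show "En m x r'"
        unfolding En_def
      proof (intro conjI ballI impI notI)
        fix x' assume x': "x' \<in> W m" "below x' x" "cnd (r' \<union> t x')"
        have "cnd (r \<union> t x')" by (rule cnd_subset[OF x'(3)]) (use r'(2) in blast)
        then show False using e x' unfolding En_def by blast
      qed (use e r' in \<open>auto simp: En_def\<close>)
    next
      fix m m' x x' r assume e: "En m x r" "En m' x' r"
      show "m = m' \<longleftrightarrow> x = x'" using uniq[of m x r x'] inj[of m x r m' r] e by blast
      assume "x \<noteq> x'"
      moreover have "x \<in> Pool" "x' \<in> Pool" "t x \<union> t x' \<subseteq> r" using e WP unfolding En_def by blast+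
      ultimately show "Red x x' r" using Red_mono[OF pred] by blast
    qed (use dense in blast)
    then show ?thesis using q q0q by blast
  qed
qed

end

text \<open>Failure of the green alternative is exactly the hypothesis \<open>no_green\<close> under
  which the stages are built.\<close>

theorem (in cohen_singular) green_or_red:
  fixes z :: "'z rel"
  assumes "Well_order z" "z <o k" "arrow k z" "cond s N q0"
  shows "(\<exists>q Y. cond s N q \<and> q0 \<subseteq> q \<and> Y \<subseteq> Field lam \<and> Restr lam Y =o z \<and>
      (\<forall>a\<in>Y. \<forall>b\<in>Y. a \<noteq> b \<longrightarrow> Grn a b q)) \<or>
    (\<exists>q En. cond s N q \<and> q0 \<subseteq> q \<and> red_enumeration q En)"
proof (rule disjCI)
  assume n: "\<nexists>q En. cond s N q \<and> q0 \<subseteq> q \<and> red_enumeration q En"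
  show "\<exists>q Y. cond s N q \<and> q0 \<subseteq> q \<and> Y \<subseteq> Field lam \<and> Restr lam Y =o z \<and>
      (\<forall>a\<in>Y. \<forall>b\<in>Y. a \<noteq> b \<longrightarrow> Grn a b q)"
  proof (rule ccontr)
    assume g: "\<not> ?thesis"
    obtain a X C E Bl d M' where st: "a ` Field k \<subseteq> Field lam" "cofinal (a ` Field k) lam"
      "\<forall>i\<in>Field k. stage_sets (X i) (C i) (E i) (Bl i) (d i) (M' i) \<and>
        Inl ` underS lam (a i) \<subseteq> X i \<and> (\<forall>j\<in>underS k i. E j \<subseteq> X i)"
      using ex_stages by (elim exE conjE)
    interpret cohen_stages s N lam Grn k z q0 a X C E Bl d M'
    proof
      show "False" if "cond s N q" "q0 \<subseteq> q" "Y \<subseteq> Field lam" "Restr lam Y =o z"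
        "\<And>a b. a \<in> Y \<Longrightarrow> b \<in> Y \<Longrightarrow> a \<noteq> b \<Longrightarrow> Grn a b q" for q Y
        using g that by blast
    qed (use assms st in blast)+
    show False using n ex_red_enumeration by blast
  qed
qed

section \<open>The forcing relation\<close>

lemma pelts_name_of:
  fixes S :: "(('i, 'p) pname \<times> 'p) set"
  assumes "|S| \<le>o |UNIV :: 'i set|"
  shows "pelts (name_of S) = S"
proof -
  have "\<exists>f :: 'i \<rightharpoonup> ('i, 'p) pname \<times> 'p. ran f = S"
  proof (cases "S = {}")
    case False
    then obtain g :: "'i \<Rightarrow> ('i, 'p) pname \<times> 'p" where "g ` UNIV = S"
      using assms card_of_ordLeq2[of S "UNIV :: 'i set"] by auto
    moreover have "ran (Some \<circ> g) = range g" unfolding ran_def comp_def by blast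
    ultimately have "ran (Some \<circ> g) = S" by simp
    then show ?thesis by blast
  qed (use ran_empty in blast)
  then have "ran (SOME f :: 'i \<rightharpoonup> ('i, 'p) pname \<times> 'p. ran f = S) = S" by (rule someI_ex)
  then show ?thesis by (simp add: name_of_def)
qed

lemma pelts_pnames:
  assumes "t \<in> pnames P" "(s, p) \<in> pelts t" shows "s \<in> pnames P" "p \<in> P"
  using assms by (auto elim: pnames.cases)

lemma pname_induct [case_names step]:
  assumes "\<And>t. (\<And>s p. (s, p) \<in> pelts t \<Longrightarrow> Q s) \<Longrightarrow> Q t"
  shows "Q t"
  using wf_pelts
proof (induction t rule: wf_induct_rule)
  case (less t)
  show ?case by (rule assms, rule less.IH) blast
qed

text \<open>\<open>ty\<close> fixes the index type of the names; that this type is infinite allows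
  names of pairs.\<close>

locale forcing =
  fixes P :: "'p set" and le :: "'p \<Rightarrow> 'p \<Rightarrow> bool" and e :: 'p and ty :: "'i itself"
  assumes le_refl: "p \<in> P \<Longrightarrow> le p p" and le_trans: "le p q \<Longrightarrow> le q r \<Longrightarrow> le p r"
    and e_P: "e \<in> P" and le_e: "p \<in> P \<Longrightarrow> le p e"
    and inf_i: "infinite (UNIV :: 'i set)"
begin

section \<open>Density, and forced equality and membership\<close>

abbreviation db where "db p D \<equiv> dense_below P le p D"
abbreviation feq :: "('i, 'p) pname \<Rightarrow> ('i, 'p) pname \<Rightarrow> 'p \<Rightarrow> bool" where "feq \<equiv> forces_eq P le"
abbreviation fmem :: "('i, 'p) pname \<Rightarrow> ('i, 'p) pname \<Rightarrow> 'p \<Rightarrow> bool" where "fmem \<equiv> forces_mem P le"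
abbreviation fc :: "('i, 'p) pname sform \<Rightarrow> 'p \<Rightarrow> bool" where "fc \<equiv> forces P le"
abbreviation pn :: "('i, 'p) pname set" where "pn \<equiv> pnames P"

lemma db_mono: "db p D \<Longrightarrow> le q p \<Longrightarrow> db q D"
  unfolding dense_below_def using le_trans by blast

lemma db_weaken: "db p D \<Longrightarrow> (\<And>q. q \<in> P \<Longrightarrow> le q p \<Longrightarrow> q \<in> D \<Longrightarrow> q \<in> D') \<Longrightarrow> db p D'"
  unfolding dense_below_def using le_trans by meson

lemma db_I: "(\<And>q. q \<in> P \<Longrightarrow> le q p \<Longrightarrow> q \<in> D) \<Longrightarrow> db p D"
  unfolding dense_below_def using le_refl by meson

lemma db_db: assumes "db p {q. db q D}" shows "db p D"
  unfolding dense_below_def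
proof (intro ballI impI)
  fix q assume "q \<in> P" "le q p"
  then obtain r where r: "r \<in> P" "le r q" "db r D" using assms unfolding dense_below_def by blast
  then obtain r' where "r' \<in> P" "le r' r" "r' \<in> D" using le_refl unfolding dense_below_def by blast
  then show "\<exists>r\<in>P. le r q \<and> r \<in> D" using r le_trans by blast
qed

lemma db_bind: "db p D \<Longrightarrow> (\<And>q. q \<in> P \<Longrightarrow> le q p \<Longrightarrow> q \<in> D \<Longrightarrow> db q D') \<Longrightarrow> db p D'"
  by (rule db_db, erule db_weaken) blast

text \<open>At a condition incompatible with \<open>r\<close> the implication holds vacuously, so
  density matters only below extensions of \<open>r\<close>. This turns the density clauses of
  forced equality into quantification over extensions.\<close>

lemma db_imp_iff: "db p {q. le q r \<longrightarrow> q \<in> D} \<longleftrightarrow> (\<forall>q\<in>P. le q p \<longrightarrow> le q r \<longrightarrow> db q D)"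
proof (intro iffI ballI impI)
  fix q assume q: "db p {q. le q r \<longrightarrow> q \<in> D}" "q \<in> P" "le q p" "le q r"
  show "db q D"
    by (rule db_weaken[OF db_mono[OF q(1,3)]]) (use q(4) le_trans in blast)
next
  assume D: "\<forall>q\<in>P. le q p \<longrightarrow> le q r \<longrightarrow> db q D"
  show "db p {q. le q r \<longrightarrow> q \<in> D}"
    unfolding dense_below_def
  proof (intro ballI impI)
    fix q assume q: "q \<in> P" "le q p"
    show "\<exists>v\<in>P. le v q \<and> v \<in> {q. le q r \<longrightarrow> q \<in> D}"
    proof (cases "\<exists>v\<in>P. le v q \<and> le v r")
      case True
      then obtain v where v: "v \<in> P" "le v q" "le v r" by blast
      then have "db v D" using D q le_trans by blast
      then obtain w where "w \<in> P" "le w v" "w \<in> D" using v(1) le_refl unfolding dense_below_def by blast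
      then show ?thesis using v(2) le_trans by blast
    qed (use q le_refl in blast)
  qed
qed

lemma fmem_iff: "fmem s t p \<longleftrightarrow> db p {q. \<exists>y r. (y, r) \<in> pelts t \<and> le q r \<and> feq s y q}"
  unfolding forces_mem_def by (rule arg_cong[of _ _ "db p"]) force

lemma feq_iff_sym: "feq s t p \<longleftrightarrow>
     (\<forall>x r. (x, r) \<in> pelts s \<longrightarrow> (\<forall>q\<in>P. le q p \<longrightarrow> le q r \<longrightarrow> fmem x t q)) \<and>
     (\<forall>y r. (y, r) \<in> pelts t \<longrightarrow> (\<forall>q\<in>P. le q p \<longrightarrow> le q r \<longrightarrow>
        db q {v. \<exists>x r'. (x, r') \<in> pelts s \<and> le v r' \<and> feq x y v}))"
proof -
  have 1: "{q. le q r \<longrightarrow> (\<exists>y\<in>pelts t. le q (snd y) \<and> feq x (fst y) q)} =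
      {q. le q r \<longrightarrow> q \<in> {q. \<exists>y r. (y, r) \<in> pelts t \<and> le q r \<and> feq x y q}}" for r x by force
  have 2: "{q. le q r \<longrightarrow> (\<exists>x\<in>pelts s. le q (snd x) \<and> feq (fst x) y q)} =
      {q. le q r \<longrightarrow> q \<in> {q. \<exists>x r. (x, r) \<in> pelts s \<and> le q r \<and> feq x y q}}" for r y by force
  show ?thesis
    unfolding forces_eq.simps[of P le s t p] 1 2 db_imp_iff fmem_iff by force
qed

lemma feq_mono: "feq s t p \<Longrightarrow> le q p \<Longrightarrow> feq s t q"
  unfolding feq_iff_sym[of s t] using le_trans by blast

lemma feq_refl: "feq s s p"
proof (induction s arbitrary: p rule: pname_induct)
  case (step t)
  show ?case
    unfolding feq_iff_sym[of t t p] fmem_iff by (intro conjI allI impI ballI db_I) (use step le_trans in blast)+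
qed

lemma feq_sym: "feq s t p \<Longrightarrow> feq t s p"
proof (induction s arbitrary: t p rule: pname_induct)
  case (step s)
  note st = step.prems[unfolded feq_iff_sym[of s t p]]
  show ?case
    unfolding feq_iff_sym[of t s p]
  proof (intro conjI allI impI ballI)
    fix x r q assume x: "(x, r) \<in> pelts t" "q \<in> P" "le q p" "le q r"
    show "fmem x s q"
      unfolding fmem_iff
      using st[THEN conjunct2, rule_format, OF x] by (rule db_weaken) (use step.IH in blast)
  next
    fix y r q assume y: "(y, r) \<in> pelts s" "q \<in> P" "le q p" "le q r"
    show "db q {v. \<exists>x r'. (x, r') \<in> pelts t \<and> le v r' \<and> feq x y v}"
      using st[THEN conjunct1, rule_format, OF y] unfolding fmem_iff
      by (rule db_weaken) (use step.IH y(1) in blast)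
  qed
qed

text \<open>Once forced equality is known to be symmetric, the second half can also be phrased with
  \<open>fmem\<close>; the result is extensionality inside the forcing relation.\<close>

lemma feq_iff: "feq s t p \<longleftrightarrow>
     (\<forall>x r q. (x, r) \<in> pelts s \<longrightarrow> q \<in> P \<longrightarrow> le q p \<longrightarrow> le q r \<longrightarrow> fmem x t q) \<and>
     (\<forall>y r q. (y, r) \<in> pelts t \<longrightarrow> q \<in> P \<longrightarrow> le q p \<longrightarrow> le q r \<longrightarrow> fmem y s q)"
proof -
  have "(\<exists>x r'. (x, r') \<in> pelts s \<and> le v r' \<and> feq x y v) \<longleftrightarrow> (\<exists>x r'. (x, r') \<in> pelts s \<and> le v r' \<and> feq y x v)" for y v
    using feq_sym by blast
  then show ?thesis unfolding feq_iff_sym[of s t p] fmem_iff by (simp only: Ball_def) blast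
qed

lemma fmem_mono: "fmem s t p \<Longrightarrow> le q p \<Longrightarrow> fmem s t q"
  unfolding fmem_iff by (rule db_mono)

lemma fmem_dense: "db p {q. fmem s t q} \<Longrightarrow> fmem s t p"
  unfolding fmem_iff by (rule db_db)

lemma feq_memD:
  assumes "feq s t p" "p \<in> P" "le p r"
  shows "(x, r) \<in> pelts s \<Longrightarrow> fmem x t p" "(x, r) \<in> pelts t \<Longrightarrow> fmem x s p"
  using assms(1)[unfolded feq_iff[of s t p]] assms(2,3) le_refl by blast+

lemma feq_dense: assumes d: "db p {q. feq s t q}" shows "feq s t p"
  unfolding feq_iff
proof (intro conjI allI impI)
  fix x r q assume x: "(x, r) \<in> pelts s" "q \<in> P" "le q p" "le q r"
  show "fmem x t q"
  proof (rule fmem_dense, rule db_weaken[OF db_mono[OF d x(3)]])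
    fix v assume v: "v \<in> P" "le v q" "v \<in> {q. feq s t q}"
    then have "feq s t v" by simp
    from feq_memD(1)[OF this v(1) le_trans[OF v(2) x(4)] x(1)]
    show "v \<in> {q. fmem x t q}" by simp
  qed
next
  fix x r q assume x: "(x, r) \<in> pelts t" "q \<in> P" "le q p" "le q r"
  show "fmem x s q"
  proof (rule fmem_dense, rule db_weaken[OF db_mono[OF d x(3)]])
    fix v assume v: "v \<in> P" "le v q" "v \<in> {q. feq s t q}"
    then have "feq s t v" by simp
    from feq_memD(2)[OF this v(1) le_trans[OF v(2) x(4)] x(1)]
    show "v \<in> {q. fmem x s q}" by simp
  qed
qed

text \<open>The common core of both halves of transitivity: \<open>tr\<close> is transitivity at
  members, supplied by the induction hypothesis.\<close>

lemma fmem_transfer: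
  assumes "fmem x t q" "feq t u q"
    and tr: "\<And>y z r v. (z, r) \<in> pelts u \<Longrightarrow> feq x y v \<Longrightarrow> feq y z v \<Longrightarrow> feq x z v"
  shows "fmem x u q"
  unfolding fmem_iff
proof (rule db_bind[OF assms(1)[unfolded fmem_iff]])
  fix v assume v: "v \<in> P" "le v q" "v \<in> {v. \<exists>y r. (y, r) \<in> pelts t \<and> le v r \<and> feq x y v}"
  then obtain y r where y: "(y, r) \<in> pelts t" "le v r" "feq x y v" by blast
  have "fmem y u v" by (rule feq_memD(1)[OF feq_mono[OF assms(2) v(2)] v(1) y(2,1)])
  then show "db v {v. \<exists>y r. (y, r) \<in> pelts u \<and> le v r \<and> feq x y v}"
    unfolding fmem_iff by (rule db_weaken) (use tr feq_mono[OF y(3)] in blast)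
qed

lemma feq_trans: "feq s t p \<Longrightarrow> feq t u p \<Longrightarrow> feq s u p"
proof (induction s arbitrary: t u p rule: pname_induct)
  case (step s)
  show ?case
    unfolding feq_iff[of s u p]
  proof (intro conjI allI impI)
    fix x r q assume x: "(x, r) \<in> pelts s" "q \<in> P" "le q p" "le q r"
    have "fmem x t q" by (rule feq_memD(1)[OF feq_mono[OF step.prems(1) x(3)] x(2,4,1)])
    then show "fmem x u q" using feq_mono[OF step.prems(2) x(3)] by (rule fmem_transfer) (rule step.IH[OF x(1)])
  next
    fix x r q assume x: "(x, r) \<in> pelts u" "q \<in> P" "le q p" "le q r"
    have "fmem x t q" by (rule feq_memD(2)[OF feq_mono[OF step.prems(2) x(3)] x(2,4,1)])
    then show "fmem x s q" using feq_sym[OF feq_mono[OF step.prems(1) x(3)]]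
      by (rule fmem_transfer) (use step.IH feq_sym in blast)
  qed
qed

lemma fmem_eq2: "fmem s t p \<Longrightarrow> feq t t' p \<Longrightarrow> fmem s t' p"
  by (erule (1) fmem_transfer) (rule feq_trans)

lemma fmem_eq1: "fmem s t p \<Longrightarrow> feq s s' p \<Longrightarrow> fmem s' t p"
  unfolding fmem_iff by (erule db_weaken) (use feq_trans feq_sym feq_mono in blast)

lemma fmem_pelts: "(s, r) \<in> pelts t \<Longrightarrow> le p r \<Longrightarrow> fmem s t p"
  unfolding fmem_iff by (rule db_I) (use feq_refl le_trans in blast)

lemma fc_mono: "fc \<phi> p \<Longrightarrow> le q p \<Longrightarrow> fc \<phi> q"
proof (induction \<phi> arbitrary: p q)
  case (Forall F)
  have "fc (F t) q" if "t \<in> pn" for t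
    by (rule Forall.IH[OF rangeI]) (use Forall.prems that in auto)
  then show ?case by simp
next
  case (Neg \<phi>)
  then show ?case by (simp, meson le_trans)
next
  case (Mem s t)
  then show ?case using fmem_mono by simp
next
  case (Eq s t)
  then show ?case using feq_mono by simp
next
  case (Conj \<phi> \<psi>)
  then show ?case by auto
qed

lemma fc_dense: "db p {q. fc \<phi> q} \<Longrightarrow> fc \<phi> p"
proof (induction \<phi> arbitrary: p)
  case (Forall F)
  have "fc (F t) p" if "t \<in> pn" for t
    by (rule Forall.IH[OF rangeI], rule db_weaken[OF Forall.prems]) (use that in auto)
  then show ?case by simp
next
  case (Neg \<phi>)
  show ?case
    unfolding forces.simps
  proof (intro ballI impI notI)
    fix q assume q: "q \<in> P" "le q p" "fc \<phi> q"
    then obtain r where "r \<in> P" "le r q" "fc (Neg \<phi>) r" using Neg.prems unfolding dense_below_def by blast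
    then show False using fc_mono[OF q(3)] le_refl by auto
  qed
next
  case (Conj \<phi> \<psi>)
  show ?case
    using Conj.IH(1)[OF db_weaken[OF Conj.prems]] Conj.IH(2)[OF db_weaken[OF Conj.prems]] by simp
qed (use feq_dense fmem_dense in auto)

section \<open>Forcing of connectives and quantifiers, and invariance under forced equality\<close>

lemma db_bindE: "db p {q. A q} \<Longrightarrow> (\<And>q. q \<in> P \<Longrightarrow> le q p \<Longrightarrow> A q \<Longrightarrow> db q D) \<Longrightarrow> db p D"
  by (erule db_bind) simp

lemma fc_bindE: "db p {q. A q} \<Longrightarrow> (\<And>q. q \<in> P \<Longrightarrow> le q p \<Longrightarrow> A q \<Longrightarrow> fc \<phi> q) \<Longrightarrow> fc \<phi> p"
  by (rule fc_dense, erule db_weaken) simp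

lemma feq_bindE: "db p {q. A q} \<Longrightarrow> (\<And>q. q \<in> P \<Longrightarrow> le q p \<Longrightarrow> A q \<Longrightarrow> feq s t q) \<Longrightarrow> feq s t p"
  using fc_bindE[of p A "Eq s t"] by simp

lemma fmem_bindE: "db p {q. A q} \<Longrightarrow> (\<And>q. q \<in> P \<Longrightarrow> le q p \<Longrightarrow> A q \<Longrightarrow> fmem s t q) \<Longrightarrow> fmem s t p"
  using fc_bindE[of p A "Mem s t"] by simp

lemma fc_Exists: "fc (Exists F) p \<longleftrightarrow> db p {q. \<exists>t\<in>pn. fc (F t) q}"
proof
  assume a: "fc (Exists F) p"
  show "db p {q. \<exists>t\<in>pn. fc (F t) q}"
    unfolding dense_below_def
  proof (intro ballI impI)
    fix q assume "q \<in> P" "le q p"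
    then show "\<exists>r\<in>P. le r q \<and> r \<in> {q. \<exists>t\<in>pn. fc (F t) q}"
      using a by (simp add: Exists_def) blast
  qed
next
  assume a: "db p {q. \<exists>t\<in>pn. fc (F t) q}"
  show "fc (Exists F) p"
    using a unfolding Exists_def dense_below_def forces.simps by blast
qed

lemma fc_Disj: "fc (Disj \<phi> \<psi>) p \<longleftrightarrow> db p {q. fc \<phi> q \<or> fc \<psi> q}"
proof
  assume a: "fc (Disj \<phi> \<psi>) p"
  show "db p {q. fc \<phi> q \<or> fc \<psi> q}"
    unfolding dense_below_def
  proof (intro ballI impI)
    fix q assume q: "q \<in> P" "le q p"
    then have "\<not> ((\<forall>r\<in>P. le r q \<longrightarrow> \<not> fc \<phi> r) \<and> (\<forall>r\<in>P. le r q \<longrightarrow> \<not> fc \<psi> r))"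
      using a by (simp add: Disj_def)
    then show "\<exists>r\<in>P. le r q \<and> r \<in> {q. fc \<phi> q \<or> fc \<psi> q}" by blast
  qed
next
  assume a: "db p {q. fc \<phi> q \<or> fc \<psi> q}"
  show "fc (Disj \<phi> \<psi>) p"
    unfolding Disj_def forces.simps
  proof (intro ballI impI notI, elim conjE)
    fix q assume q: "q \<in> P" "le q p" "\<forall>r\<in>P. le r q \<longrightarrow> \<not> fc \<phi> r" "\<forall>r\<in>P. le r q \<longrightarrow> \<not> fc \<psi> r"
    then show False using a unfolding dense_below_def by blast
  qed
qed

lemma fc_Imp: "fc (Imp \<phi> \<psi>) p \<longleftrightarrow> (\<forall>q\<in>P. le q p \<longrightarrow> fc \<phi> q \<longrightarrow> fc \<psi> q)"
proof
  assume a: "fc (Imp \<phi> \<psi>) p"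
  show "\<forall>q\<in>P. le q p \<longrightarrow> fc \<phi> q \<longrightarrow> fc \<psi> q"
  proof (intro ballI impI)
    fix q assume q: "q \<in> P" "le q p" "fc \<phi> q"
    show "fc \<psi> q"
    proof (rule fc_dense, unfold dense_below_def, intro ballI impI)
      fix r assume r: "r \<in> P" "le r q"
      have "le r p" "fc \<phi> r" using r q le_trans fc_mono by blast+
      then show "\<exists>v\<in>P. le v r \<and> v \<in> {q. fc \<psi> q}" using a r(1) unfolding Imp_def by auto
    qed
  qed
next
  assume a: "\<forall>q\<in>P. le q p \<longrightarrow> fc \<phi> q \<longrightarrow> fc \<psi> q"
  show "fc (Imp \<phi> \<psi>) p"
    unfolding Imp_def forces.simps using a le_refl by blast
qed

lemma fc_Iff: "fc (Iff \<phi> \<psi>) p \<longleftrightarrow> (\<forall>q\<in>P. le q p \<longrightarrow> fc \<phi> q \<longleftrightarrow> fc \<psi> q)"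
  by (auto simp: Iff_def fc_Imp)

lemma fc_Forall: "fc (Forall F) p \<longleftrightarrow> (\<forall>t\<in>pn. fc (F t) p)" by simp

text \<open>In higher-order abstract syntax \<open>F\<close> is an arbitrary function on names, so
  invariance under forced equality has to be checked; the rules below build it up along the formulas
  in use.\<close>

definition ext :: "(('i, 'p) pname \<Rightarrow> ('i, 'p) pname sform) \<Rightarrow> bool" where
  "ext F \<longleftrightarrow> (\<forall>p s t. feq s t p \<longrightarrow> fc (F s) p \<longrightarrow> fc (F t) p)"

lemma extD: "ext F \<Longrightarrow> feq s t p \<Longrightarrow> fc (F s) p \<Longrightarrow> fc (F t) p"
  unfolding ext_def by blast

lemma ext_basic:
  "ext (\<lambda>x. Mem x t)" "ext (\<lambda>x. Mem t x)" "ext (\<lambda>x. Eq x t)" "ext (\<lambda>x. Eq t x)" "ext (\<lambda>x. \<phi>)"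
  unfolding ext_def forces.simps
  using fmem_eq1 apply blast
  using fmem_eq2 apply blast
  using feq_trans feq_sym apply blast
  using feq_trans apply blast
  by blast

lemma ext_Neg: "ext F \<Longrightarrow> ext (\<lambda>x. Neg (F x))"
  unfolding ext_def forces.simps
proof (intro allI impI ballI notI)
  fix p s t q
  assume F: "\<forall>p s t. feq s t p \<longrightarrow> fc (F s) p \<longrightarrow> fc (F t) p" and st: "feq s t p"
    and n: "\<forall>q\<in>P. le q p \<longrightarrow> \<not> fc (F s) q" and q: "q \<in> P" "le q p" "fc (F t) q"
  have "fc (F s) q" using F feq_sym[OF feq_mono[OF st q(2)]] q(3) by simp
  then show False using n q by simp
qed

lemma ext_Conj: "ext F \<Longrightarrow> ext G \<Longrightarrow> ext (\<lambda>x. Conj (F x) (G x))"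
  unfolding ext_def by auto

lemma ext_Forall: "(\<And>y. ext (\<lambda>x. F x y)) \<Longrightarrow> ext (\<lambda>x. Forall (F x))"
  unfolding ext_def forces.simps by blast

lemmas ext_core = ext_basic ext_Neg ext_Conj ext_Forall

lemma ext_Exists: "(\<And>y. ext (\<lambda>x. F x y)) \<Longrightarrow> ext (\<lambda>x. Exists (F x))"
  unfolding Exists_def by (intro ext_core)

lemma ext_Disj: "ext F \<Longrightarrow> ext G \<Longrightarrow> ext (\<lambda>x. Disj (F x) (G x))"
  unfolding Disj_def by (intro ext_core)

lemma ext_Iff: "ext F \<Longrightarrow> ext G \<Longrightarrow> ext (\<lambda>x. Iff (F x) (G x))"
  unfolding Iff_def Imp_def by (intro ext_core)

lemma ext_IsZero: "ext IsZero" and ext_IsOne: "ext IsOne"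
proof -
  show 1: "ext IsZero" unfolding IsZero_def[abs_def] by (intro ext_core)
  show "ext IsOne" unfolding IsOne_def[abs_def] by (intro ext_core ext_Iff)
qed

text \<open>Whatever is forced into \<open>A\<close> is densely equal to an element of the name
  \<open>A\<close>, and \<open>ext F\<close> carries the property across.\<close>

lemma fc_ForallInI:
  assumes F: "ext F"
    and a: "\<And>y r q. (y, r) \<in> pelts A \<Longrightarrow> q \<in> P \<Longrightarrow> le q p \<Longrightarrow> le q r \<Longrightarrow> fc (F y) q"
  shows "fc (ForallIn A F) p"
proof -
  have "fc (F t) q" if "q \<in> P" "le q p" "fmem t A q" for t q
  proof (rule fc_bindE[OF that(3)[unfolded fmem_iff]], goal_cases)
    case (1 v)
    then obtain y r where y: "(y, r) \<in> pelts A" "le v r" "feq t y v" by blast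
    then have "fc (F y) v" using a 1 that le_trans by blast
    then show ?case by (rule extD[OF F feq_sym[OF y(3)]])
  qed
  then show ?thesis by (simp add: ForallIn_def fc_Imp)
qed

lemma fc_ExistsIn: "fc (ExistsIn A F) p \<longleftrightarrow> db p {q. \<exists>t\<in>pn. fmem t A q \<and> fc (F t) q}"
  unfolding ExistsIn_def fc_Exists by simp

lemma feq_extensional:
  assumes z: "z \<in> pn" and w: "w \<in> pn"
  shows "feq z w p \<longleftrightarrow> (\<forall>x\<in>pn. \<forall>q\<in>P. le q p \<longrightarrow> fmem x z q \<longleftrightarrow> fmem x w q)"
proof
  assume "feq z w p"
  then show "\<forall>x\<in>pn. \<forall>q\<in>P. le q p \<longrightarrow> fmem x z q \<longleftrightarrow> fmem x w q"
    using fmem_eq2 feq_sym feq_mono by blast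
next
  assume a: "\<forall>x\<in>pn. \<forall>q\<in>P. le q p \<longrightarrow> fmem x z q \<longleftrightarrow> fmem x w q"
  show "feq z w p"
    unfolding feq_iff
    using a fmem_pelts pelts_pnames(1)[OF z] pelts_pnames(1)[OF w] by blast
qed

section \<open>Names of unordered and ordered pairs\<close>

definition upn :: "('i, 'p) pname \<Rightarrow> ('i, 'p) pname \<Rightarrow> ('i, 'p) pname" where
  "upn a b = name_of {(a, e), (b, e)}"

definition opn :: "('i, 'p) pname \<Rightarrow> ('i, 'p) pname \<Rightarrow> ('i, 'p) pname" where
  "opn a b = upn (upn a a) (upn a b)"

lemma pelts_upn: "pelts (upn a b) = {(a, e), (b, e)}"
  unfolding upn_def by (rule pelts_name_of[OF card_of_finite_le[OF inf_i]]) simp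

lemma upn_pn: "a \<in> pn \<Longrightarrow> b \<in> pn \<Longrightarrow> upn a b \<in> pn"
  by (rule pnames.intros) (use e_P in \<open>auto simp: pelts_upn\<close>)

lemma opn_pn: "a \<in> pn \<Longrightarrow> b \<in> pn \<Longrightarrow> opn a b \<in> pn"
  unfolding opn_def by (intro upn_pn)

lemma fmem_upn: "fmem x (upn a b) p \<longleftrightarrow> db p {q. feq x a q \<or> feq x b q}"
  unfolding fmem_iff pelts_upn
  by (rule iffI; erule db_weaken) (use le_e in auto)

lemma fmem_upnI: "feq x a p \<or> feq x b p \<Longrightarrow> fmem x (upn a b) p"
  unfolding fmem_upn by (rule db_I) (use feq_mono in auto)

lemma fc_IsUPair:
  assumes "z \<in> pn" "a \<in> pn" "b \<in> pn"
  shows "fc (IsUPair z a b) p \<longleftrightarrow> feq z (upn a b) p"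
  unfolding feq_extensional[OF assms(1) upn_pn[OF assms(2,3)]] IsUPair_def fc_Forall fc_Iff fmem_upn fc_Disj
  by simp

lemma upn_cong: "feq a a' p \<Longrightarrow> feq b b' p \<Longrightarrow> feq (upn a b) (upn a' b') p"
  unfolding feq_iff[of "upn a b"] pelts_upn
  by (auto intro!: fmem_upnI intro: feq_mono feq_sym)

lemma opn_cong: "feq a a' p \<Longrightarrow> feq b b' p \<Longrightarrow> feq (opn a b) (opn a' b') p"
  unfolding opn_def by (intro upn_cong)

lemma fc_IsOPair:
  assumes z: "z \<in> pn" and a: "a \<in> pn" and b: "b \<in> pn"
  shows "fc (IsOPair z a b) p \<longleftrightarrow> feq z (opn a b) p"
proof
  assume "fc (IsOPair z a b) p"
  then have "db p {q. \<exists>u\<in>pn. db q {r. \<exists>v\<in>pn. feq u (upn a a) r \<and> feq v (upn a b) r \<and> feq z (upn u v) r}}"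
    unfolding IsOPair_def fc_Exists by (simp add: fc_IsUPair z a b cong: bex_cong)
  then show "feq z (opn a b) p"
  proof (rule feq_bindE, goal_cases)
    case (1 q)
    then obtain u where "db q {r. \<exists>v\<in>pn. feq u (upn a a) r \<and> feq v (upn a b) r \<and> feq z (upn u v) r}" by blast
    then show ?case by (rule feq_bindE) (use upn_cong feq_trans in \<open>auto simp: opn_def; blast\<close>)
  qed
next
  assume f: "feq z (opn a b) p"
  have pr: "fc (Conj (IsUPair (upn a a) a a) (Conj (IsUPair (upn a b) a b) (IsUPair z (upn a a) (upn a b)))) q"
    if "le q p" for q
    using feq_mono[OF f that] by (simp add: fc_IsUPair z a b upn_pn feq_refl opn_def)
  show "fc (IsOPair z a b) p"
    unfolding IsOPair_def fc_Exists
  proof (rule db_I, rule CollectI, rule bexI[of _ "upn a a"], rule db_I, rule CollectI, rule bexI[of _ "upn a b"])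
    fix q r assume "le q p" "le r q"
    then show "fc (Conj (IsUPair (upn a a) a a) (Conj (IsUPair (upn a b) a b) (IsUPair z (upn a a) (upn a b)))) r"
      using pr le_trans by blast
  qed (use upn_pn a b in auto)
qed

lemma upn_feqD:
  assumes "feq (upn a b) (upn c d) p" "p \<in> P"
  shows "db p {q. feq a c q \<or> feq a d q}" "db p {q. feq b c q \<or> feq b d q}"
  using fmem_eq2[OF fmem_upnI assms(1), of a] fmem_eq2[OF fmem_upnI assms(1), of b] feq_refl
  by (auto simp: fmem_upn)

text \<open>The usual argument for Kuratowski pairs, carried out densely, since each membership
  yields a disjunction only below further extensions. Given \<open>a = c\<close>, the critical case
  \<open>b = c\<close> and \<open>d = a\<close> also yields \<open>b = d\<close>.\<close>

lemma opn_inj: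
  assumes eq: "feq (opn a b) (opn c d) p" and p: "p \<in> P"
  shows "feq a c p" "feq b d p"
proof -
  have single: "feq a c q" if "feq (upn a x) (upn c c) q" "q \<in> P" for a c x q
    using upn_feqD(1)[OF that] by (intro feq_dense) simp
  have first: "feq a c p" if eq: "feq (opn a b) (opn c d) p" and p: "p \<in> P" for a b c d p
  proof (rule feq_bindE[OF upn_feqD(1)[OF eq[unfolded opn_def] p]])
    fix q assume "q \<in> P" "feq (upn a a) (upn c c) q \<or> feq (upn a a) (upn c d) q"
    then show "feq a c q" using single[of a a c q] single[of c d a q] feq_sym by blast
  qed
  show ac: "feq a c p" by (rule first[OF eq p])
  have 1: "db p {q. feq (upn a b) (upn c c) q \<or> feq (upn a b) (upn c d) q}"
    by (rule upn_feqD(2)[OF eq[unfolded opn_def] p])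
  have 2: "db p {q. feq (upn c d) (upn a a) q \<or> feq (upn c d) (upn a b) q}"
    by (rule upn_feqD(2)[OF feq_sym[OF eq, unfolded opn_def] p])
  have bcd: "db p {q. feq b c q \<or> feq b d q}"
  proof (rule db_bindE[OF 1])
    fix q assume q: "q \<in> P" "feq (upn a b) (upn c c) q \<or> feq (upn a b) (upn c d) q"
    from q(2) show "db q {q. feq b c q \<or> feq b d q}"
      by (elim disjE) (rule db_weaken[OF upn_feqD(2)[OF _ q(1)]], assumption, blast)+
  qed
  have dab: "db p {q. feq d a q \<or> feq d b q}"
  proof (rule db_bindE[OF 2])
    fix q assume q: "q \<in> P" "feq (upn c d) (upn a a) q \<or> feq (upn c d) (upn a b) q"
    from q(2) show "db q {q. feq d a q \<or> feq d b q}"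
      by (elim disjE) (rule db_weaken[OF upn_feqD(2)[OF _ q(1)]], assumption, blast)+
  qed
  show "feq b d p"
  proof (rule feq_bindE[OF bcd])
    fix q assume q: "q \<in> P" "le q p" "feq b c q \<or> feq b d q"
    show "feq b d q"
    proof (rule feq_bindE[OF db_mono[OF dab q(2)]])
      fix v assume v: "v \<in> P" "le v q" "feq d a v \<or> feq d b v"
      have "feq a c v" using ac q v le_trans feq_mono by blast
      moreover have "feq b c v \<or> feq b d v" using q(3) v(2) feq_mono by blast
      ultimately show "feq b d v" using v(3) feq_trans feq_sym by blast
    qed
  qed
qed

lemma fc_App:
  assumes f: "f \<in> pn" and x: "x \<in> pn" and y: "y \<in> pn"
  shows "fc (App f x y) p \<longleftrightarrow> fmem (opn x y) f p"
proof
  assume "fc (App f x y) p"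
  then have "db p {q. \<exists>t\<in>pn. fmem t f q \<and> feq t (opn x y) q}"
    unfolding App_def fc_ExistsIn by (simp add: fc_IsOPair x y cong: bex_cong)
  then show "fmem (opn x y) f p" by (rule fmem_bindE) (use fmem_eq1 in blast)
next
  assume a: "fmem (opn x y) f p"
  show "fc (App f x y) p"
    unfolding App_def fc_ExistsIn
    by (rule db_I) (use fmem_mono[OF a] opn_pn[OF x y] feq_refl x y in \<open>auto simp: fc_IsOPair intro!: bexI[of _ "opn x y"]\<close>)
qed

end

context forcing
begin

section \<open>Canonical names of ordinals\<close>

abbreviation Iset :: "'i set" where "Iset \<equiv> UNIV"
abbreviation chk :: "'a rel \<Rightarrow> 'a \<Rightarrow> ('i, 'p) pname" where "chk r a \<equiv> check_elem r e a"
abbreviation cho :: "'a rel \<Rightarrow> ('i, 'p) pname" where "cho r \<equiv> check_ord r e"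
abbreviation (input) "uS \<equiv> underS"

lemma fc_ExistsI: "t \<in> pn \<Longrightarrow> fc (F t) p \<Longrightarrow> fc (Exists F) p"
  unfolding fc_Exists by (rule db_I) (use fc_mono in blast)

lemma pelts_chk:
  fixes r :: "'a rel"
  assumes r: "Well_order r" and sz: "|Field r| \<le>o |Iset|"
  shows "pelts (chk r a) = (\<lambda>b. (chk r b, e)) ` uS r a"
proof -
  have wf: "wf (r - Id)" using r well_order_on_def by blast
  have "chk r a = name_of ((\<lambda>b. (chk r b, e)) ` uS r a)"
    unfolding check_elem_def
    by (subst wfrec[OF wf], rule arg_cong[of _ _ name_of], rule image_cong[OF refl])
      (simp add: cut_apply underS_def)
  moreover have "|(\<lambda>b. (chk r b, e)) ` uS r a| \<le>o |Iset|"
    by (rule card_of_image_le[OF card_of_subset_le[OF _ sz]]) (auto simp: underS_def Field_def)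
  ultimately show ?thesis using pelts_name_of by metis
qed

lemma pelts_cho:
  fixes r :: "'a rel"
  assumes "|Field r| \<le>o |Iset|"
  shows "pelts (cho r) = (\<lambda>a. (chk r a, e)) ` Field r"
  unfolding check_ord_def by (rule pelts_name_of[OF card_of_image_le[OF assms]])

context
  fixes r :: "'a rel"
  assumes r: "Well_order r" and sz: "|Field r| \<le>o |Iset|"
begin

lemma chk_pn: "chk r a \<in> pn"
proof -
  have wf: "wf (r - Id)" using r well_order_on_def by blast
  then show ?thesis
  proof (induction a)
    case (less a)
    show ?case
      by (rule pnames.intros) (use less e_P in \<open>auto simp: pelts_chk[OF r sz] underS_def\<close>)
  qed
qed

lemma fmem_chk: "fmem x (chk r a) p \<longleftrightarrow> db p {q. \<exists>b\<in>uS r a. feq x (chk r b) q}"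
  unfolding fmem_iff pelts_chk[OF r sz] by (rule iffI; erule db_weaken) (use le_e in auto)

lemma fmem_cho: "fmem x (cho r) p \<longleftrightarrow> db p {q. \<exists>b\<in>Field r. feq x (chk r b) q}"
  unfolding fmem_iff pelts_cho[OF sz] by (rule iffI; erule db_weaken) (use le_e in auto)

lemma db_ex: "db p D \<Longrightarrow> p \<in> P \<Longrightarrow> \<exists>q\<in>P. le q p \<and> q \<in> D"
  unfolding dense_below_def using le_refl by blast

text \<open>Equality with a larger canonical name would force the name of \<open>a\<close> into
  itself, hence equality with the name of some \<open>c\<close> below \<open>a\<close> at an
  extension; induction on \<open>a\<close> excludes this.\<close>

lemma chk_neq: "a \<in> uS r b \<Longrightarrow> p \<in> P \<Longrightarrow> \<not> feq (chk r a) (chk r b) p"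
proof -
  have wf: "wf (r - Id)" using r well_order_on_def by blast
  then show "a \<in> uS r b \<Longrightarrow> p \<in> P \<Longrightarrow> \<not> feq (chk r a) (chk r b) p"
  proof (induction a arbitrary: b p)
    case (less a)
    show ?case
    proof
      assume eq: "feq (chk r a) (chk r b) p"
      have "(chk r a, e) \<in> pelts (chk r b)" using less.prems by (simp add: pelts_chk[OF r sz])
      then have "fmem (chk r a) (chk r b) p" by (rule fmem_pelts) (rule le_e[OF less.prems(2)])
      then have "fmem (chk r a) (chk r a) p" using fmem_eq2 feq_sym[OF eq] by blast
      then obtain q where "q \<in> P" "\<exists>c\<in>uS r a. feq (chk r a) (chk r c) q"
        unfolding fmem_chk using db_ex less.prems(2) by blast
      then obtain c where c: "c \<in> uS r a" "feq (chk r c) (chk r a) q" "q \<in> P" using feq_sym by blast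
      have "(c, a) \<in> r - Id" using c(1) by (simp add: underS_def)
      from less.IH[OF this c(1,3)] show False using c(2) by blast
    qed
  qed
qed

lemma feq_chk: "a \<in> Field r \<Longrightarrow> b \<in> Field r \<Longrightarrow> p \<in> P \<Longrightarrow> feq (chk r a) (chk r b) p \<longleftrightarrow> a = b"
proof -
  assume ab: "a \<in> Field r" "b \<in> Field r" and p: "p \<in> P"
  have "a \<in> uS r b \<or> a = b \<or> b \<in> uS r a"
    using r ab wo_rel.TOTALS[of r] by (auto simp: wo_rel_def underS_def)
  then show ?thesis using chk_neq[OF _ p] feq_sym feq_refl by blast
qed

lemma fmem_chk_chk:
  assumes "a \<in> Field r" "b \<in> Field r" "p \<in> P"
  shows "fmem (chk r a) (chk r b) p \<longleftrightarrow> a \<in> uS r b"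
proof
  assume "fmem (chk r a) (chk r b) p"
  then obtain q c where "q \<in> P" "c \<in> uS r b" "feq (chk r a) (chk r c) q"
    unfolding fmem_chk using db_ex assms(3) by blast
  moreover have "uS r b \<subseteq> Field r" by (auto simp: underS_def Field_def)
  ultimately show "a \<in> uS r b" using feq_chk[OF assms(1)] by blast
next
  assume "a \<in> uS r b"
  then show "fmem (chk r a) (chk r b) p" unfolding fmem_chk by (intro db_I) (use feq_refl in blast)
qed

end

section \<open>Colourings in the extension\<close>

lemma ext_IsUPair1: "ext (\<lambda>z. IsUPair z a b)" and ext_IsUPair3: "ext (\<lambda>b. IsUPair z a b)"
  and ext_IsUPair2: "ext (\<lambda>a. IsUPair z a b)" and ext_IsUPair23: "ext (\<lambda>a. IsUPair z a a)"
  unfolding IsUPair_def by (intro ext_Forall ext_Iff ext_Disj ext_basic)+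

lemma ext_IsOPair1: "ext (\<lambda>z. IsOPair z a b)" and ext_IsOPair2: "ext (\<lambda>a. IsOPair z a b)"
  and ext_IsOPair3: "ext (\<lambda>b. IsOPair z a b)"
  unfolding IsOPair_def
  by (intro ext_Exists ext_Conj ext_basic ext_IsUPair1 ext_IsUPair2 ext_IsUPair3 ext_IsUPair23)+

lemma ext_App: "ext (\<lambda>x. App f x y)" "ext (\<lambda>y. App f x y)"
  unfolding App_def ExistsIn_def by (intro ext_Exists ext_Conj ext_basic ext_IsOPair2 ext_IsOPair3)+

lemma upn_commute: "feq (upn a b) (upn b a) p"
  unfolding feq_iff pelts_upn by (auto intro!: fmem_upnI simp: feq_refl)

text \<open>The conclusion inside \<open>Homogeneous\<close>, isolated so that its invariance in
  \<open>u\<close> can be stated.\<close>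

definition has_colour ::
  "('i, 'p) pname \<Rightarrow> (('i, 'p) pname \<Rightarrow> ('i, 'p) pname sform) \<Rightarrow> ('i, 'p) pname \<Rightarrow> ('i, 'p) pname sform" where
  "has_colour c Col u = Exists (\<lambda>i. Conj (Col i) (App c u i))"

lemma ext_has_colour: "ext (has_colour c Col)"
  unfolding has_colour_def[abs_def] by (intro ext_Exists ext_Conj ext_basic ext_App)

lemma fc_InPairs:
  assumes u: "u \<in> pn"
  shows "fc (InPairs u A) p \<longleftrightarrow>
     db p {q. \<exists>a\<in>pn. \<exists>b\<in>pn. fmem a A q \<and> fmem b A q \<and> (\<forall>v\<in>P. le v q \<longrightarrow> \<not> feq a b v) \<and> feq u (upn a b) q}"
    (is "_ \<longleftrightarrow> db p ?D")
proof
  assume "fc (InPairs u A) p"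
  then have "db p {q. \<exists>a\<in>pn. fmem a A q \<and> db q {v. \<exists>b\<in>pn. fmem b A v \<and> (\<forall>w\<in>P. le w v \<longrightarrow> \<not> feq a b w) \<and>
     feq u (upn a b) v}}"
    unfolding InPairs_def fc_ExistsIn by (simp add: fc_IsUPair u cong: bex_cong)
  then show "db p ?D"
  proof (rule db_bindE, goal_cases)
    case (1 q)
    then obtain a where a: "a \<in> pn" "fmem a A q"
      "db q {v. \<exists>b\<in>pn. fmem b A v \<and> (\<forall>w\<in>P. le w v \<longrightarrow> \<not> feq a b w) \<and> feq u (upn a b) v}" by blast
    show ?case by (rule db_weaken[OF a(3)]) (use a(1) fmem_mono[OF a(2)] in blast)
  qed
next
  assume D: "db p ?D"
  show "fc (InPairs u A) p"
    unfolding InPairs_def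
  proof (subst fc_ExistsIn, rule db_weaken[OF D])
    fix q assume "q \<in> ?D"
    then obtain a b where ab: "a \<in> pn" "b \<in> pn" "fmem a A q" "fmem b A q" "\<forall>v\<in>P. le v q \<longrightarrow> \<not> feq a b v"
      "feq u (upn a b) q" by blast
    have "fc (Conj (Neg (Eq a b)) (IsUPair u a b)) v" if "le v q" for v
      using ab that feq_mono[OF ab(6) that] le_trans[OF _ that] by (simp add: fc_IsUPair u)
    then have "fc (ExistsIn A (\<lambda>b. Conj (Neg (Eq a b)) (IsUPair u a b))) q"
      unfolding fc_ExistsIn by (intro db_I) (use ab(2) fmem_mono[OF ab(4)] in blast)
    then show "q \<in> {q. \<exists>t\<in>pn. fmem t A q \<and> fc (ExistsIn A (\<lambda>b. Conj (Neg (Eq t b)) (IsUPair u t b))) q}"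
      using ab by blast
  qed
qed

text \<open>Densely \<open>c\<close> has a value \<open>i\<close> at \<open>u\<close>. The pair of
  \<open>u\<close> and \<open>i\<close> belongs to \<open>c\<close>, so it equals a pair with second
  entry zero or one, and \<open>opn_inj\<close> passes this on to \<open>i\<close>; the value one is
  excluded by \<open>no_green\<close>.\<close>

lemma colouring_dichotomy:
  assumes c: "c \<in> pn" and u: "u \<in> pn" and p: "p \<in> P" and col: "fc (IsColouring c L) p"
    and pair: "fc (InPairs u L) p"
    and no_green: "\<And>q. q \<in> P \<Longrightarrow> le q p \<Longrightarrow> \<not> fc (has_colour c IsOne u) q"
  shows "fc (has_colour c IsZero u) p"
proof -
  have c1: "fc (Forall (\<lambda>z. Imp (Mem z c) (Exists (\<lambda>x. Exists (\<lambda>y. Conj (Conj (InPairs x L)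
      (Disj (IsZero y) (IsOne y))) (IsOPair z x y)))))) p"
    and c2: "fc (Forall (\<lambda>x. Imp (InPairs x L) (Exists (\<lambda>y. App c x y)))) p"
    using col unfolding IsColouring_def IsFun_def ForallIn_def by simp_all
  have "fc (Exists (\<lambda>y. App c u y)) p"
    using c2 u pair p le_refl unfolding fc_Forall fc_Imp by blast
  then have "db p {q. \<exists>i\<in>pn. fmem (opn u i) c q}" unfolding fc_Exists by (simp add: fc_App c u cong: bex_cong)
  then show ?thesis
  proof (rule fc_bindE)
    fix q assume q: "q \<in> P" "le q p" and "\<exists>i\<in>pn. fmem (opn u i) c q"
    then obtain i where i: "i \<in> pn" "fmem (opn u i) c q" by blast
    let ?z = "opn u i"
    have z: "?z \<in> pn" by (rule opn_pn[OF u i(1)])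
    have appi: "fc (App c u i) q" using i by (simp add: fc_App c u)
    have "fc (Exists (\<lambda>x. Exists (\<lambda>y. Conj (Conj (InPairs x L) (Disj (IsZero y) (IsOne y))) (IsOPair ?z x y)))) q"
      using c1 z q(1,2) i(2) unfolding fc_Forall fc_Imp by simp
    then have "db q {v. \<exists>x\<in>pn. db v {w. \<exists>y\<in>pn. fc (Disj (IsZero y) (IsOne y)) w \<and> feq ?z (opn x y) w}}"
      unfolding fc_Exists by (simp add: fc_IsOPair z cong: bex_cong) (erule db_weaken, force elim: db_weaken)
    then show "fc (has_colour c IsZero u) q"
    proof (rule fc_bindE, goal_cases)
      case (1 v)
      then obtain x where "db v {w. \<exists>y\<in>pn. fc (Disj (IsZero y) (IsOne y)) w \<and> feq ?z (opn x y) w}" by blast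
      then show ?case
      proof (rule fc_bindE, goal_cases)
        case w: (1 w)
        then obtain y where y: "fc (Disj (IsZero y) (IsOne y)) w" "feq ?z (opn x y) w" by blast
        have yi: "feq y i w" by (rule feq_sym[OF opn_inj(2)[OF y(2) w(1)]])
        have wq: "le w q" by (rule le_trans[OF w(2) 1(2)])
        show ?case
        proof (rule fc_bindE[OF y(1)[unfolded fc_Disj]])
          fix t assume t: "t \<in> P" "le t w" "fc (IsZero y) t \<or> fc (IsOne y) t"
          have tq: "le t q" by (rule le_trans[OF t(2) wq])
          have col: "fc (has_colour c Col u) t" if "fc (Col i) t" for Col
            unfolding has_colour_def using that fc_mono[OF appi tq] i(1) by (intro fc_ExistsI[of i]) simp_all
          note yit = feq_mono[OF yi t(2)]
          have "\<not> fc (IsOne y) t"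
            using col[of IsOne] extD[OF ext_IsOne yit] no_green[OF t(1) le_trans[OF tq q(2)]] by blast
          then show "fc (has_colour c IsZero u) t" using t(3) col[of IsZero] extD[OF ext_IsZero yit] by blast
        qed
      qed
    qed
  qed
qed

section \<open>Names of sets enumerated by a relation \<open>En m x q\<close>: \<open>q\<close>
  decides that the \<open>m\<close>-th element is \<open>x\<close>\<close>

context
  fixes r :: "'a rel" and z :: "'b rel" and En :: "'b \<Rightarrow> 'a \<Rightarrow> 'p \<Rightarrow> bool" and p :: 'p
  assumes r: "Well_order r" and r_sz: "|Field r| \<le>o |Iset|"
    and z: "Well_order z" and z_sz: "|Field z| \<le>o |Iset|"
    and P_sz: "|P| \<le>o |Iset|" and p: "p \<in> P"
    and En: "\<And>m x q. En m x q \<Longrightarrow> m \<in> Field z \<and> x \<in> Field r \<and> q \<in> P"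
    and En_mono: "\<And>m x q v. En m x q \<Longrightarrow> v \<in> P \<Longrightarrow> le v q \<Longrightarrow> En m x v"
    and En_total: "\<And>m. m \<in> Field z \<Longrightarrow> db p {q. \<exists>x. En m x q}"
    and En_unique: "\<And>m m' x x' q. En m x q \<Longrightarrow> En m' x' q \<Longrightarrow> m = m' \<longleftrightarrow> x = x'"
begin

abbreviation at where "at u w m x v \<equiv> En m x v \<and> feq u (chk r x) v \<and> feq w (chk z m) v"
abbreviation at2 where "at2 u w u' w' v \<equiv> \<exists>m x m' x'. at u w m x v \<and> at u' w' m' x' v"

definition enum_set :: "('i, 'p) pname" where
  "enum_set = name_of {(chk r x, q) | m x q. En m x q}"

definition enum_fun :: "('i, 'p) pname" where
  "enum_fun = name_of {(opn (chk r x) (chk z m), q) | m x q. En m x q}"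

lemma pelts_enum_set: "pelts enum_set = {(chk r x, q) | m x q. En m x q}"
  and pelts_enum_fun: "pelts enum_fun = {(opn (chk r x) (chk z m), q) | m x q. En m x q}"
proof -
  let ?T = "Field z \<times> Field r \<times> P"
  have T: "|?T| \<le>o |Iset|"
    by (intro card_of_Times_le[OF inf_i] z_sz r_sz P_sz)
  have "{(chk r x, q) | m x q. En m x q} \<subseteq> (\<lambda>(m, x, q). (chk r x, q)) ` ?T"
    using En by force
  then show "pelts enum_set = {(chk r x, q) | m x q. En m x q}"
    unfolding enum_set_def by (intro pelts_name_of card_of_subset_le[OF _ card_of_image_le[OF T]])
  have "{(opn (chk r x) (chk z m), q) | m x q. En m x q} \<subseteq> (\<lambda>(m, x, q). (opn (chk r x) (chk z m), q)) ` ?T"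
    using En by force
  then show "pelts enum_fun = {(opn (chk r x) (chk z m), q) | m x q. En m x q}"
    unfolding enum_fun_def by (intro pelts_name_of card_of_subset_le[OF _ card_of_image_le[OF T]])
qed

lemmas cpn = chk_pn[OF r r_sz] chk_pn[OF z z_sz]

lemma enum_set_pn: "enum_set \<in> pn" and enum_fun_pn: "enum_fun \<in> pn"
  by (rule pnames.intros; use En cpn opn_pn in \<open>auto simp: pelts_enum_set pelts_enum_fun\<close>)+

lemma fmem_enum_set: "fmem u enum_set q \<longleftrightarrow> db q {v. \<exists>m x. En m x v \<and> feq u (chk r x) v}"
  unfolding fmem_iff pelts_enum_set
proof (rule iffI; erule db_weaken)
  fix v assume "v \<in> P" "v \<in> {q. \<exists>y ra. (y, ra) \<in> {(chk r x, q) |m x q. En m x q} \<and> le q ra \<and> feq u y q}"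
  then show "v \<in> {v. \<exists>m x. En m x v \<and> feq u (chk r x) v}" using En_mono by blast
next
  fix v assume "v \<in> P" "v \<in> {v. \<exists>m x. En m x v \<and> feq u (chk r x) v}"
  then show "v \<in> {q. \<exists>y ra. (y, ra) \<in> {(chk r x, q) |m x q. En m x q} \<and> le q ra \<and> feq u y q}"
    using le_refl by blast
qed

lemma fc_App_enum:
  assumes "u \<in> pn" "w \<in> pn"
  shows "fc (App enum_fun u w) q \<longleftrightarrow> db q {v. \<exists>m x. at u w m x v}"
  unfolding fc_App[OF enum_fun_pn assms] fmem_iff pelts_enum_fun
proof (rule iffI; erule db_weaken)
  fix v assume v: "v \<in> P" "v \<in> {q. \<exists>y ra. (y, ra) \<in> {(opn (chk r x) (chk z m), q) |m x q. En m x q} \<and> le q ra \<and> feq (opn u w) y q}"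
  then obtain m x v' where "En m x v'" "le v v'" and eq: "feq (opn u w) (opn (chk r x) (chk z m)) v" by blast
  then have "En m x v" using En_mono v(1) by blast
  then show "v \<in> {v. \<exists>m x. at u w m x v}"
    using opn_inj[OF eq v(1)] by blast
next
  fix v assume "v \<in> P" "v \<in> {v. \<exists>m x. at u w m x v}"
  then show "v \<in> {q. \<exists>y ra. (y, ra) \<in> {(opn (chk r x) (chk z m), q) |m x q. En m x q} \<and> le q ra \<and> feq (opn u w) y q}"
    using le_refl opn_cong by blast
qed

lemma fc_App_enumI: "En m x q \<Longrightarrow> q \<in> P \<Longrightarrow> feq u (chk r x) q \<Longrightarrow> feq w (chk z m) q \<Longrightarrow> u \<in> pn \<Longrightarrow> w \<in> pn \<Longrightarrow>
    fc (App enum_fun u w) q"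
  unfolding fc_App_enum by (rule db_I) (use En_mono feq_mono in blast)

lemma App_enum_two:
  assumes "fc (App enum_fun u w) q" "fc (App enum_fun u' w') q" and pn: "u \<in> pn" "w \<in> pn" "u' \<in> pn" "w' \<in> pn"
  shows "db q {v. at2 u w u' w' v}"
proof (rule db_bindE[OF assms(1)[unfolded fc_App_enum[OF pn(1,2)]]], goal_cases)
  case (1 v)
  then obtain m x where x: "En m x v" "feq u (chk r x) v" "feq w (chk z m) v" by blast
  show ?case
    by (rule db_weaken[OF db_mono[OF assms(2)[unfolded fc_App_enum[OF pn(3,4)]] 1(2)]])
      (use En_mono[OF x(1)] feq_mono[OF x(2)] feq_mono[OF x(3)] in blast)
qed

text \<open>\<open>En_total\<close> gives surjectivity; \<open>En_unique\<close>, with the fact that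
  distinct canonical names are never forced equal, gives both functionality and injectivity.\<close>

lemma fc_IsBij_enum: "fc (IsBij enum_fun enum_set (cho z)) p"
proof -
  have 1: "fc (ForallIn enum_fun (\<lambda>w. Exists (\<lambda>x. Exists (\<lambda>y. Conj (Conj (Mem x enum_set) (Mem y (cho z))) (IsOPair w x y))))) p"
  proof (rule fc_ForallInI, goal_cases)
    case 1
    show ?case by (intro ext_Exists ext_Conj ext_basic ext_IsOPair1)
  next
    case (2 y q' q)
    then obtain m x where y: "y = opn (chk r x) (chk z m)" and "En m x q'" by (auto simp: pelts_enum_fun)
    then have E: "En m x q" using En_mono 2 by blast
    have "fmem (chk r x) enum_set q"
      unfolding fmem_enum_set by (rule db_I) (use En_mono[OF E] feq_refl in blast)
    moreover have "fmem (chk z m) (cho z) q"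
      unfolding fmem_cho[OF z z_sz] by (rule db_I) (use En[OF E] feq_refl in blast)
    ultimately have "fc (Conj (Conj (Mem (chk r x) enum_set) (Mem (chk z m) (cho z))) (IsOPair y (chk r x) (chk z m))) q"
      by (simp add: fc_IsOPair y opn_pn cpn feq_refl)
    then show ?case by (intro fc_ExistsI[OF cpn(1)] fc_ExistsI[OF cpn(2)])
  qed
  have 2: "fc (Exists (\<lambda>y. App enum_fun u y)) q" if u: "u \<in> pn" and m: "fmem u enum_set q" for u q
    unfolding fc_Exists
  proof (rule db_weaken[OF m[unfolded fmem_enum_set]])
    fix v assume v: "v \<in> P" "v \<in> {v. \<exists>m x. En m x v \<and> feq u (chk r x) v}"
    then obtain m x where "En m x v" "feq u (chk r x) v" by blast
    then have "fc (App enum_fun u (chk z m)) v" using v(1) u cpn feq_refl by (intro fc_App_enumI)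
    then show "v \<in> {q. \<exists>t\<in>pn. fc (App enum_fun u t) q}" using cpn by blast
  qed
  have 3: "feq w w' q" if "fc (App enum_fun u w) q" "fc (App enum_fun u w') q" "u \<in> pn" "w \<in> pn" "w' \<in> pn" for u w w' q
  proof (rule feq_bindE[OF App_enum_two[OF that(1,2,3,4,3,5)]], goal_cases)
    case (1 v)
    then obtain m x m' x' where x: "En m x v" "feq u (chk r x) v" "feq w (chk z m) v"
      "En m' x' v" "feq u (chk r x') v" "feq w' (chk z m') v" by blast
    have "feq (chk r x) (chk r x') v" using feq_trans[OF feq_sym[OF x(2)] x(5)] .
    then have "x = x'" using feq_chk[OF r r_sz _ _ 1(1)] En[OF x(1)] En[OF x(4)] by blast
    then have "m = m'" using En_unique[OF x(1,4)] by blast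
    then show ?case using feq_trans[OF x(3) feq_sym[OF x(6)[folded \<open>m = m'\<close>]]] by simp
  qed
  have 4: "fc (ForallIn (cho z) (\<lambda>y. Exists (\<lambda>x. App enum_fun x y))) p"
  proof (rule fc_ForallInI, goal_cases)
    case 1
    show ?case by (intro ext_Exists ext_App)
  next
    case (2 y e' q)
    then obtain m where m: "m \<in> Field z" "y = chk z m" by (auto simp: pelts_cho[OF z_sz])
    show ?case
      unfolding fc_Exists
    proof (rule db_weaken[OF db_mono[OF En_total[OF m(1)] 2(3)]])
      fix v assume v: "v \<in> P" "v \<in> {q. \<exists>x. En m x q}"
      then obtain x where "En m x v" by blast
      then have "fc (App enum_fun (chk r x) y) v"
        unfolding m(2) using v(1) cpn feq_refl by (intro fc_App_enumI)
      then show "v \<in> {q. \<exists>t\<in>pn. fc (App enum_fun t y) q}" using cpn by blast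
    qed
  qed
  have 5: "feq u u' q" if "fc (App enum_fun u w) q" "fc (App enum_fun u' w) q" "u \<in> pn" "u' \<in> pn" "w \<in> pn" for u u' w q
  proof (rule feq_bindE[OF App_enum_two[OF that(1,2,3,5,4,5)]], goal_cases)
    case (1 v)
    then obtain m x m' x' where x: "En m x v" "feq u (chk r x) v" "feq w (chk z m) v"
      "En m' x' v" "feq u' (chk r x') v" "feq w (chk z m') v" by blast
    have "feq (chk z m) (chk z m') v" using feq_trans[OF feq_sym[OF x(3)] x(6)] .
    then have "m = m'" using feq_chk[OF z z_sz _ _ 1(1)] En[OF x(1)] En[OF x(4)] by blast
    then have "x = x'" using En_unique[OF x(1,4)] by blast
    then show ?case using feq_trans[OF x(2) feq_sym[OF x(5)[folded \<open>x = x'\<close>]]] by simp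
  qed
  show ?thesis
    unfolding IsBij_def IsFun_def using 1 2 3 4 5 by (simp add: fc_Imp) blast
qed

lemma fc_Subset_enum: "fc (Subset enum_set (cho r)) p"
  unfolding Subset_def
proof (rule fc_ForallInI[OF ext_basic(1)])
  fix y ra q assume "(y, ra) \<in> pelts enum_set"
  then obtain m x where "y = chk r x" "En m x ra" by (auto simp: pelts_enum_set)
  then show "fc (Mem y (cho r)) q"
    using En feq_refl by (simp add: fmem_cho[OF r r_sz]) (intro db_I, blast)
qed

text \<open>A forced pair from the set is densely a pair of two distinct canonical names, where
  \<open>col\<close> applies; \<open>ext_has_colour\<close> transfers the colour back.\<close>

lemma fc_Homogeneous_enum:
  assumes col: "\<And>m x m' x' q. En m x q \<Longrightarrow> En m' x' q \<Longrightarrow> x \<noteq> x' \<Longrightarrow>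
      fc (has_colour c Col (upn (chk r x) (chk r x'))) q"
  shows "fc (Homogeneous c enum_set Col) p"
proof -
  have "fc (has_colour c Col u) q" if u: "u \<in> pn" and ip: "fc (InPairs u enum_set) q" for u q
  proof (rule fc_bindE[OF ip[unfolded fc_InPairs[OF u]]], goal_cases)
    case (1 v)
    then obtain a b where ab: "fmem a enum_set v" "fmem b enum_set v" "\<And>w. w \<in> P \<Longrightarrow> le w v \<Longrightarrow> \<not> feq a b w"
      "feq u (upn a b) v" by blast
    show ?case
    proof (rule fc_bindE[OF ab(1)[unfolded fmem_enum_set]])
      fix w assume w: "w \<in> P" "le w v" "\<exists>m x. En m x w \<and> feq a (chk r x) w"
      then obtain m x where x: "En m x w" "feq a (chk r x) w" by blast
      show "fc (has_colour c Col u) w"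
      proof (rule fc_bindE[OF db_mono[OF ab(2)[unfolded fmem_enum_set] w(2)]])
        fix t assume t: "t \<in> P" "le t w" "\<exists>m x. En m x t \<and> feq b (chk r x) t"
        then obtain m' x' where x': "En m' x' t" "feq b (chk r x') t" by blast
        have xt: "En m x t" "feq a (chk r x) t" using En_mono[OF x(1) t(1,2)] feq_mono[OF x(2) t(2)] by auto
        have tv: "le t v" by (rule le_trans[OF t(2) w(2)])
        have "x \<noteq> x'" using ab(3)[OF t(1) tv] feq_trans[OF xt(2)] feq_sym[OF x'(2)] by blast
        then have "fc (has_colour c Col (upn (chk r x) (chk r x'))) t" by (rule col[OF xt(1) x'(1)])
        moreover have "feq (upn (chk r x) (chk r x')) u t"
          by (rule feq_sym[OF feq_trans[OF feq_mono[OF ab(4) tv] upn_cong[OF xt(2) x'(2)]]])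
        ultimately show "fc (has_colour c Col u) t" using extD[OF ext_has_colour] by blast
      qed
    qed
  qed
  then show ?thesis unfolding Homogeneous_def by (simp add: fc_Imp has_colour_def)
qed

text \<open>Membership between canonical names is decided by the ground-model orders, so
  \<open>ord\<close> yields the equivalence at every extension.\<close>

lemma fc_HasOrderType_enum:
  assumes ord: "\<And>m x m' x' q. En m x q \<Longrightarrow> En m' x' q \<Longrightarrow> x \<in> uS r x' \<longleftrightarrow> m \<in> uS z m'"
  shows "fc (HasOrderType enum_set (cho z)) p"
  unfolding HasOrderType_def
proof (rule fc_ExistsI[OF enum_fun_pn])
  have "fc (Iff (Mem u u') (Mem w w')) q"
    if a: "fc (App enum_fun u w) q" "fc (App enum_fun u' w') q" and pn: "u \<in> pn" "w \<in> pn" "u' \<in> pn" "w' \<in> pn"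
    for u u' w w' q
  proof (rule fc_bindE[OF App_enum_two[OF a pn]], goal_cases)
    case (1 v)
    then obtain m x m' x' where x: "En m x v" "feq u (chk r x) v" "feq w (chk z m) v"
      "En m' x' v" "feq u' (chk r x') v" "feq w' (chk z m') v" by blast
    have "fmem u u' t \<longleftrightarrow> fmem w w' t" if t: "t \<in> P" "le t v" for t
    proof -
      note xt = x(2,3,5,6)[THEN feq_mono, OF t(2)]
      have "fmem u u' t \<longleftrightarrow> fmem (chk r x) (chk r x') t"
        using fmem_eq1 fmem_eq2 xt feq_sym by meson
      also have "\<dots> \<longleftrightarrow> x \<in> uS r x'" using fmem_chk_chk[OF r r_sz _ _ t(1)] En[OF x(1)] En[OF x(4)] by blast
      also have "\<dots> \<longleftrightarrow> m \<in> uS z m'" by (rule ord[OF x(1,4)])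
      also have "\<dots> \<longleftrightarrow> fmem (chk z m) (chk z m') t"
        using fmem_chk_chk[OF z z_sz _ _ t(1)] En[OF x(1)] En[OF x(4)] by blast
      also have "\<dots> \<longleftrightarrow> fmem w w' t" using fmem_eq1 fmem_eq2 xt feq_sym by meson
      finally show ?thesis .
    qed
    then show ?case by (simp add: fc_Iff)
  qed
  then show "fc (Conj (IsBij enum_fun enum_set (cho z))
       (Forall (\<lambda>x. Forall (\<lambda>x'. Forall (\<lambda>y. Forall (\<lambda>y'.
          Imp (Conj (App enum_fun x y) (App enum_fun x' y')) (Iff (Mem x x') (Mem y y')))))))) p"
    using fc_IsBij_enum by (simp add: fc_Imp)
qed

lemma fc_Exists_equipotent_homogeneous:
  assumes "\<And>m x m' x' q. En m x q \<Longrightarrow> En m' x' q \<Longrightarrow> x \<noteq> x' \<Longrightarrow>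
      fc (has_colour c Col (upn (chk r x) (chk r x'))) q"
  shows "fc (Exists (\<lambda>X. Conj (Subset X (cho r)) (Conj (Equipotent X (cho z)) (Homogeneous c X Col)))) p"
proof (rule fc_ExistsI[OF enum_set_pn])
  have "fc (Equipotent enum_set (cho z)) p"
    unfolding Equipotent_def by (rule fc_ExistsI[OF enum_fun_pn]) (rule fc_IsBij_enum)
  moreover have "fc (Homogeneous c enum_set Col) p" by (rule fc_Homogeneous_enum) (rule assms)
  ultimately show "fc (Conj (Subset enum_set (cho r)) (Conj (Equipotent enum_set (cho z)) (Homogeneous c enum_set Col))) p"
    using fc_Subset_enum by simp
qed

lemma fc_Exists_order_type_homogeneous:
  assumes "\<And>m x m' x' q. En m x q \<Longrightarrow> En m' x' q \<Longrightarrow> x \<noteq> x' \<Longrightarrow>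
      fc (has_colour c Col (upn (chk r x) (chk r x'))) q"
    and "\<And>m x m' x' q. En m x q \<Longrightarrow> En m' x' q \<Longrightarrow> x \<in> uS r x' \<longleftrightarrow> m \<in> uS z m'"
  shows "fc (Exists (\<lambda>Y. Conj (Subset Y (cho r)) (Conj (HasOrderType Y (cho z)) (Homogeneous c Y Col)))) p"
proof (rule fc_ExistsI[OF enum_set_pn])
  have "fc (HasOrderType enum_set (cho z)) p" by (rule fc_HasOrderType_enum) (rule assms(2))
  moreover have "fc (Homogeneous c enum_set Col) p" by (rule fc_Homogeneous_enum) (rule assms(1))
  ultimately show "fc (Conj (Subset enum_set (cho r)) (Conj (HasOrderType enum_set (cho z)) (Homogeneous c enum_set Col))) p"
    using fc_Subset_enum by simp
qed

end

lemma fc_InPairs_chk: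
  fixes r :: "'a rel"
  assumes r: "Well_order r" and sz: "|Field r| \<le>o |Iset|"
    and ab: "a \<in> Field r" "b \<in> Field r" "a \<noteq> b"
  shows "fc (InPairs (upn (chk r a) (chk r b)) (cho r)) p"
  unfolding fc_InPairs[OF upn_pn[OF chk_pn[OF r sz] chk_pn[OF r sz]]]
proof (rule db_I, rule CollectI, rule bexI[OF _ chk_pn[OF r sz, of a]], rule bexI[OF _ chk_pn[OF r sz, of b]],
    intro conjI ballI impI)
  have m: "fmem (chk r x) (cho r) q" if "x \<in> Field r" for x q
    unfolding fmem_cho[OF r sz] by (rule db_I) (use feq_refl that in blast)
  show "fmem (chk r a) (cho r) q" for q by (rule m[OF ab(1)])
  show "fmem (chk r b) (cho r) q" for q by (rule m[OF ab(2)])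
  show "\<not> feq (chk r a) (chk r b) v" if "v \<in> P" for v using feq_chk[OF r sz ab(1,2) that] ab(3) by blast
  show "feq (upn (chk r a) (chk r b)) (upn (chk r a) (chk r b)) q" for q by (rule feq_refl)
qed

end

section \<open>The theorem\<close>

text \<open>Inverse of \<open>Map.graph\<close> on single-valued relations; on others the value
  \<open>True\<close> takes precedence.\<close>

definition ungraph :: "('a \<times> bool) set \<Rightarrow> 'a \<rightharpoonup> bool" where
  "ungraph g = (\<lambda>x. if (x, True) \<in> g then Some True else if (x, False) \<in> g then Some False else None)"

lemma ungraph_graph [simp]: "ungraph (Map.graph p) = p"
proof
  fix x show "ungraph (Map.graph p) x = p x"
    by (cases "p x"; cases "the (p x)") (auto simp: ungraph_def Map.graph_def)
qed

lemma graph_ungraph: "single_valued g \<Longrightarrow> Map.graph (ungraph g) = g"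
  unfolding ungraph_def Map.graph_def single_valued_def
  by (auto split: if_splits) (metis (full_types))+

lemma graph_subset_iff: "Map.graph p \<subseteq> Map.graph q \<longleftrightarrow> p \<subseteq>\<^sub>m q"
  unfolding Map.graph_def map_le_def dom_def by auto

lemma cond_graph_iff: "cond s (Field n \<times> Field s) (Map.graph p) \<longleftrightarrow> p \<in> cohen_conds n s"
proof -
  have "|dom p| \<le>o |Map.graph p|" by (metis card_of_image fst_graph_eq_dom)
  note 1 = ordLeq_ordLess_trans[OF this]
  have "|Map.graph p| \<le>o |dom p|" by (metis card_of_image graph_eq_to_snd_dom)
  note 2 = ordLeq_ordLess_trans[OF this]
  have "|Map.graph p| <o s \<longleftrightarrow> |dom p| <o s" by (rule iffI[OF 1 2])
  moreover have "single_valued (Map.graph p)" by (auto simp: single_valued_def Map.graph_def)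
  ultimately show ?thesis by (simp add: cond_def cohen_conds_def fst_graph_eq_dom)
qed

theorem mainTheorem5:
  fixes kappa :: "'k rel" and sigma :: "'s rel" and lam :: "'l rel" and nu :: "'n rel"
    and zeta :: "'z rel"
  assumes "Card_order kappa" and "Card_order sigma" and "Card_order lam" and "Card_order nu"
    and "natLeq <o kappa" and "kappa <o sigma" and "sigma =o weak_power sigma"
    and "sigma <o lam"
    and "is_cofinality kappa lam" and "kappa \<le>o nu"
    and "strong_limit lam"
    and "Well_order zeta" and "zeta <o kappa"
    and "arrow kappa zeta"
    \<comment> \<open>the index type for names is large enough for \<open>lam\<close> and the forcing notion to have names\<close>
    and "lam \<le>o |UNIV :: 'i set|" and "|cohen_conds nu sigma| \<le>o |UNIV :: 'i set|"
  shows "holds_in_extension (cohen_conds nu sigma) cohen_le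
           (Arrow (check_ord lam Map.empty) (check_ord zeta Map.empty)
              :: ('i, 'n \<times> 's \<rightharpoonup> bool) pname sform)"
proof -
  let ?P = "cohen_conds nu sigma" and ?e = "Map.empty :: 'n \<times> 's \<rightharpoonup> bool"
  have wo: "Well_order lam" using assms(3) card_order_on_well_order_on by blast
  have s_inf: "infinite (Field sigma)"
  proof -
    have "natLeq <o sigma" by (rule ordLess_transitive[OF assms(5,6)])
    then have "|UNIV :: nat set| \<le>o |Field sigma|"
      using card_of_mono2[OF ordLess_imp_ordLeq] by (metis Field_natLeq)
    then show ?thesis using card_of_ordLeq_infinite infinite_UNIV_nat by blast
  qed
  have lam_sz: "|Field lam| \<le>o |UNIV :: 'i set|"
    by (rule ordIso_ordLeq_trans[OF card_of_Field_ordIso[OF assms(3)] assms(15)])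
  have "|Field sigma| \<le>o |Field lam|" by (rule card_of_mono2[OF ordLess_imp_ordLeq[OF assms(8)]])
  then have inf_i: "infinite (UNIV :: 'i set)"
    using ordLeq_transitive[OF _ lam_sz] card_of_ordLeq_infinite s_inf by blast
  have z_lam: "zeta <o lam"
    by (rule ordLess_transitive[OF assms(13) ordLess_transitive[OF assms(6,8)]])
  have z_sz: "|Field zeta| \<le>o |UNIV :: 'i set|"
    by (rule ordLeq_transitive[OF card_of_mono2[OF ordLess_imp_ordLeq[OF z_lam]] lam_sz])
  have "|{} :: ('n \<times> 's) set| <o sigma"
    by (rule finite_ordLess_infinite[OF card_of_Well_order _ _ s_inf])
      (use assms(2) card_order_on_well_order_on in \<open>auto simp: Field_card_of\<close>)
  then have e_P: "?e \<in> ?P" by (simp add: cohen_conds_def)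
  interpret F: forcing ?P cohen_le ?e "TYPE('i)"
    by unfold_locales (use e_P inf_i in \<open>auto simp: cohen_le_def intro: map_le_trans\<close>)
  let ?cnd = "cond sigma (Field nu \<times> Field sigma)"
  have cnd_P: "?cnd g \<Longrightarrow> ungraph g \<in> ?P" "?cnd g \<Longrightarrow> Map.graph (ungraph g) = g" for g
    using cond_graph_iff[of sigma nu "ungraph g"] graph_ungraph[of g] by (auto simp: cond_def)
  have le_graph: "cohen_le p q \<longleftrightarrow> Map.graph q \<subseteq> Map.graph p" for p q
    by (simp add: cohen_le_def graph_subset_iff)
  let ?R = "\<lambda>c. Exists (\<lambda>X. Conj (Subset X (F.cho lam)) (Conj (Equipotent X (F.cho lam)) (Homogeneous c X IsZero)))"
  let ?G = "\<lambda>c. Exists (\<lambda>Y. Conj (Subset Y (F.cho lam)) (Conj (HasOrderType Y (F.cho zeta)) (Homogeneous c Y IsOne)))"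
  \<comment> \<open>A disjunction is forced as soon as densely one disjunct is, so below each
    \<open>p\<close> it suffices to find one \<open>q\<close> deciding which homogeneous set
    exists.\<close>
  have main: "\<exists>q\<in>?P. cohen_le q p \<and> (F.fc (?R c) q \<or> F.fc (?G c) q)"
    if c: "c \<in> F.pn" and p: "p \<in> ?P" and col: "F.fc (IsColouring c (F.cho lam)) p" for c p
  proof -
    let ?u = "\<lambda>a b. F.upn (F.chk lam a) (F.chk lam b)"
    have u: "?u a b \<in> F.pn" for a b by (intro F.upn_pn F.chk_pn[OF wo lam_sz])
    \<comment> \<open>The conjunct \<open>?cnd g\<close> is included because
      \<open>ungraph g\<close> represents \<open>g\<close> faithfully only for conditions.\<close>
    define Grn where "Grn a b g \<longleftrightarrow> ?cnd g \<and> F.fc (F.has_colour c IsOne (?u a b)) (ungraph g)" for a b g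
    interpret C: cohen_singular sigma "Field nu \<times> Field sigma" lam Grn kappa
    proof
      show "regularCard sigma" by (rule regularCard_if_weak_power[OF assms(2) s_inf assms(7)])
      show "Grn b a g" if "Grn a b g" for a b g
        using that F.extD[OF F.ext_has_colour F.upn_commute] unfolding Grn_def by blast
      show "Grn a b g'" if "Grn a b g" "g \<subseteq> g'" "?cnd g'" for a b g g'
      proof -
        have "cohen_le (ungraph g') (ungraph g)"
          using that cnd_P(2)[of g] cnd_P(2)[of g'] by (simp add: le_graph Grn_def)
        then show ?thesis using that F.fc_mono unfolding Grn_def by blast
      qed
    qed (use assms s_inf in auto)
    have green: "F.fc (F.has_colour c IsOne (?u a b)) q" if "Grn a b (Map.graph q)" for a b q
      using that by (simp add: Grn_def)
    \<comment> \<open>No extension forces the pair to be green, so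
      \<open>colouring_dichotomy\<close> makes \<open>q\<close> force it to be red.\<close>
    have red: "F.fc (F.has_colour c IsZero (?u a b)) q"
      if R: "C.Red a b (Map.graph q)" and q: "q \<in> ?P" "cohen_le q p" and ab: "a \<in> Field lam" "b \<in> Field lam" "a \<noteq> b"
      for a b q
    proof (rule F.colouring_dichotomy[OF c u q(1) F.fc_mono[OF col q(2)]])
      show "F.fc (InPairs (?u a b) (F.cho lam)) q" by (rule F.fc_InPairs_chk[OF wo lam_sz ab])
      fix v assume v: "v \<in> ?P" "cohen_le v q"
      then have "?cnd (Map.graph v)" "Map.graph q \<subseteq> Map.graph v" by (auto simp: cond_graph_iff le_graph)
      then show "\<not> F.fc (F.has_colour c IsOne (?u a b)) v"
        using R unfolding C.Red_def Grn_def by auto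
    qed
    have "?cnd (Map.graph p)" using p by (simp add: cond_graph_iff)
    from C.green_or_red[OF assms(12,13,14) this] show ?thesis
    proof (elim disjE exE conjE)
      fix g Y
      assume g: "?cnd g" "Map.graph p \<subseteq> g" and Y: "Y \<subseteq> Field lam" "Restr lam Y =o zeta"
        and gr: "\<forall>a\<in>Y. \<forall>b\<in>Y. a \<noteq> b \<longrightarrow> Grn a b g"
      define q where "q = ungraph g"
      have q: "q \<in> ?P" "cohen_le q p" "Map.graph q = g" using cnd_P[OF g(1)] g(2) by (auto simp: q_def le_graph)
      obtain h where h: "iso zeta (Restr lam Y) h"
        using ordIso_symmetric[OF Y(2)] unfolding ordIso_def by blast
      have FY: "Field (Restr lam Y) = Y"
        using wo Y(1) by (intro Refl_Field_Restr2) (simp_all add: order_on_defs)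
      have h1: "h ` Field zeta = Y" "inj_on h (Field zeta)"
        and h2: "\<And>a b. a \<in> Field zeta \<Longrightarrow> b \<in> Field zeta \<Longrightarrow> (a, b) \<in> zeta \<longleftrightarrow> (h a, h b) \<in> Restr lam Y"
        using h unfolding iso_iff2 FY bij_betw_def by blast+
      \<comment> \<open>The green set lives in the ground model, so every extension of
        \<open>q\<close> enumerates it by the same isomorphism \<open>h\<close>.\<close>
      define En where "En m x v \<longleftrightarrow> v \<in> ?P \<and> cohen_le v q \<and> m \<in> Field zeta \<and> x = h m" for m x v
      have "F.fc (?G c) q"
      proof (rule F.fc_Exists_order_type_homogeneous[OF wo lam_sz assms(12) z_sz assms(16) q(1)])
        show "m \<in> Field zeta \<and> x \<in> Field lam \<and> v \<in> ?P" if "En m x v" for m x v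
          using that h1(1) Y(1) unfolding En_def by blast
        show "En m x w" if "En m x v" "w \<in> ?P" "cohen_le w v" for m x v w
          using that F.le_trans unfolding En_def by blast
        show "F.db q {v. \<exists>x. En m x v}" if "m \<in> Field zeta" for m
          by (rule F.db_I) (use that in \<open>auto simp: En_def\<close>)
        show "m = m' \<longleftrightarrow> x = x'" if "En m x v" "En m' x' v" for m m' x x' v
          using that h1(2) unfolding En_def inj_on_def by blast
        show "F.fc (F.has_colour c IsOne (?u x x')) v" if "En m x v" "En m' x' v" "x \<noteq> x'" for m x m' x' v
        proof -
          have "x \<in> Y" "x' \<in> Y" "cohen_le v q" using that h1(1) unfolding En_def by blast+
          moreover have "F.fc (F.has_colour c IsOne (?u x x')) q"
            using gr that(3) calculation(1,2) by (intro green) (simp add: q(3))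
          ultimately show ?thesis using F.fc_mono by blast
        qed
        show "x \<in> underS lam x' \<longleftrightarrow> m \<in> underS zeta m'" if "En m x v" "En m' x' v" for m x m' x' v
        proof -
          have x: "m \<in> Field zeta" "m' \<in> Field zeta" "x = h m" "x' = h m'" using that unfolding En_def by blast+
          then have "x \<in> Y" "x' \<in> Y" "x = x' \<longleftrightarrow> m = m'" using h1 by (auto simp: inj_on_def)
          then show ?thesis using h2[OF x(1,2)] x(3,4) by (auto simp: underS_def)
        qed
      qed
      then show ?thesis using q(1,2) by blast
    next
      fix g E
      assume g: "?cnd g" "Map.graph p \<subseteq> g" and E: "C.red_enumeration g E"
      define q where "q = ungraph g"
      have q: "q \<in> ?P" "cohen_le q p" "Map.graph q = g" using cnd_P[OF g(1)] g(2) by (auto simp: q_def le_graph)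
      note E' = E[unfolded C.red_enumeration_def]
      note E1 = E'[THEN conjunct1, rule_format]
      note E2 = E'[THEN conjunct2, THEN conjunct1, rule_format]
      note E3 = E'[THEN conjunct2, THEN conjunct2, THEN conjunct1, rule_format]
      note E4 = E'[THEN conjunct2, THEN conjunct2, THEN conjunct2, THEN conjunct1, rule_format]
      note E5 = E'[THEN conjunct2, THEN conjunct2, THEN conjunct2, THEN conjunct2, rule_format]
      \<comment> \<open>\<open>E\<close> is restricted to conditions below \<open>q\<close>, where
        its density clause holds and \<open>c\<close> is forced to be a colouring.\<close>
      define En where "En m x v \<longleftrightarrow> v \<in> ?P \<and> cohen_le v q \<and> E m x (Map.graph v)" for m x v
      have "F.fc (?R c) q"
      proof (rule F.fc_Exists_equipotent_homogeneous[OF wo lam_sz wo lam_sz assms(16) q(1)])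
        show "m \<in> Field lam \<and> x \<in> Field lam \<and> v \<in> ?P" if "En m x v" for m x v
          using that E1 unfolding En_def by blast
        show "En m x w" if "En m x v" "w \<in> ?P" "cohen_le w v" for m x v w
          using that F.le_trans E2[of m x "Map.graph v" "Map.graph w"] unfolding En_def
          by (auto simp: cond_graph_iff le_graph)
        show "F.db q {v. \<exists>x. En m x v}" if m: "m \<in> Field lam" for m
          unfolding dense_below_def
        proof (intro ballI impI)
          fix v assume v: "v \<in> ?P" "cohen_le v q"
          then obtain x r' where r': "Map.graph v \<subseteq> r'" "E m x r'"
            using E3[OF m, of "Map.graph v"] q(3) by (auto simp: cond_graph_iff le_graph)
          have "?cnd r'" using E1[OF r'(2)] by blast
          note w = cnd_P[OF this]
          have "cohen_le (ungraph r') v" using r'(1) w(2) by (simp add: le_graph)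
          moreover from this have "En m x (ungraph r')"
            using w r'(2) v(2) F.le_trans unfolding En_def by auto
          ultimately show "\<exists>w\<in>?P. cohen_le w v \<and> w \<in> {v. \<exists>x. En m x v}" using w(1) by blast
        qed
        show "m = m' \<longleftrightarrow> x = x'" if "En m x v" "En m' x' v" for m m' x x' v
          using that E4 unfolding En_def by blast
        show "F.fc (F.has_colour c IsZero (?u x x')) v" if e: "En m x v" "En m' x' v" "x \<noteq> x'" for m x m' x' v
        proof -
          have v: "v \<in> ?P" "cohen_le v p" using e F.le_trans q(2) unfolding En_def by blast+
          have E: "E m x (Map.graph v)" "E m' x' (Map.graph v)" using e unfolding En_def by blast+
          show ?thesis by (rule red[OF E5[OF E e(3)] v]) (use E1[OF E(1)] E1[OF E(2)] e(3) in auto)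
        qed
      qed
      then show ?thesis using q(1,2) by blast
    qed
  qed
  show ?thesis
    unfolding holds_in_extension_def Arrow_def F.fc_Forall F.fc_Imp F.fc_Disj
  proof (intro ballI impI)
    fix p0 p and c :: "('i, 'n \<times> 's \<rightharpoonup> bool) pname"
    assume c: "c \<in> F.pn" and p: "p \<in> ?P" and col: "F.fc (IsColouring c (F.cho lam)) p"
    show "F.db p {q. F.fc (?R c) q \<or> F.fc (?G c) q}"
      unfolding dense_below_def using main[OF c _ F.fc_mono[OF col]] by blast
  qed
qed

end
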